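(* For fixed integers $a\ge2$, $k\ge1$ and even $d\ge2$, let $q_j$ be the late real poles of $q\mapsto W_{a,d}(q,k)$, indexed by phase as in the context. Then, as $j\to\infty$, $$q_{j+1}-q_j\sim\frac{2\pi k}{3aj^3},\qquad \frac{\operatorname{Res}_{q=q_j}W_{a,d}(q,k)}{q_{j+1}-q_j}\longrightarrow\frac{\sin(\pi/a)}{\pi d}.$$ For any fixed $q_0<1$ sufficiently close to $1$, $$\#\{j:q_0\le q_j\le1-\varepsilon\}=\sqrt{\frac{\pi k}{3a}}\,\varepsilon^{-1/2}+O(1)\qquad(\varepsilon\downarrow0).$$
   Context: $\Phi(q)=\prod_{n\ge1}(1-q^n)$. For $0<|q|<1$, $$W_{a,d}(q,k)=\frac1d\sum_{z^d=1}\frac{\sum_{m\ge0}z^mq^{am+1}\Phi(q^{am+1})^k}{\sum_{m\ge0}z^mq^{a(m+1)}\Phi(q^{a(m+1)})^k},$$ a meromorphic function of $q$ on $0<|q|<1$. For $t>0$ let $\Theta(t)=\pi^{3/2}\sqrt{k/(3t)}$ and $\phi=(k-3)\pi/8$. For even $d$ and every sufficiently large integer $j$, there is exactly one real pole $q_j=e^{-t_j/a}$ of $W_{a,d}(\cdot,k)$ with $t_j>0$ in the window $|\Theta(t_j)-\phi-\pi(j+1/2)|<\pi/4$; these poles are simple, and they are all the real poles sufficiently close to $1$. *)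

theory Defs
  imports "HOL-Complex_Analysis.Complex_Analysis" "HOL-Library.Landau_Symbols"
begin

definition Phi :: "complex \<Rightarrow> complex" where
  "Phi q = (\<Prod>n. 1 - q ^ Suc n)"

text \<open>
  Where a denominator vanishes, the value of \<open>W\<close> is an artefact of division by zero. This is harmless:
  \<^const>\<open>is_pole\<close> and \<^const>\<open>residue\<close> only depend on the values in a punctured neighbourhood.
\<close>
definition W :: "nat \<Rightarrow> nat \<Rightarrow> nat \<Rightarrow> complex \<Rightarrow> complex" where
  "W a d k q = 1 / of_nat d *
     (\<Sum>z | z ^ d = 1.
        (\<Sum>m. z ^ m * q ^ (a * m + 1) * Phi (q ^ (a * m + 1)) ^ k) /
        (\<Sum>m. z ^ m * q ^ (a * (m + 1)) * Phi (q ^ (a * (m + 1))) ^ k))"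

definition Theta :: "nat \<Rightarrow> real \<Rightarrow> real" where
  "Theta k t = pi powr (3 / 2) * sqrt (real k / (3 * t))"

definition phase_shift :: "nat \<Rightarrow> real" where
  "phase_shift k = (real k - 3) * pi / 8"

definition pole_in_window :: "nat \<Rightarrow> nat \<Rightarrow> nat \<Rightarrow> nat \<Rightarrow> real \<Rightarrow> bool" where
  "pole_in_window a d k j x \<longleftrightarrow> is_pole (W a d k) (complex_of_real x) \<and>
     (\<exists>t>0. x = exp (- t / real a) \<and>
        \<bar>Theta k t - phase_shift k - pi * (real j + 1 / 2)\<bar> < pi / 4)"

text \<open>
  The pole \<open>q\<^sub>j\<close> is only meaningful for indices \<open>j\<close> whose window contains exactly one real pole;
  this is the case for all sufficiently large \<open>j\<close> when \<open>d\<close> is even. Counts of indices are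
  restricted to such \<open>j\<close>.
\<close>
definition late_index :: "nat \<Rightarrow> nat \<Rightarrow> nat \<Rightarrow> nat \<Rightarrow> bool" where
  "late_index a d k j \<longleftrightarrow> (\<exists>!x. pole_in_window a d k j x)"

definition late_pole :: "nat \<Rightarrow> nat \<Rightarrow> nat \<Rightarrow> nat \<Rightarrow> real" where
  "late_pole a d k j = (THE x. pole_in_window a d k j x)"

end

theory Submission
  imports Defs "HOL-Real_Asymp.Real_Asymp" "HOL-Probability.Sinc_Integral"
begin

text \<open>
  Put \<open>q = e\<^sup>-\<^sup>t\<^sup>/\<^sup>a\<close> and \<open>g(x) = e\<^sup>-\<^sup>x \<Phi>(e\<^sup>-\<^sup>x)\<^sup>k\<close>, so that numerator and denominator of each term of \<open>W\<close> are
  sums of \<open>z\<^sup>m g((m + s) t)\<close> over \<open>m\<close>, with \<open>s = 1/a\<close> and \<open>s = 1\<close>. Instead of the modularity of the eta function,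
  a telescoping estimate for the logarithmic derivative shows that \<open>g(x)\<close> is asymptotic to a multiple of
  \<open>x\<^sup>-\<^sup>k\<^sup>/\<^sup>2 e\<^sup>-\<^sup>A\<^sup>/\<^sup>x\<close> with \<open>A = k \<pi>\<^sup>2 / 6\<close> as \<open>x\<close> tends to \<open>0\<close> in the sector \<open>\<bar>arg x\<bar> \<le> \<pi>/4\<close>. For \<open>z = e\<^sup>2\<^sup>\<pi>\<^sup>i\<^sup>\<theta>\<close> the residue
  theorem turns the sums into integrals over the two rays \<open>arg x = \<plusminus>\<pi>/4\<close>, with frequencies \<open>\<theta>\<close> and \<open>1 - \<theta>\<close>; each
  ray passes through the saddle point of its integrand, and Laplace's method applies.
  For \<open>z \<noteq> -1\<close> one ray dominates (for \<open>z = 1\<close> all terms are positive), so these denominators have no zeros near \<open>t = 0\<close>.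
  For \<open>z = -1\<close> the two contributions are conjugate and combine to a multiple of \<open>cos (\<Theta>(t) - \<phi> - \<pi> s)\<close>. The denominator
  and its derivative thus determine the zeros, one simple zero for each half period, and the quotient of the
  amplitudes of numerator and derivative gives the residues. Gaps and counts follow from
  \<open>\<Theta>(t\<^sub>j) = \<phi> + \<pi> (j + 1/2) + o(1)\<close>.
\<close>

section \<open>The logarithm of the Euler product\<close>

text \<open>The angle pi/4 is forced by the exponent: for \<open>x = r * (1 + \<i>)\<close> the sum
  of \<open>- A / x\<close> and \<open>\<i> * \<omega> * x\<close> equals
  \<open>- (1 - \<i>) * (A / (2 * r) + \<omega> * r)\<close>, a constant complex number times a real
  function of r. Its minimum is the saddle for every frequency, so one contour serves all t and all
  z, and a single number controls both decay and oscillation. At frequency 1/2 that number is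
  exactly Theta. The phase shift collects three arguments: - k pi/8 from the power of x on the ray,
  pi/4 from dx = (1 + \<i>) dr, and pi/8 from the Gaussian integral with coefficient 1 - \<i>. The
  main obstacle is that Laplace's method gives the denominator at z = -1 only up to o(1) relative to
  its weight. Such an error term cannot be differentiated, yet simplicity of zeros, uniqueness in a
  window and residues all need the derivative. So the ray method is run a second time, on
  \<open>x * summand' k x\<close>, and both runs must share the same constant. Constants that scale
  numerator and denominator alike remain unspecified positive numbers.\<close>

definition log_Phi :: "complex \<Rightarrow> complex" where
  "log_Phi x = (\<Sum>n. Ln (1 - exp (- of_nat (Suc n) * x)))"

definition log_Phi' :: "complex \<Rightarrow> complex" where
  "log_Phi' x = (\<Sum>n. of_nat (Suc n) * exp (- of_nat (Suc n) * x) / (1 - exp (- of_nat (Suc n) * x)))"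

lemma norm_exp_less_1: "Re x > 0 \<Longrightarrow> norm (exp (- of_nat (Suc n) * x)) < 1"
  by (simp add: norm_exp_eq_Re mult_less_0_iff add_nonneg_pos zero_less_mult_iff)

text \<open>Each factor of the product has positive real part. This makes the principal
  \<open>Ln\<close> of it differentiable, inverted by \<open>exp\<close>, and compatible with
  \<open>cnj\<close>.\<close>

lemma one_minus_exp_not_nonpos:
  assumes "Re x > 0"
  shows "1 - exp (- of_nat (Suc n) * x) \<notin> \<real>\<^sub>\<le>\<^sub>0"
proof -
  have "Re (exp (- of_nat (Suc n) * x)) < 1"
    using complex_Re_le_cmod[of "exp (- of_nat (Suc n) * x)"] norm_exp_less_1[OF assms, of n] by linarith
  then show ?thesis
    by (metis complex_nonpos_Reals_iff diff_gt_0_iff_gt minus_complex.sel(1) not_less one_complex.sel(1))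
qed

lemma norm_exp_mult_le:
  assumes "Re y \<ge> \<rho>"
  shows "norm (exp (- of_nat n * y)) \<le> exp (- \<rho>) ^ n"
proof -
  have "norm (exp (- of_nat n * y)) = exp (- (real n * Re y))"
    by (simp add: norm_exp_eq_Re)
  also have "\<dots> \<le> exp (- (real n * \<rho>))"
    using assms by (simp add: mult_left_mono)
  also have "\<dots> = exp (-\<rho>) ^ n"
    by (simp add: exp_of_nat_mult [symmetric])
  finally show ?thesis .
qed

text \<open>Since the logarithm of 1 - w is at most 2 |w| for |w| < 1/2, a geometric series
  dominates the logarithms locally uniformly. Termwise differentiation then gives both series and
  the derivative together.\<close>

lemma log_Phi_aux:
  assumes "Re x > 0"
  shows "(\<lambda>n. Ln (1 - exp (- of_nat (Suc n) * x))) sums log_Phi x"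
    and "(\<lambda>n. of_nat (Suc n) * exp (- of_nat (Suc n) * x) / (1 - exp (- of_nat (Suc n) * x))) sums log_Phi' x"
    and "(log_Phi has_field_derivative log_Phi' x) (at x)"
proof -
  define S where "S = {x::complex. Re x > 0}"
  have S: "open S" by (simp add: S_def open_halfspace_Re_gt)
  have "\<exists>g g'. \<forall>x \<in> S. ((\<lambda>n. Ln (1 - exp (- of_nat (Suc n) * x))) sums g x) \<and>
      ((\<lambda>n. of_nat (Suc n) * exp (- of_nat (Suc n) * x) / (1 - exp (- of_nat (Suc n) * x))) sums g' x) \<and>
      (g has_field_derivative g' x) (at x)"
  proof (rule series_and_derivative_comparison_local[OF S])
    fix n x assume "x \<in> S"
    then have *: "1 - exp (- of_nat (Suc n) * x) \<notin> \<real>\<^sub>\<le>\<^sub>0"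
      by (intro one_minus_exp_not_nonpos) (simp add: S_def)
    then show "((\<lambda>x. Ln (1 - exp (- of_nat (Suc n) * x))) has_field_derivative
       of_nat (Suc n) * exp (- of_nat (Suc n) * x) / (1 - exp (- of_nat (Suc n) * x))) (at x)"
      by (auto intro!: derivative_eq_intros simp del: of_nat_Suc simp: field_simps)
  next
    fix x assume "x \<in> S"
    \<comment> \<open>On the ball of radius \<open>\<rho>\<close> around x the real part stays at
      least \<open>\<rho>\<close>, so one geometric ratio \<open>exp (- \<rho>)\<close> serves the
      whole ball.\<close>
    define \<rho> where "\<rho> = Re x / 2"
    have \<rho>: "\<rho> > 0" using \<open>x \<in> S\<close> by (simp add: S_def \<rho>_def)
    define h where "h n = 2 * exp (-\<rho>) ^ Suc n" for n
    have "summable h"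
      unfolding h_def using \<rho> by (intro summable_mult) (simp add: summable_Suc_iff summable_geometric del: power_Suc)
    moreover have ev: "\<forall>\<^sub>F n in sequentially. exp (-\<rho>) ^ Suc n < 1/2"
    proof -
      have "(\<lambda>n. exp (-\<rho>) ^ Suc n) \<longlonglongrightarrow> 0"
        using \<rho> by (intro LIMSEQ_Suc LIMSEQ_realpow_zero) auto
      then show ?thesis by (rule order_tendstoD) simp
    qed
    moreover have "\<forall>\<^sub>F n in sequentially. \<forall>y\<in>ball x \<rho> \<inter> S. norm (Ln (1 - exp (- of_nat (Suc n) * y))) \<le> h n"
      using ev
    proof eventually_elim
      case (elim n)
      show ?case
      proof
        fix y assume y: "y \<in> ball x \<rho> \<inter> S"
        have "\<bar>Re x - Re y\<bar> < \<rho>"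
          using y abs_Re_le_cmod[of "x - y"] by (auto simp: dist_norm)
        then have "Re y \<ge> \<rho>" by (simp add: \<rho>_def abs_if split: if_splits) 
        from norm_exp_mult_le[OF this, of "Suc n"]
        have 1: "norm (exp (- of_nat (Suc n) * y)) \<le> exp (-\<rho>) ^ Suc n" .
        with elim have "norm (- exp (- of_nat (Suc n) * y)) < 1/2" by (simp only: norm_minus_cancel)
        from norm_Ln_le[OF this] 1 show "norm (Ln (1 - exp (- of_nat (Suc n) * y))) \<le> h n"
          by (simp add: h_def)
      qed
    qed
    ultimately show "\<exists>d h. 0 < d \<and> summable h \<and> (\<forall>\<^sub>F n in sequentially. \<forall>y\<in>ball x d \<inter> S. norm (Ln (1 - exp (- of_nat (Suc n) * y))) \<le> h n)"
      using \<rho> by blast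
  qed
  then obtain g g' where gg0: "\<forall>x \<in> S. ((\<lambda>n. Ln (1 - exp (- of_nat (Suc n) * x))) sums g x) \<and>
      ((\<lambda>n. of_nat (Suc n) * exp (- of_nat (Suc n) * x) / (1 - exp (- of_nat (Suc n) * x))) sums g' x) \<and>
      (g has_field_derivative g' x) (at x)"
    by (elim exE)
  note gg = bspec[OF gg0, THEN conjunct1] bspec[OF gg0, THEN conjunct2, THEN conjunct1]
    bspec[OF gg0, THEN conjunct2, THEN conjunct2]
  have g: "g y = log_Phi y" "g' y = log_Phi' y" if "y \<in> S" for y
    using gg(1,2)[OF that] by (simp_all add: log_Phi_def log_Phi'_def sums_iff)
  have x: "x \<in> S" using assms by (simp add: S_def)
  show "(\<lambda>n. Ln (1 - exp (- of_nat (Suc n) * x))) sums log_Phi x"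
     "(\<lambda>n. of_nat (Suc n) * exp (- of_nat (Suc n) * x) / (1 - exp (- of_nat (Suc n) * x))) sums log_Phi' x"
    using gg(1,2)[OF x] g[OF x] by simp_all
  show "(log_Phi has_field_derivative log_Phi' x) (at x)"
    using has_field_derivative_transform_within_open[OF gg(3)[OF x] S x g(1)] g(2)[OF x] by simp
qed

lemma exp_log_Phi:
  assumes "Re x > 0"
  shows "exp (log_Phi x) = Phi (exp (- x))"
proof -
  have "prodinf (\<lambda>n. exp (Ln (1 - exp (- of_nat (Suc n) * x)))) = exp (log_Phi x)"
    unfolding log_Phi_def using log_Phi_aux(1)[OF assms] by (intro prodinf_exp) (rule sums_summable)
  moreover have "exp (Ln (1 - exp (- of_nat (Suc n) * x))) = 1 - exp (-x) ^ Suc n" for n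
  proof -
    have "1 - exp (- of_nat (Suc n) * x) \<noteq> 0"
      using one_minus_exp_not_nonpos[OF assms, of n] by auto
    moreover have "exp (- of_nat (Suc n) * x) = exp (-x) ^ Suc n"
      by (metis exp_of_nat_mult minus_mult_commute)
    ultimately show ?thesis by (simp add: exp_Ln)
  qed
  ultimately show ?thesis by (simp add: Phi_def del: power_Suc)
qed

lemma log_Phi_cnj:
  assumes "Re x > 0"
  shows "log_Phi (cnj x) = cnj (log_Phi x)" "log_Phi' (cnj x) = cnj (log_Phi' x)"
proof -
  have "(\<lambda>n. cnj (Ln (1 - exp (- of_nat (Suc n) * x)))) sums cnj (log_Phi x)"
    using log_Phi_aux(1)[OF assms] by (simp only: sums_cnj)
  moreover have "cnj (Ln (1 - exp (- of_nat (Suc n) * x))) = Ln (1 - exp (- of_nat (Suc n) * cnj x))" for n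
    unfolding cnj_Ln[OF one_minus_exp_not_nonpos[OF assms]]
    by (simp only: complex_cnj_diff complex_cnj_one exp_cnj complex_cnj_mult complex_cnj_minus complex_cnj_of_nat)
  ultimately show "log_Phi (cnj x) = cnj (log_Phi x)"
    using log_Phi_aux(1)[of "cnj x"] assms by (simp add: sums_iff)
  have "(\<lambda>n. cnj (of_nat (Suc n) * exp (- of_nat (Suc n) * x) / (1 - exp (- of_nat (Suc n) * x)))) sums cnj (log_Phi' x)"
    using log_Phi_aux(2)[OF assms] by (simp only: sums_cnj)
  then show "log_Phi' (cnj x) = cnj (log_Phi' x)"
    using log_Phi_aux(2)[of "cnj x"] assms by (simp add: sums_iff exp_cnj)
qed

lemma geometric_has_sum:
  fixes c :: "'a :: {real_normed_field, banach}"
  assumes "norm c < 1"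
  shows "((\<lambda>m. c ^ m) has_sum (1 / (1 - c))) UNIV"
proof (rule norm_summable_imp_has_sum)
  show "summable (\<lambda>m. norm (c ^ m))"
    unfolding norm_power using assms by (intro summable_geometric) simp
qed (rule geometric_sums[OF assms])

text \<open>Expanding each term geometrically gives the double series of n q^(n m); summing over n
  instead of m gives q^m / (1 - q^m)^2. In this form every term is one fixed function,
  \<open>exp y / (exp y - 1)\<^sup>2\<close>, evaluated at y = m x, which makes the series
  comparable with an integral.\<close>

lemma log_Phi'_eq_Lambert:
  assumes "Re x > 0"
  shows "(\<lambda>m. exp (- of_nat (Suc m) * x) / (1 - exp (- of_nat (Suc m) * x)) ^ 2) sums log_Phi' x"
proof -
  define q where "q = exp (-x)"
  have q: "norm q < 1" "q \<noteq> 0" using assms by (auto simp: q_def norm_exp_eq_Re)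
  have e: "exp (- of_nat (Suc m) * x) = q ^ Suc m" for m
    unfolding q_def by (metis exp_of_nat_mult minus_mult_commute)
  have nq: "norm (q ^ Suc m) < 1" for m
    unfolding norm_power using power_less_one_iff[of "norm q" "Suc m"] q by (simp del: power_Suc)
  define F where "F = (\<lambda>(n,m). of_nat (Suc n) * q ^ (Suc n * Suc m))"
  have row: "((\<lambda>m. F (n, m)) has_sum (of_nat (Suc n) * q ^ Suc n / (1 - q ^ Suc n))) UNIV" 
    and rown: "((\<lambda>m. norm (F (n, m))) has_sum (real (Suc n) * norm q ^ Suc n / (1 - norm q ^ Suc n))) UNIV" for n
  proof -
    have a: "((\<lambda>m. (norm q ^ Suc n) ^ m) has_sum (1 / (1 - norm q ^ Suc n))) UNIV"
      using nq[of n] by (intro geometric_has_sum) (simp add: norm_power del: power_Suc)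
    have b: "((\<lambda>m. (q ^ Suc n) ^ m) has_sum (1 / (1 - q ^ Suc n))) UNIV"
      by (rule geometric_has_sum[OF nq])
    show "((\<lambda>m. F (n, m)) has_sum (of_nat (Suc n) * q ^ Suc n / (1 - q ^ Suc n))) UNIV"
      using has_sum_cmult_right[OF b, of "of_nat (Suc n) * q ^ Suc n"]
      by (simp add: F_def power_mult[symmetric] power_add[symmetric] algebra_simps del: of_nat_Suc)
    show "((\<lambda>m. norm (F (n, m))) has_sum (real (Suc n) * norm q ^ Suc n / (1 - norm q ^ Suc n))) UNIV"
      using has_sum_cmult_right[OF a, of "real (Suc n) * norm q ^ Suc n"]
      by (simp add: F_def norm_mult norm_power power_mult[symmetric] power_add[symmetric] algebra_simps del: of_nat_Suc)
  qed
  have col: "((\<lambda>n. F (n, m)) has_sum (q ^ Suc m / (1 - q ^ Suc m)^2)) UNIV" for m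
  proof -
    have s: "(\<lambda>n. of_nat (Suc n) * (q ^ Suc m) ^ n) sums (1 / (1 - q ^ Suc m)^2)"
      by (rule geometric_deriv_sums[OF nq])
    have sn: "summable (\<lambda>n. norm (of_nat (Suc n) * (q ^ Suc m) ^ n))"
      using sums_summable[OF geometric_deriv_sums[of "norm (q ^ Suc m)"]] nq[of m]
      by (simp add: norm_mult norm_power del: of_nat_Suc power_Suc)
    have "((\<lambda>n. of_nat (Suc n) * (q ^ Suc m) ^ n) has_sum (1 / (1 - q ^ Suc m)^2)) UNIV"
      by (rule norm_summable_imp_has_sum[OF sn s])
    from has_sum_cmult_right[OF this, of "q ^ Suc m"] show ?thesis
      by (simp add: F_def power_mult[symmetric] power_add[symmetric] algebra_simps del: of_nat_Suc)
  qed
  \<comment> \<open>Exchanging the order of summation needs absolute summability. Bounding the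
    denominator below by \<open>1 - norm q\<close> compares the sums of norms over the rows with the
    derivative of a geometric series.\<close>
  have summ: "F summable_on UNIV"
  proof -
    have "summable (\<lambda>n. real (Suc n) * norm q ^ Suc n / (1 - norm q ^ Suc n))"
    proof (rule summable_comparison_test)
      have "norm (real (Suc n) * norm q ^ Suc n / (1 - norm q ^ Suc n)) \<le>
            norm q / (1 - norm q) * (real (Suc n) * norm q ^ n)" for n
      proof -
        have "norm q ^ Suc n \<le> norm q" using q power_Suc_le_self[of "norm q" n] by simp
        then have "real (Suc n) * norm q ^ Suc n / (1 - norm q ^ Suc n) \<le> real (Suc n) * norm q ^ Suc n / (1 - norm q)"
          using q by (intro divide_left_mono mult_pos_pos) (auto simp del: power_Suc)
        moreover have "norm q ^ Suc n < 1" using nq[of n] by (simp add: norm_power norm_mult)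
        ultimately show ?thesis by (simp add: mult_ac)
      qed
      then show "\<exists>N. \<forall>n\<ge>N. norm (real (Suc n) * norm q ^ Suc n / (1 - norm q ^ Suc n)) \<le>
            norm q / (1 - norm q) * (real (Suc n) * norm q ^ n)" by blast
      show "summable (\<lambda>n. norm q / (1 - norm q) * (real (Suc n) * norm q ^ n))"
        using sums_summable[OF geometric_deriv_sums[of "norm q"]] q by (intro summable_mult) simp
    qed
    moreover have "real (Suc n) * norm q ^ Suc n / (1 - norm q ^ Suc n) \<ge> 0" for n
      using nq[of n] by (simp add: norm_power norm_mult)
    ultimately have "(\<lambda>n. real (Suc n) * norm q ^ Suc n / (1 - norm q ^ Suc n)) summable_on UNIV"
      by (subst summable_on_UNIV_nonneg_real_iff) auto
    then have "(\<lambda>p. norm (F p)) summable_on (SIGMA n:UNIV. UNIV)"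
      using rown by (intro summable_on_SigmaI[OF rown]) auto
    then show ?thesis by (simp add: abs_summable_summable)
  qed
  then obtain s where s: "(F has_sum s) (UNIV \<times> UNIV)" by (auto simp: summable_on_def)
  have "((\<lambda>n. of_nat (Suc n) * q ^ Suc n / (1 - q ^ Suc n)) has_sum s) UNIV"
    by (rule has_sum_SigmaD[OF s row])
  then have 1: "(\<lambda>n. of_nat (Suc n) * q ^ Suc n / (1 - q ^ Suc n)) sums s"
    by (rule has_sum_imp_sums)
  have "((\<lambda>(m,n). F (n, m)) has_sum s) (UNIV \<times> UNIV)"
    using s[unfolded has_sum_swap[where f = F]] by (simp add: case_prod_unfold)
  then have "((\<lambda>m. q ^ Suc m / (1 - q ^ Suc m)^2) has_sum s) UNIV"
    by (rule has_sum_SigmaD) (use col in simp)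
  then have 2: "(\<lambda>m. q ^ Suc m / (1 - q ^ Suc m)^2) sums s"
    by (rule has_sum_imp_sums)
  have "s = log_Phi' x"
    using 1 log_Phi_aux(2)[OF assms] unfolding e using sums_unique2 by blast
  with 2 show ?thesis unfolding e by simp
qed

section \<open>Expansion of the logarithmic derivative near the origin\<close>

text \<open>The closed sector of opening pi/2 around the positive axis, without its vertex. Its
  boundary belongs to it because the integration rays lie there.\<close>

definition sector :: "complex set" where
  "sector = {x. 0 < Re x \<and> \<bar>Im x\<bar> \<le> Re x}"

lemma norm_le_sector: "x \<in> sector \<Longrightarrow> norm x \<le> 2 * Re x"
  using cmod_le[of x] by (simp add: sector_def)

lemma sector_scale: "x \<in> sector \<Longrightarrow> c > 0 \<Longrightarrow> of_real c * x \<in> sector"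
  by (auto simp: sector_def abs_mult)

lemma of_real_in_sector: "r > 0 \<Longrightarrow> of_real r \<in> sector"
  by (auto simp: sector_def)

lemma convex_sector: "convex sector"
proof (rule convexI)
  fix x y :: complex and u v :: real
  assume *: "x \<in> sector" "y \<in> sector" "0 \<le> u" "0 \<le> v" "u + v = 1"
  have "0 < u * Re x + v * Re y"
    using * by (cases "u = 0") (auto simp: sector_def intro: add_pos_nonneg)
  moreover have "\<bar>u * Im x + v * Im y\<bar> \<le> u * Re x + v * Re y"
  proof -
    have "\<bar>u * Im x + v * Im y\<bar> \<le> u * \<bar>Im x\<bar> + v * \<bar>Im y\<bar>"
      using * by (intro order.trans[OF abs_triangle_ineq]) (simp add: abs_mult)
    also have "\<dots> \<le> u * Re x + v * Re y"
      using * by (intro add_mono mult_left_mono) (auto simp: sector_def)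
    finally show ?thesis .
  qed
  ultimately show "u *\<^sub>R x + v *\<^sub>R y \<in> sector" by (simp add: sector_def)
qed

lemma exp_neq_1_Re_pos: "Re y > 0 \<Longrightarrow> exp y \<noteq> (1::complex)"
  by (metis exp_zero less_irrefl norm_exp_eq_Re norm_one one_less_exp_iff)

lemma exp_neq_1_ball:
  assumes "norm (y::complex) < 1" "y \<noteq> 0"
  shows "exp y \<noteq> 1"
proof
  assume "exp y = 1"
  then obtain n :: int where n: "Re y = 0" "Im y = of_int (2 * n) * pi"
    by (auto simp: exp_eq_1)
  have "\<bar>Im y\<bar> < 1" using abs_Im_le_cmod[of y] assms by simp
  moreover have "n \<noteq> 0" using n assms(2) by (auto simp: complex_eq_iff)
  then have "\<bar>real_of_int n\<bar> \<ge> 1" by linarith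
  then have "\<bar>Im y\<bar> \<ge> 2 * pi" using n by (simp add: abs_mult)
  ultimately show False using pi_gt3 by linarith
qed

text \<open>\<open>P\<close> is the primitive of \<open>e\<^sup>y / (e\<^sup>y - 1)\<^sup>2 - 1 / y\<^sup>2\<close> that vanishes at the removable singularity \<open>0\<close>.\<close>
lemma obtain_primitive:
  obtains P where "P holomorphic_on ({y. Re y > 0} \<union> ball 0 1)" "P 0 = 0"
    "\<And>y. Re y > 0 \<Longrightarrow> P y = 1 / y - 1 / (exp y - 1) - 1 / (2::complex)"
proof -
  define U where "U = {y. Re y > 0} \<union> ball (0::complex) 1"
  define f where "f y = 1 / y - 1 / (exp y - 1) - 1 / (2::complex)" for y
  have U: "open U" by (auto simp: U_def open_halfspace_Re_gt)
  have ne: "exp y \<noteq> 1" if "y \<in> U - {0}" for y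
    using that exp_neq_1_Re_pos exp_neq_1_ball by (auto simp: U_def)
  have hol: "f holomorphic_on (U - {0})"
    unfolding f_def using ne by (intro holomorphic_intros) auto
  have lim1: "((\<lambda>y::complex. (exp y - 1) / y) \<longlongrightarrow> 1) (at 0)"
    using DERIV_exp[of "0::complex"] by (simp add: has_field_derivative_iff)
  have "((\<lambda>y::complex. 1 - 1 / ((exp y - 1) / y) - y / 2) \<longlongrightarrow> 1 - 1 / 1 - 0 / 2) (at 0)"
    by (intro tendsto_intros lim1) auto
  moreover have "eventually (\<lambda>y::complex. y \<in> ball 0 1 - {0}) (at 0)"
    using eventually_at_in_open[of "ball 0 1" "0::complex"] by simp
  then have "eventually (\<lambda>y. 1 - 1 / ((exp y - 1) / y) - y / 2 = (y - 0) * f y) (at (0::complex))"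
    by eventually_elim (simp add: f_def field_simps)
  ultimately have "((\<lambda>z. (z - 0) * f z) \<longlongrightarrow> 0) (at 0)"
    by (simp add: tendsto_cong)
  moreover have "0 \<in> interior U" using U by (simp add: interior_open U_def)
  ultimately obtain P where P: "P holomorphic_on U" "\<forall>z\<in>U-{0}. P z = f z"
    using holomorphic_on_extend_lim[OF hol] by blast
  \<comment> \<open>The extension theorem does not give the value at the singularity. By continuity
    it can be read off along \<open>1 / Suc n\<close>, where a real limit decides; the summand - 1/2
    is what makes it vanish.\<close>
  have "P 0 = 0"
  proof -
    have "continuous (at 0) P" using P(1) U
      by (metis U_def UnI2 centre_in_ball continuous_on_eq_continuous_at holomorphic_on_imp_continuous_on zero_less_one)
    then have PT: "(P \<longlongrightarrow> P 0) (at 0)" by (simp add: isCont_def)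
    define X where "X n = (of_real (1 / real (Suc n)) :: complex)" for n
    have X_eq: "X = (\<lambda>n. of_real (inverse (real (Suc n))))"
      by (simp add: X_def fun_eq_iff field_simps)
    have X: "X \<longlonglongrightarrow> 0" "X n \<noteq> 0" for n
      using tendsto_of_real[OF LIMSEQ_inverse_real_of_nat, where 'a=complex]
      unfolding X_eq by (simp_all del: of_nat_Suc)
    have "(\<lambda>n. P (X n)) \<longlonglongrightarrow> P 0"
      using PT X by (intro filterlim_compose[OF PT]) (auto simp: filterlim_at)
    moreover have "P (X n) = of_real (real (Suc n) - 1 / (exp (1 / real (Suc n)) - 1) - 1 / 2)" for n
    proof -
      have fr: "f (of_real s) = of_real (1 / s - 1 / (exp s - 1) - 1 / 2)" for s :: real
        by (simp add: f_def exp_of_real)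
      have "X n \<in> U - {0}" using X(2) by (simp add: U_def X_eq)
      then have "P (X n) = f (X n)" using P(2) by blast
      also have "\<dots> = of_real (real (Suc n) - 1 / (exp (1 / real (Suc n)) - 1) - 1 / 2)"
        unfolding X_def fr by (simp del: of_nat_Suc)
      finally show ?thesis .
    qed
    moreover have "((\<lambda>n. real (Suc n) - 1 / (exp (1 / real (Suc n)) - 1) - 1 / 2) \<longlongrightarrow> 0) sequentially"
      by real_asymp
    then have "((\<lambda>n. of_real (real (Suc n) - 1 / (exp (1 / real (Suc n)) - 1) - 1 / 2) :: complex) \<longlongrightarrow> of_real 0) sequentially"
      by (rule tendsto_of_real)
    ultimately show ?thesis by (metis (no_types, lifting) LIMSEQ_unique of_real_0 ext)
  qed
  moreover have "P y = 1 / y - 1 / (exp y - 1) - 1 / 2" if "Re y > 0" for y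
    using P(2) that by (auto simp: U_def f_def)
  ultimately show ?thesis using that P(1) unfolding U_def by blast
qed

text \<open>The term m = 0 contributes r, and the others telescope against 1 / (1 + m r),
  contributing at most 1. Because the bound stays finite as r tends to 0, the accumulated remainder
  below is only of first order in |x|.\<close>

lemma sum_inverse_square_le:
  fixes r :: real
  assumes "r > 0"
  shows "(\<Sum>m<M. r / (1 + real m * r) ^ 2) \<le> r + 1"
proof -
  have "(\<Sum>m<Suc N. r / (1 + real m * r) ^ 2) \<le> r + 1 - 1 / (1 + real N * r)" for N
  proof (induction N)
    case (Suc N)
    have p: "1 + real N * r > 0" "1 + real (Suc N) * r > 0" using assms by (auto intro: add_pos_nonneg)
    have "r / (1 + real (Suc N) * r) ^ 2 \<le> r / ((1 + real N * r) * (1 + real (Suc N) * r))"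
      unfolding power2_eq_square using p assms
      by (intro frac_le mult_pos_pos mult_right_mono) (auto simp: algebra_simps)
    also have "\<dots> = 1 / (1 + real N * r) - 1 / (1 + real (Suc N) * r)"
      using p by (simp add: divide_simps) (simp add: algebra_simps)
    finally show ?case using Suc by simp
  qed simp
  from this[of M] have "(\<Sum>m<Suc M. r / (1 + real m * r) ^ 2) \<le> r + 1"
    using assms by (smt (verit, best) divide_nonneg_nonneg mult_nonneg_nonneg of_nat_0_le_iff)
  moreover have "r / (1 + real M * r) ^ 2 \<ge> 0" using assms by simp
  ultimately show ?thesis by simp
qed

text \<open>Near the vertex this is compactness: the truncated closed sector lies in the domain of
  P, its vertex being covered by the unit ball. Far out, Re y is at least |y|/2, so the exponential
  part of the explicit second derivative is negligible and 2 / y^3 remains. Quadratic decay is what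
  the summation over multiples of x uses.\<close>

lemma bounded_second_derivative:
  fixes P :: "complex \<Rightarrow> complex"
  assumes hol: "P holomorphic_on ({y. Re y > 0} \<union> ball 0 1)"
    and P: "\<And>y. Re y > 0 \<Longrightarrow> P y = 1 / y - 1 / (exp y - 1) - 1 / 2"
  obtains C where "C > 0" "\<And>y. y \<in> insert 0 sector \<Longrightarrow> norm (deriv (deriv P) y) \<le> C / (1 + norm y)\<^sup>2"
    "\<And>y. Re y > 0 \<Longrightarrow> deriv P y = exp y / (exp y - 1)\<^sup>2 - 1 / y\<^sup>2"
proof -
  define U where "U = {y. Re y > 0} \<union> ball (0::complex) 1"
  have U: "open U" by (auto simp: U_def open_halfspace_Re_gt)
  have H: "open {y. 0 < Re y}" by (rule open_halfspace_Re_gt)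
  have d1: "deriv P y = exp y / (exp y - 1)\<^sup>2 - 1 / y\<^sup>2" if "Re y > 0" for y
  proof -
    have "((\<lambda>y. 1 / y - 1 / (exp y - 1) - 1 / 2) has_field_derivative (exp y / (exp y - 1)\<^sup>2 - 1 / y\<^sup>2)) (at y)"
      using that exp_neq_1_Re_pos[OF that] by (auto intro!: derivative_eq_intros simp: power2_eq_square)
    then have "(P has_field_derivative (exp y / (exp y - 1)\<^sup>2 - 1 / y\<^sup>2)) (at y)"
      by (rule has_field_derivative_transform_within_open[OF _ H]) (use that P in auto)
    then show ?thesis by (rule DERIV_imp_deriv)
  qed
  have d2: "deriv (deriv P) y = 2 / y ^ 3 - exp y * (exp y + 1) / (exp y - 1) ^ 3" if "Re y > 0" for y
  proof -
    have n: "exp y - 1 \<noteq> 0" "y \<noteq> 0" using that exp_neq_1_Re_pos[OF that] by auto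
    have "((\<lambda>y. exp y / (exp y - 1)\<^sup>2 - 1 / y\<^sup>2) has_field_derivative
       ((exp y * (exp y - 1)\<^sup>2 - exp y * (2 * (exp y - 1) * exp y)) / ((exp y - 1)\<^sup>2 * (exp y - 1)\<^sup>2)
         + (2 * y) / (y\<^sup>2 * y\<^sup>2))) (at y)"
      using n by (auto intro!: derivative_eq_intros)
    also have "((exp y * (exp y - 1)\<^sup>2 - exp y * (2 * (exp y - 1) * exp y)) / ((exp y - 1)\<^sup>2 * (exp y - 1)\<^sup>2)
         + (2 * y) / (y\<^sup>2 * y\<^sup>2)) = 2 / y ^ 3 - exp y * (exp y + 1) / (exp y - 1) ^ 3"
    proof -
      have "(exp y * (exp y - 1)\<^sup>2 - exp y * (2 * (exp y - 1) * exp y)) / ((exp y - 1)\<^sup>2 * (exp y - 1)\<^sup>2)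
          = ((exp y - 1) * (- exp y * (exp y + 1))) / ((exp y - 1) * (exp y - 1) ^ 3)"
        by (rule arg_cong2[where f="(/)"]) (simp_all add: algebra_simps power2_eq_square power3_eq_cube)
      also have "\<dots> = - exp y * (exp y + 1) / (exp y - 1) ^ 3" by (rule nonzero_mult_divide_mult_cancel_left[OF n(1)])
      finally show ?thesis using n by (simp add: power2_eq_square power3_eq_cube)
    qed
    finally have "(deriv P has_field_derivative (2 / y ^ 3 - exp y * (exp y + 1) / (exp y - 1) ^ 3)) (at y)"
      by (rule has_field_derivative_transform_within_open[OF _ H]) (use that d1 in auto)
    then show ?thesis by (rule DERIV_imp_deriv)
  qed
  define K where "K = cball (0::complex) 2 \<inter> {y. 0 \<le> Re y \<and> \<bar>Im y\<bar> \<le> Re y}"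
  have "closed {y. 0 \<le> Re y \<and> \<bar>Im y\<bar> \<le> Re y}"
    by (intro closed_Collect_conj closed_Collect_le continuous_intros)
  then have "compact K" unfolding K_def by (intro compact_Int_closed compact_cball)
  moreover have KU: "K \<subseteq> U"
  proof
    fix y assume "y \<in> K"
    then show "y \<in> U" by (cases "Re y = 0") (auto simp: K_def U_def cmod_def)
  qed
  have "continuous_on K (deriv (deriv P))"
    using holomorphic_deriv[OF holomorphic_deriv[OF hol[folded U_def] U] U]
    by (rule continuous_on_subset[OF holomorphic_on_imp_continuous_on KU])
  ultimately have "bounded (deriv (deriv P) ` K)"
    by (intro compact_imp_bounded compact_continuous_image)
  then obtain B where B: "B > 0" "\<And>y. y \<in> K \<Longrightarrow> norm (deriv (deriv P) y) \<le> B"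
    unfolding bounded_pos by blast
  \<comment> \<open>The 9 bounds (1 + |y|)^2 for |y| at most 2. For larger y the two parts
    contribute 128 and 2 over |y|^2, and 520 = 4 * 130 because 1 + |y| is at most 2 |y|.\<close>
  have "norm (deriv (deriv P) y) \<le> (9 * B + 520) / (1 + norm y)\<^sup>2" if y: "y \<in> insert 0 sector" for y
  proof (cases "norm y \<le> 2")
    case True
    then have "y \<in> K" using y by (auto simp: K_def sector_def)
    have "norm (deriv (deriv P) y) * (1 + norm y)\<^sup>2 \<le> B * 3\<^sup>2"
      using B \<open>y \<in> K\<close> True by (intro mult_mono power_mono) auto
    then have "norm (deriv (deriv P) y) * (1 + norm y)\<^sup>2 \<le> 9 * B + 520" by simp
    moreover have "(1 + norm y)\<^sup>2 > 0" by (intro zero_less_power add_pos_nonneg) auto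
    ultimately show ?thesis by (simp only: pos_le_divide_eq)
  next
    case False
    define r where "r = norm y"
    define E where "E = exp (Re y)"
    have ys: "y \<in> sector" using False y by auto
    have r: "r > 2" "Re y \<ge> r / 2" using False norm_le_sector[OF ys] by (auto simp: r_def)
    have E2: "E \<ge> 2" using r exp_ge_add_one_self[of "Re y"] unfolding E_def by linarith
    have Er: "E \<ge> r\<^sup>2 / 8"
    proof -
      have "1 + r/2 + (r/2)\<^sup>2/2 \<le> exp (r/2)" using r by (intro exp_lower_Taylor_quadratic) simp
      moreover have "exp (r/2) \<le> E" using r by (simp add: E_def)
      ultimately show ?thesis using r by (simp add: power2_eq_square)
    qed
    have nE: "norm (exp y) = E" by (simp add: E_def norm_exp_eq_Re)
    have l: "norm (exp y - 1) \<ge> E / 2"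
      using norm_triangle_ineq2[of "exp y" 1] E2 unfolding nE norm_one by linarith
    have "norm (exp y * (exp y + 1) / (exp y - 1) ^ 3) = E * norm (exp y + 1) / norm (exp y - 1) ^ 3"
      by (simp add: norm_divide norm_mult norm_power nE del: norm_exp_eq_Re)
    also have "\<dots> \<le> E * (2 * E) / (E / 2) ^ 3"
      using l E2 norm_triangle_ineq[of "exp y" 1] nE
      by (intro frac_le mult_mono power_mono) auto
    also have "\<dots> = 16 / E" using E2 by (simp add: field_simps power3_eq_cube)
    also have "\<dots> \<le> 16 / (r\<^sup>2 / 8)" using Er r E2 by (intro divide_left_mono mult_pos_pos) auto
    finally have 1: "norm (exp y * (exp y + 1) / (exp y - 1) ^ 3) \<le> 128 / r\<^sup>2" by simp
    have "norm (2 / y ^ 3) = 2 / r ^ 3" by (simp add: norm_divide norm_power r_def)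
    also have "\<dots> \<le> 2 / r\<^sup>2" using r by (intro divide_left_mono mult_pos_pos power_increasing) auto
    finally have 2: "norm (2 / y ^ 3) \<le> 2 / r\<^sup>2" .
    have "norm (deriv (deriv P) y) \<le> 130 / r\<^sup>2"
      using d2[of y] ys 1 2 norm_triangle_ineq4[of "2 / y ^ 3" "exp y * (exp y + 1) / (exp y - 1) ^ 3"]
      by (simp add: sector_def add_divide_distrib[symmetric])
    also have "130 / r\<^sup>2 = 520 / (2 * r)\<^sup>2" by (simp add: power2_eq_square)
    also have "\<dots> \<le> (9 * B + 520) / (1 + r)\<^sup>2"
      using r B by (intro frac_le power_mono) (auto simp: zero_less_power)
    finally show ?thesis by (simp add: r_def)
  qed
  then show ?thesis using that[of "9 * B + 520"] d1 B(1) by auto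
qed

text \<open>An Euler-Maclaurin comparison of first order. The values of P at multiples of x
  telescope to - 1/2, its limit at infinity. The values
  \<open>x * deriv P (of_nat (Suc m) * x)\<close> add up to \<open>x * log_Phi' x\<close> minus pi^2
  / (6 x), by the Lambert form and the sum of inverse squares. The two differ by second-order
  remainders of total size O(|x| (1 + |x|)), and division by x gives the claim.\<close>

lemma log_Phi'_expansion:
  obtains C where "C > 0" "\<And>x. x \<in> sector \<Longrightarrow>
     norm (log_Phi' x + 1 / (2 * x) - of_real (pi\<^sup>2) / (6 * x\<^sup>2)) \<le> C * (1 + norm x)"
proof -
  obtain P where hol: "P holomorphic_on ({y. Re y > 0} \<union> ball 0 1)" and P0: "P 0 = 0"
    and P: "\<And>y. Re y > 0 \<Longrightarrow> P y = 1 / y - 1 / (exp y - 1) - 1 / (2::complex)"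
    using obtain_primitive by blast
  obtain C where C: "C > 0" "\<And>y. y \<in> insert 0 sector \<Longrightarrow> norm (deriv (deriv P) y) \<le> C / (1 + norm y)\<^sup>2"
    "\<And>y. Re y > 0 \<Longrightarrow> deriv P y = exp y / (exp y - 1)\<^sup>2 - 1 / y\<^sup>2"
    using bounded_second_derivative[OF hol P] by blast
  define U where "U = {y. Re y > 0} \<union> ball (0::complex) 1"
  have U: "open U" by (auto simp: U_def open_halfspace_Re_gt)
  have sU: "insert 0 sector \<subseteq> U" by (auto simp: sector_def U_def)
  have D1: "(P has_field_derivative deriv P y) (at y)" if "y \<in> U" for y
    using hol U that unfolding U_def[symmetric] by (rule holomorphic_derivI)
  have D2: "(deriv P has_field_derivative deriv (deriv P) y) (at y)" if "y \<in> U" for y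
    using holomorphic_deriv[OF hol[folded U_def] U] U that by (rule holomorphic_derivI)
  have "norm (log_Phi' x + 1 / (2 * x) - of_real (pi\<^sup>2) / (6 * x\<^sup>2)) \<le> C * (1 + norm x)"
    if x: "x \<in> sector" for x
  proof -
    define r where "r = norm x"
    have Rx: "Re x > 0" using x by (simp add: sector_def)
    have r: "r > 0" using Rx by (auto simp: r_def)
    \<comment> \<open>The error of the right-endpoint rule for the integral of
      \<open>deriv P\<close> from m x to (m + 1) x.\<close>
    define e where "e m = P (of_nat (Suc m) * x) - P (of_nat m * x) - x * deriv P (of_nat (Suc m) * x)" for m
    have e_le: "norm (e m) \<le> C * r * (r / (1 + real m * r)\<^sup>2)" for m
    proof -
      define a b where "a = of_nat m * x" and "b = of_nat (Suc m) * x"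
      define B where "B = C / (1 + real m * r)\<^sup>2"
      have seg: "y \<in> insert 0 sector \<and> norm y \<ge> real m * r \<and> norm (b - y) \<le> r" if y: "y \<in> closed_segment a b" for y
      proof -
        obtain u where u: "0 \<le> u" "u \<le> 1" "y = (1 - u) *\<^sub>R a + u *\<^sub>R b"
          using y by (auto simp: in_segment)
        have y1: "y = of_real (real m + u) * x"
          using u by (simp add: a_def b_def scaleR_conv_of_real algebra_simps)
        have y2: "b - y = of_real (1 - u) * x"
          using u by (simp add: a_def b_def scaleR_conv_of_real algebra_simps)
        have "y = 0 \<or> y \<in> sector"
          using sector_scale[OF x, of "real m + u"] u by (cases "real m + u = 0") (auto simp: y1)
        moreover have "norm y = (real m + u) * r" using u unfolding y1 r_def norm_mult by (simp del: of_real_add)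
        moreover have "norm (b - y) = (1 - u) * r" using u unfolding y2 r_def norm_mult by (simp del: of_real_diff)
        moreover have "real m * r \<le> (real m + u) * r" "(1 - u) * r \<le> r"
          using u r by (auto simp: algebra_simps)
        ultimately show ?thesis by simp
      qed
      have ba: "b - a = x" by (simp add: a_def b_def algebra_simps)
      have nB: "norm (deriv (deriv P) y) \<le> B" if "y \<in> closed_segment a b" for y
      proof -
        have "norm (deriv (deriv P) y) \<le> C / (1 + norm y)\<^sup>2" using seg[OF that] C(2) by blast
        also have "\<dots> \<le> B" unfolding B_def using seg[OF that] C(1) r
          by (intro divide_left_mono power_mono mult_pos_pos zero_less_power) (auto intro: add_pos_nonneg)
        finally show ?thesis .
      qed
      have B0: "B \<ge> 0" using C(1) by (simp add: B_def)
      have step1: "norm (deriv P y - deriv P b) \<le> B * r" if y: "y \<in> closed_segment a b" for y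
      proof -
        have "norm (deriv P y - deriv P b) \<le> B * norm (y - b)"
        proof (rule field_differentiable_bound[of "closed_segment a b" "deriv P" "deriv (deriv P)"])
          fix z assume z: "z \<in> closed_segment a b"
          have "z \<in> U" using seg[OF z] sU by (elim conjE) (rule subsetD)
          then show "(deriv P has_field_derivative deriv (deriv P) z) (at z within closed_segment a b)"
            by (rule has_field_derivative_at_within[OF D2])
        qed (simp_all add: y nB)
        also have "\<dots> \<le> B * r" using seg[OF y] B0 by (intro mult_left_mono) (auto simp: norm_minus_commute)
        finally show ?thesis .
      qed
      \<comment> \<open>Second use of the mean value bound: subtracting the linear function with
        slope \<open>deriv P b\<close> leaves a function whose derivative was just bounded by
        \<open>B * r\<close>.\<close>
      have "norm ((P b - b * deriv P b) - (P a - a * deriv P b)) \<le> B * r * norm (b - a)"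
      proof (rule field_differentiable_bound[of "closed_segment a b" "\<lambda>y. P y - y * deriv P b" "\<lambda>y. deriv P y - deriv P b"])
        fix y assume y: "y \<in> closed_segment a b"
        then have "y \<in> U" using seg[OF y] sU by (elim conjE) (rule subsetD)
        then show "((\<lambda>y. P y - y * deriv P b) has_field_derivative deriv P y - deriv P b) (at y within closed_segment a b)"
          using DERIV_diff[OF has_field_derivative_at_within[OF D1] DERIV_cmult_right[OF DERIV_ident, of "deriv P b"]]
          by simp
      qed (use step1 in auto)
      moreover have "(P b - b * deriv P b) - (P a - a * deriv P b) = e m"
      proof -
        have "e m = P b - P a - x * deriv P b" by (simp only: e_def a_def b_def)
        then show ?thesis by (simp add: ba[symmetric] algebra_simps)
      qed
      ultimately have "norm (e m) \<le> B * r * r" by (simp add: ba r_def)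
      then show ?thesis by (simp add: B_def mult_ac)
    qed
    have "(\<lambda>m. P (of_nat (Suc m) * x) - P (of_nat m * x)) sums (-1/2 - P (of_nat 0 * x))"
    proof (rule telescope_sums)
      have "(\<lambda>m. 1 / (of_nat m * x) - 1 / (exp (of_nat m * x) - 1) - 1 / 2) \<longlonglongrightarrow> 0 - 0 - 1 / 2"
      proof (intro tendsto_intros)
        have inf: "filterlim (\<lambda>m. of_nat m * x :: complex) at_infinity sequentially"
        proof (rule filterlim_norm_at_top_imp_at_infinity)
          have "filterlim (\<lambda>m. real m * norm x) at_top sequentially"
            using filterlim_at_top_mult_tendsto_pos[OF tendsto_const r filterlim_real_sequentially]
            by (simp add: r_def mult.commute)
          then show "filterlim (\<lambda>m. norm (of_nat m * x)) at_top sequentially"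
            by (simp add: norm_mult)
        qed
        then show "(\<lambda>m. 1 / (of_nat m * x)) \<longlonglongrightarrow> 0"
          using tendsto_divide_0[OF tendsto_const] by blast
        have "filterlim (\<lambda>m. norm (exp (of_nat m * x) - 1)) at_top sequentially"
        proof (rule filterlim_at_top_mono)
          show "filterlim (\<lambda>m. real m * Re x) at_top sequentially"
            using filterlim_at_top_mult_tendsto_pos[OF tendsto_const Rx filterlim_real_sequentially]
            by (simp add: mult.commute)
          show "\<forall>\<^sub>F m in sequentially. real m * Re x \<le> norm (exp (of_nat m * x) - 1)"
          proof (intro always_eventually allI)
            fix m show "real m * Re x \<le> norm (exp (of_nat m * x) - 1)"
            proof -
              have "exp (real m * Re x) = norm (exp (of_nat m * x))" by (simp add: norm_exp_eq_Re)
              then show ?thesis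
                using norm_triangle_ineq2[of "exp (of_nat m * x)" 1] exp_ge_add_one_self[of "real m * Re x"]
                unfolding norm_one by linarith
            qed
          qed
        qed
        then have "filterlim (\<lambda>m. exp (of_nat m * x) - 1) at_infinity sequentially"
          by (rule filterlim_norm_at_top_imp_at_infinity)
        then show "(\<lambda>m. 1 / (exp (of_nat m * x) - 1)) \<longlonglongrightarrow> 0"
          using tendsto_divide_0[OF tendsto_const] by blast
      qed
      moreover have "\<forall>\<^sub>F m in sequentially. 1 / (of_nat m * x) - 1 / (exp (of_nat m * x) - 1) - 1 / 2 = P (of_nat m * x)"
        using eventually_gt_at_top[of 0]
        by eventually_elim (use Rx in \<open>simp add: P\<close>)
      ultimately show "(\<lambda>m. P (of_nat m * x)) \<longlonglongrightarrow> -1/2" by (simp add: tendsto_cong)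
    qed
    then have S1: "(\<lambda>m. P (of_nat (Suc m) * x) - P (of_nat m * x)) sums (-1/2)" by (simp add: P0)
    have S2: "(\<lambda>m. deriv P (of_nat (Suc m) * x)) sums (log_Phi' x - of_real (pi\<^sup>2 / 6) / x\<^sup>2)"
    proof -
      have "(\<lambda>n. of_real (1 / (real n + 1)\<^sup>2) :: complex) sums of_real (pi\<^sup>2 / 6)"
        using sums_of_real[OF inverse_squares_sums, where 'a=complex] by (simp add: add.commute)
      from sums_divide[OF this, of "x\<^sup>2"]
      have "(\<lambda>n. 1 / (of_nat (Suc n) * x)\<^sup>2) sums (of_real (pi\<^sup>2 / 6) / x\<^sup>2)"
        by (simp add: power_mult_distrib add.commute)
      from sums_diff[OF log_Phi'_eq_Lambert[OF Rx] this]
      have "(\<lambda>m. exp (- of_nat (Suc m) * x) / (1 - exp (- of_nat (Suc m) * x))\<^sup>2 - 1 / (of_nat (Suc m) * x)\<^sup>2)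
         sums (log_Phi' x - of_real (pi\<^sup>2 / 6) / x\<^sup>2)" .
      moreover have "exp (- of_nat (Suc m) * x) / (1 - exp (- of_nat (Suc m) * x))\<^sup>2 - 1 / (of_nat (Suc m) * x)\<^sup>2
          = deriv P (of_nat (Suc m) * x)" for m
      proof -
        define w where "w = of_nat (Suc m) * x"
        have w: "Re w > 0" using Rx by (simp add: w_def del: of_nat_Suc)
        have E: "exp (-w) = 1 / exp w" by (simp add: exp_minus divide_inverse)
        have "1 - exp (-w) = (exp w - 1) / exp w" by (simp add: E diff_divide_distrib)
        then have "exp (-w) / (1 - exp (-w))\<^sup>2 = exp w / (exp w - 1)\<^sup>2"
          by (simp add: E power_divide power2_eq_square)
        then show ?thesis unfolding minus_mult_left[symmetric] w_def[symmetric] by (simp add: C(3)[OF w])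
      qed
      ultimately show ?thesis by simp
    qed
    have S3: "e sums (-1/2 - x * (log_Phi' x - of_real (pi\<^sup>2 / 6) / x\<^sup>2))"
      unfolding e_def by (intro sums_diff sums_mult S1 S2)
    have "norm (\<Sum>m<M. e m) \<le> C * r * (r + 1)" for M
    proof -
      have "norm (\<Sum>m<M. e m) \<le> (\<Sum>m<M. C * r * (r / (1 + real m * r)\<^sup>2))"
        by (intro sum_norm_le e_le)
      also have "\<dots> = C * r * (\<Sum>m<M. r / (1 + real m * r)\<^sup>2)" by (simp add: sum_distrib_left)
      also have "\<dots> \<le> C * r * (r + 1)" using sum_inverse_square_le[OF r] C(1) r by (intro mult_left_mono) auto
      finally show ?thesis .
    qed
    then have "norm (-1/2 - x * (log_Phi' x - of_real (pi\<^sup>2 / 6) / x\<^sup>2)) \<le> C * r * (r + 1)"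
      using S3 unfolding sums_def
      by (intro Lim_norm_ubound[where f="\<lambda>M. \<Sum>m<M. e m" and net=sequentially]) auto
    also have "-1/2 - x * (log_Phi' x - of_real (pi\<^sup>2 / 6) / x\<^sup>2) =
        - x * (log_Phi' x + 1 / (2 * x) - of_real (pi\<^sup>2) / (6 * x\<^sup>2))"
      using r by (auto simp: field_simps r_def)
    also have "norm \<dots> = r * norm (log_Phi' x + 1 / (2 * x) - of_real (pi\<^sup>2) / (6 * x\<^sup>2))"
      by (simp add: norm_mult r_def)
    finally show ?thesis using r by (simp add: r_def mult_ac add.commute)
  qed
  then show ?thesis using that C(1) by blast
qed

text \<open>The logarithm with its two singular terms at the vertex removed; its derivative is the
  quantity estimated in \<open>log_Phi'_expansion\<close>.\<close>

definition log_Phi_reg :: "complex \<Rightarrow> complex" where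
  "log_Phi_reg x = log_Phi x + Ln x / 2 + of_real (pi\<^sup>2) / (6 * x)"

text \<open>A bounded derivative on a convex set makes the function Lipschitz, hence Cauchy at the
  vertex. That the limit is real is essential: its exponential then scales all sums by a positive
  number and leaves the phase alone.\<close>

lemma log_Phi_reg_limit:
  obtains l :: real and C where "C > 0"
    "\<And>x. x \<in> sector \<Longrightarrow> norm x \<le> 1 \<Longrightarrow> norm (log_Phi_reg x - of_real l) \<le> C * norm x"
proof -
  obtain C where C: "C > 0" "\<And>x. x \<in> sector \<Longrightarrow>
     norm (log_Phi' x + 1 / (2 * x) - of_real (pi\<^sup>2) / (6 * x\<^sup>2)) \<le> C * (1 + norm x)"
    using log_Phi'_expansion by blast
  define S where "S = sector \<inter> cball 0 1"
  have conv: "convex S" unfolding S_def by (intro convex_Int convex_sector convex_cball)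
  define R' where "R' z = log_Phi' z + 1 / (2 * z) - of_real (pi\<^sup>2) / (6 * z\<^sup>2)" for z
  have der: "(log_Phi_reg has_field_derivative R' z) (at z within S)"
    and bnd: "norm (R' z) \<le> 2 * C" if z: "z \<in> S" for z
  proof -
    have z': "Re z > 0" "z \<noteq> 0" "z \<notin> \<real>\<^sub>\<le>\<^sub>0" using z by (auto simp: S_def sector_def complex_nonpos_Reals_iff)
    have "((\<lambda>x. Ln x / 2 + of_real (pi\<^sup>2) / (6 * x)) has_field_derivative 1 / (2 * z) - of_real (pi\<^sup>2) / (6 * z\<^sup>2)) (at z)"
      using z' by (auto intro!: derivative_eq_intros simp: power2_eq_square field_simps)
    from DERIV_add[OF log_Phi_aux(3)[OF z'(1)] this]
    have "(log_Phi_reg has_field_derivative R' z) (at z)"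
      by (simp add: log_Phi_reg_def[abs_def] R'_def add.assoc add_diff_eq)
    then show "(log_Phi_reg has_field_derivative R' z) (at z within S)"
      by (rule has_field_derivative_at_within)
    have "norm (log_Phi' z + 1 / (2 * z) - of_real (pi\<^sup>2) / (6 * z\<^sup>2)) \<le> C * (1 + norm z)"
      using z C(2) by (simp add: S_def)
    also have "\<dots> \<le> C * 2" using z C(1) by (intro mult_left_mono) (auto simp: S_def)
    finally show "norm (R' z) \<le> 2 * C" by (simp add: R'_def)
  qed
  have lip: "norm (log_Phi_reg x - log_Phi_reg y) \<le> 2 * C * norm (x - y)" if "x \<in> S" "y \<in> S" for x y
    using field_differentiable_bound[of S log_Phi_reg R' "2 * C", OF conv der bnd that] .
  \<comment> \<open>The vertex is not a point of the sector, so the limit is taken along a sequence.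
    Choosing it real makes the limit invariant under conjugation.\<close>
  define X where "X = (\<lambda>n. of_real (inverse (real (Suc n))) :: complex)"
  have XS: "X n \<in> S" for n
  proof -
    have "norm (X n) = inverse (real (Suc n))" unfolding X_def norm_of_real by (simp del: of_nat_Suc)
    also have "\<dots> \<le> 1" using inverse_le_1_iff[of "real (Suc n)"] by simp
    finally show ?thesis
      using of_real_in_sector[of "inverse (real (Suc n))"] by (simp add: S_def X_def del: of_nat_Suc of_real_inverse)
  qed
  have X0: "X \<longlonglongrightarrow> 0"
    unfolding X_def using tendsto_of_real[OF LIMSEQ_inverse_real_of_nat, where 'a=complex]
    by (simp del: of_nat_Suc)
  have "Cauchy (\<lambda>n. log_Phi_reg (X n))"
  proof (rule metric_CauchyI)
    fix e :: real assume e: "e > 0"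
    have "Cauchy X" using X0 by (intro LIMSEQ_imp_Cauchy)
    then obtain M where M: "\<forall>m\<ge>M. \<forall>n\<ge>M. dist (X m) (X n) < e / (2 * C)"
      using metric_CauchyD[of X "e / (2 * C)"] e C(1) by auto
    have "dist (log_Phi_reg (X m)) (log_Phi_reg (X n)) < e" if "m \<ge> M" "n \<ge> M" for m n
    proof -
      have "dist (log_Phi_reg (X m)) (log_Phi_reg (X n)) \<le> 2 * C * dist (X m) (X n)"
        using lip[OF XS XS] by (simp add: dist_norm)
      also have "\<dots> < 2 * C * (e / (2 * C))" using M that C(1) by (intro mult_strict_left_mono) auto
      finally show ?thesis using C(1) by simp
    qed
    then show "\<exists>M. \<forall>m\<ge>M. \<forall>n\<ge>M. dist (log_Phi_reg (X m)) (log_Phi_reg (X n)) < e" by blast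
  qed
  then obtain L where L: "(\<lambda>n. log_Phi_reg (X n)) \<longlonglongrightarrow> L"
    using Cauchy_convergent_iff convergent_def by blast
  have "cnj (log_Phi_reg (X n)) = log_Phi_reg (X n)" for n
  proof -
    have "cnj (log_Phi (X n)) = log_Phi (X n)"
      using log_Phi_cnj(1)[of "X n"] XS[of n] by (simp add: S_def sector_def X_def)
    moreover have "cnj (Ln (X n)) = Ln (X n)"
      using Ln_of_real[of "inverse (real (Suc n))"] by (simp add: X_def del: of_nat_Suc of_real_inverse)
    moreover have "cnj (X n) = X n" by (simp add: X_def)
    ultimately show ?thesis by (simp add: log_Phi_reg_def)
  qed
  then have "(\<lambda>n. log_Phi_reg (X n)) \<longlonglongrightarrow> cnj L"
    using tendsto_cnj[OF L] by simp
  with L have "cnj L = L" using LIMSEQ_unique by blast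
  then have Lr: "L = of_real (Re L)" by (simp add: complex_eq_iff)
  have "norm (log_Phi_reg x - of_real (Re L)) \<le> 2 * C * norm x" if "x \<in> sector" "norm x \<le> 1" for x
  proof (rule tendsto_le[of sequentially])
    show "(\<lambda>n. 2 * C * norm (x - X n)) \<longlonglongrightarrow> 2 * C * norm x"
      using tendsto_mult_left[OF tendsto_norm[OF tendsto_diff[OF tendsto_const X0]]] by simp
    show "(\<lambda>n. norm (log_Phi_reg x - log_Phi_reg (X n))) \<longlonglongrightarrow> norm (log_Phi_reg x - of_real (Re L))"
      unfolding Lr[symmetric] by (intro tendsto_intros L)
  qed (use that lip XS in \<open>auto simp: S_def\<close>)
  then show ?thesis using that[of "2 * C" "Re L"] C(1) by simp
qed

section \<open>The summand on the diagonal sector\<close>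

definition summand :: "nat \<Rightarrow> complex \<Rightarrow> complex" where
  "summand k x = exp (- x) * Phi (exp (- x)) ^ k"

definition summand' :: "nat \<Rightarrow> complex \<Rightarrow> complex" where
  "summand' k x = summand k x * (of_nat k * log_Phi' x - 1)"

lemma summand_eq_exp:
  assumes "Re x > 0"
  shows "summand k x = exp (- x + of_nat k * log_Phi x)"
  unfolding summand_def exp_log_Phi[OF assms, symmetric] exp_add exp_of_nat_mult ..

lemma has_field_derivative_summand:
  assumes "Re x > 0"
  shows "(summand k has_field_derivative summand' k x) (at x)"
proof -
  have "((\<lambda>x. exp (- x + of_nat k * log_Phi x)) has_field_derivative summand' k x) (at x)"
    using assms by (auto intro!: derivative_eq_intros log_Phi_aux(3) simp: summand'_def summand_eq_exp)
  then show ?thesis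
    by (rule has_field_derivative_transform_within_open[OF _ open_halfspace_Re_gt[of 0]])
       (use assms summand_eq_exp in auto)
qed

lemma summand_cnj:
  assumes "Re x > 0"
  shows "summand k (cnj x) = cnj (summand k x)" "summand' k (cnj x) = cnj (summand' k x)"
  using assms by (auto simp: summand'_def summand_eq_exp log_Phi_cnj exp_cnj)

lemma summand_of_real_pos:
  assumes "x > 0"
  shows "\<exists>y>0. summand k (of_real x) = of_real y"
proof -
  have "log_Phi (of_real x) = cnj (log_Phi (of_real x))"
    using log_Phi_cnj(1)[of "of_real x"] assms by simp
  then have "log_Phi (of_real x) = of_real (Re (log_Phi (of_real x)))"
    by (simp add: complex_eq_iff)
  then have "summand k (of_real x) = exp (of_real (- x + real k * Re (log_Phi (of_real x))))"
    using assms summand_eq_exp[of "of_real x" k] by simp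
  then show ?thesis
    unfolding exp_of_real by (intro exI[of _ "exp (- x + real k * Re (log_Phi (of_real x)))"]) simp
qed

text \<open>The real part of Ln (1 - w) is ln |1 - w|, which is at most |w|. Hence the product stays
  bounded on the half-plane and the factor \<open>exp (- x)\<close> gives the decay.\<close>

lemma summand_bound:
  assumes "\<rho> > 0"
  shows "\<exists>C>0. \<forall>x. Re x \<ge> \<rho> \<longrightarrow> norm (summand k x) \<le> C * exp (- Re x)"
proof -
  define K where "K = (\<Sum>n. exp (-\<rho>) ^ Suc n)"
  have summ: "summable (\<lambda>n. exp (-\<rho>) ^ Suc n)"
    using assms by (simp only: summable_Suc_iff summable_geometric_iff) simp
  have "norm (summand k x) \<le> exp (real k * K) * exp (- Re x)" if x: "Re x \<ge> \<rho>" for x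
  proof -
    have Rx: "Re x > 0" using x assms by simp
    have "Re (log_Phi x) \<le> K"
      unfolding K_def
    proof (rule sums_le)
      show "(\<lambda>n. Re (Ln (1 - exp (- of_nat (Suc n) * x)))) sums Re (log_Phi x)"
        by (rule sums_Re[OF log_Phi_aux(1)[OF Rx]])
      show "(\<lambda>n. exp (-\<rho>) ^ Suc n) sums (\<Sum>n. exp (-\<rho>) ^ Suc n)"
        by (rule summable_sums[OF summ])
      fix n
      define w where "w = exp (- of_nat (Suc n) * x)"
      have w: "norm w \<le> exp (-\<rho>) ^ Suc n" unfolding w_def by (rule norm_exp_mult_le[OF x])
      have nz: "1 - w \<noteq> 0" using one_minus_exp_not_nonpos[OF Rx, of n] by (auto simp: w_def)
      have "Re (Ln (1 - w)) = ln (norm (1 - w))" using nz by (simp add: Re_Ln)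
      also have "\<dots> \<le> norm (1 - w) - 1" using nz by (intro ln_le_minus_one) simp
      also have "\<dots> \<le> norm w" using norm_triangle_ineq4[of 1 w] by simp
      also note w
      finally show "Re (Ln (1 - exp (- of_nat (Suc n) * x))) \<le> exp (-\<rho>) ^ Suc n" unfolding w_def .
    qed
    then have "real k * Re (log_Phi x) \<le> real k * K" by (intro mult_left_mono) auto
    then have "exp (- Re x + real k * Re (log_Phi x)) \<le> exp (real k * K + - Re x)" by simp
    then show ?thesis unfolding summand_eq_exp[OF Rx] norm_exp_eq_Re exp_add[symmetric] by simp
  qed
  then show ?thesis by (intro exI[of _ "exp (real k * K)"]) auto
qed

lemma log_Phi'_bound:
  assumes "\<rho> > 0"
  shows "\<exists>C>0. \<forall>x. Re x \<ge> \<rho> \<longrightarrow> norm (log_Phi' x) \<le> C"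
proof -
  define h where "h n = exp (-\<rho>) ^ Suc n / (1 - exp (-\<rho>))\<^sup>2" for n
  have summ: "summable h"
    unfolding h_def[abs_def]
    using assms by (intro summable_divide) (simp only: summable_Suc_iff summable_geometric_iff, simp)
  have "norm (log_Phi' x) \<le> (\<Sum>n. h n)" if x: "Re x \<ge> \<rho>" for x
  proof -
    have Rx: "Re x > 0" using x assms by simp
    have nt: "norm (exp (- of_nat (Suc m) * x) / (1 - exp (- of_nat (Suc m) * x)) ^ 2) \<le> h m" for m
    proof -
      define w where "w = exp (- of_nat (Suc m) * x)"
      have w: "norm w \<le> exp (-\<rho>) ^ Suc m" unfolding w_def by (rule norm_exp_mult_le[OF x])
      also have "\<dots> \<le> exp (-\<rho>)" using assms power_Suc_le_self[of "exp (-\<rho>)" m] by simp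
      finally have "1 - exp (-\<rho>) \<le> norm (1 - w)" using norm_triangle_ineq2[of 1 w] by simp
      then have "norm w / norm (1 - w) ^ 2 \<le> h m"
        unfolding h_def using w assms by (intro frac_le power_mono) auto
      then show ?thesis unfolding w_def[symmetric] by (simp add: norm_divide norm_power)
    qed
    have "norm (\<Sum>m. exp (- of_nat (Suc m) * x) / (1 - exp (- of_nat (Suc m) * x)) ^ 2) \<le> (\<Sum>n. h n)"
      by (rule norm_suminf_le[OF nt summ]) 
    then show ?thesis using log_Phi'_eq_Lambert[OF Rx] by (simp add: sums_iff)
  qed
  moreover have "(\<Sum>n. h n) > 0"
    by (rule suminf_pos[OF summ]) (use assms in \<open>auto simp: h_def\<close>)
  ultimately show ?thesis by blast
qed

text \<open>Converts the decay of exp (- A / x) into a bound depending on |x| alone, uniformly up to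
  the boundary rays.\<close>

lemma Re_inverse_sector:
  assumes "x \<in> sector"
  shows "Re (1 / x) \<ge> 1 / (2 * norm x)"
proof -
  have n: "norm x > 0" using assms by (auto simp: sector_def)
  have "Re (1 / x) = Re x / (norm x)\<^sup>2" by (simp add: Re_divide cmod_power2)
  also have "\<dots> \<ge> (norm x / 2) / (norm x)\<^sup>2"
    using norm_le_sector[OF assms] by (intro divide_right_mono) auto
  finally show ?thesis using n by (simp add: power2_eq_square)
qed

text \<open>The behaviour of the summand at the origin: up to a nonzero constant it is
  \<open>x\<^sup>-\<^sup>\<kappa> e\<^sup>-\<^sup>A\<^sup>/\<^sup>x\<close>, with the constant \<open>c\<close> read off along the diagonal ray.\<close>
definition admissible :: "real \<Rightarrow> real \<Rightarrow> complex \<Rightarrow> (complex \<Rightarrow> complex) \<Rightarrow> bool" where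
  "admissible A \<kappa> c G \<longleftrightarrow>
     G holomorphic_on {x. Re x > 0} \<and>
     (\<forall>x. Re x > 0 \<longrightarrow> G (cnj x) = cnj (G x)) \<and>
     (\<exists>C>0. \<forall>x\<in>sector. norm (G x) \<le> C * exp (- Re x / 2)) \<and>
     (G \<longlongrightarrow> 0) (at 0 within sector) \<and>
     ((\<lambda>r. G (of_real r * (1 + \<i>)) * of_real (r powr \<kappa>) * exp (of_real A * (1 - \<i>) / of_real (2 * r))) \<longlongrightarrow> c) (at_right 0)"

text \<open>Glues an estimate at the vertex, where exp (- A / (2 |x|)) beats every power of |x|, to
  an exponential bound at infinity. The halved rate \<open>exp (- Re x / 2)\<close> leaves room for
  a polynomial factor such as the x in \<open>x * summand' k x\<close>.\<close>

lemma sector_decay: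
  fixes G :: "complex \<Rightarrow> complex"
  assumes A: "A > 0" and C: "C1 > 0" "C2 > 0" and \<kappa>: "\<kappa> > 0"
    and small: "\<And>x. x \<in> sector \<Longrightarrow> norm x \<le> 1 \<Longrightarrow> norm (G x) \<le> C1 * norm x powr (- \<kappa>) * exp (- A / (2 * norm x))"
    and large: "\<And>x. x \<in> sector \<Longrightarrow> Re x \<ge> 1 / 2 \<Longrightarrow> norm (G x) \<le> C2 * exp (- Re x / 2)"
  shows "\<exists>C>0. \<forall>x\<in>sector. norm (G x) \<le> C * exp (- Re x / 2)" "(G \<longlongrightarrow> 0) (at 0 within sector)"
proof -
  define h where "h r = C1 * r powr (- \<kappa>) * exp (- A / (2 * r))" for r :: real
  have h0: "(h \<longlongrightarrow> 0) (at_right 0)" unfolding h_def using A C \<kappa> by real_asymp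
  have nl: "filterlim norm (at_right 0) (at (0::complex) within sector)"
    by (auto simp: filterlim_at eventually_at_filter intro!: tendsto_norm_zero tendsto_ident_at)
  have ev: "\<forall>\<^sub>F x in at 0 within sector. norm (G x) \<le> h (norm x)"
    unfolding eventually_at_le h_def using small by (intro exI[of _ 1]) auto
  show lim: "(G \<longlongrightarrow> 0) (at 0 within sector)"
    by (rule Lim_null_comparison[OF ev filterlim_compose[OF h0 nl]])
  have "\<forall>\<^sub>F r in at_right 0. h r < 1" using h0 by (rule order_tendstoD) simp
  then obtain b where b: "b > 0" "\<And>r. 0 < r \<Longrightarrow> r < b \<Longrightarrow> h r < 1"
    unfolding eventually_at_right_field by auto
  \<comment> \<open>For Re x below 1/2 a plain constant suffices, since
    \<open>exp 1 * exp (- Re x / 2)\<close> exceeds 1 there. That constant covers |x| < b, where h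
    is below 1, and |x| \<ge> b, where the negative power is controlled by its value at
    \<open>min b 1\<close>.\<close>
  define C where "C = exp 1 * (1 + C1 * min b 1 powr (-\<kappa>)) + C2"
  have "norm (G x) \<le> C * exp (- Re x / 2)" if x: "x \<in> sector" for x
  proof (cases "Re x \<ge> 1 / 2")
    case True
    then have "norm (G x) \<le> C2 * exp (- Re x / 2)" using large x by blast
    also have "\<dots> \<le> C * exp (- Re x / 2)" using C by (intro mult_right_mono) (auto simp: C_def add_nonneg_nonneg)
    finally show ?thesis .
  next
    case False
    then have n1: "norm x \<le> 1" "norm x > 0" using norm_le_sector[OF x] x by (auto simp: sector_def)
    have "norm (G x) \<le> h (norm x)" using small[OF x n1(1)] by (simp add: h_def)
    also have "h (norm x) \<le> 1 + C1 * min b 1 powr (-\<kappa>)"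
    proof (cases "norm x < b")
      case True
      then have "h (norm x) \<le> 1" using b(2)[of "norm x"] n1 by simp
      then show ?thesis using C by (simp add: add_increasing2)
    next
      case False
      then have "norm x powr (-\<kappa>) \<le> min b 1 powr (-\<kappa>)" using b \<kappa> n1 by (intro powr_mono2') auto
      moreover have "exp (- A / (2 * norm x)) \<le> 1" using A n1 by simp
      ultimately have "norm x powr (-\<kappa>) * exp (- A / (2 * norm x)) \<le> min b 1 powr (-\<kappa>) * 1"
        by (intro mult_mono) auto
      then have "C1 * (norm x powr (-\<kappa>) * exp (- A / (2 * norm x))) \<le> C1 * min b 1 powr (-\<kappa>)"
        using C by (intro mult_left_mono) auto
      then show ?thesis by (simp add: h_def mult.assoc)
    qed
    also have "\<dots> \<le> exp 1 * exp (- Re x / 2) * (1 + C1 * min b 1 powr (-\<kappa>))"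
    proof -
      have "1 \<le> exp (1 - Re x / 2)" using False by simp
      also have "\<dots> = exp 1 * exp (- Re x / 2)" by (simp add: exp_add[symmetric])
      finally show ?thesis using C mult_right_mono[of 1 "exp 1 * exp (- Re x / 2)" "1 + C1 * min b 1 powr (-\<kappa>)"]
        by (simp add: add_nonneg_nonneg)
    qed
    also have "\<dots> \<le> C * exp (- Re x / 2)" using C by (simp add: C_def algebra_simps)
    finally show ?thesis .
  qed
  moreover have "C > 0" using C by (simp add: C_def add_nonneg_pos)
  ultimately show "\<exists>C>0. \<forall>x\<in>sector. norm (G x) \<le> C * exp (- Re x / 2)" by blast
qed

lemma ray_in_sector: "r > 0 \<Longrightarrow> of_real r * (1 + \<i>) \<in> sector"
  by (simp add: sector_def)

text \<open>Exponentiating the expansion gives exp (k l) x^(-k/2) exp (- A / x) to leading order. On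
  the ray, the logarithm of 1 + \<i> supplies the argument - k pi/8, and its modulus is absorbed in
  \<open>c0\<close>. The derivative brings the factor \<open>of_nat k * log_Phi' x - 1\<close>;
  times x this is A / x to leading order, that is A (1 - \<i>) / (2 r) on the ray, so the exponent
  rises by one. The extra x appears because t times the derivative of a twisted sum is a sum of the
  same shape over x \<open>summand' k x\<close>.\<close>

lemma admissible_summand:
  assumes k: "k \<ge> 1" and A_def: "A = real k * pi\<^sup>2 / 6"
  shows "\<exists>c0>0. admissible A (real k / 2) (of_real c0 * cis (- (real k * pi / 8))) (summand k) \<and>
     admissible A (real k / 2 + 1) (of_real c0 * cis (- (real k * pi / 8)) * (of_real A * (1 - \<i>) / 2)) (\<lambda>x. x * summand' k x)"
proof -
  obtain l C where C: "C > 0"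
    "\<And>x. x \<in> sector \<Longrightarrow> norm x \<le> 1 \<Longrightarrow> norm (log_Phi_reg x - of_real l) \<le> C * norm x"
    using log_Phi_reg_limit by blast
  obtain D where D: "D > 0" "\<And>x. x \<in> sector \<Longrightarrow>
     norm (log_Phi' x + 1 / (2 * x) - of_real (pi\<^sup>2) / (6 * x\<^sup>2)) \<le> D * (1 + norm x)"
    using log_Phi'_expansion by blast
  have A: "A > 0" using k by (simp add: A_def)
  have eq: "summand k x = exp (- x + of_nat k * log_Phi_reg x - of_nat k / 2 * Ln x - of_real A / x)"
    if "x \<in> sector" for x
    using that by (subst summand_eq_exp)
      (auto simp: sector_def log_Phi_reg_def A_def algebra_simps add_divide_distrib diff_divide_distrib)
  define C1 where "C1 = exp (real k * (l + C))"
  have small: "norm (summand k x) \<le> C1 * norm x powr (- (real k / 2)) * exp (- A / (2 * norm x))"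
    if x: "x \<in> sector" "norm x \<le> 1" for x
  proof -
    have x0: "norm x > 0" "x \<noteq> 0" "Re x > 0" using x by (auto simp: sector_def)
    have "norm (log_Phi_reg x - of_real l) \<le> C"
      using C(2)[OF x] C(1) x(2) mult_left_mono[of "norm x" 1 C] by linarith
    then have "Re (log_Phi_reg x - of_real l) \<le> C" using complex_Re_le_cmod order.trans by blast
    then have 1: "real k * Re (log_Phi_reg x) \<le> real k * (l + C)" by (intro mult_left_mono) auto
    have 2: "A * (1 / (2 * norm x)) \<le> A * Re (1 / x)"
      using A Re_inverse_sector[OF x(1)] by (intro mult_left_mono) auto
    have "norm (summand k x) = exp (Re (- x + of_nat k * log_Phi_reg x - of_nat k / 2 * Ln x - of_real A / x))"
      unfolding eq[OF x(1)] by (rule norm_exp_eq_Re)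
    also have "Re (- x + of_nat k * log_Phi_reg x - of_nat k / 2 * Ln x - of_real A / x) =
         - Re x + real k * Re (log_Phi_reg x) - real k / 2 * ln (norm x) - A * Re (1 / x)"
    proof -
      have "of_real A / x = of_real A * (1 / x)" by simp
      then have "Re (of_real A / x) = A * Re (1 / x)" by (metis Re_complex_of_real Im_complex_of_real diff_zero mult_zero_left times_complex.sel(1))
      moreover have "Re (of_nat k / 2 * Ln x) = real k / 2 * ln (norm x)"
        using x0 by (simp add: Re_Ln)
      ultimately show ?thesis by simp
    qed
    also have "\<dots> \<le> real k * (l + C) + (- (real k / 2) * ln (norm x)) + (- A / (2 * norm x))"
      using 1 2 x0 by simp
    also have "exp \<dots> = C1 * norm x powr (- (real k / 2)) * exp (- A / (2 * norm x))"
      using x0 by (simp only: exp_add C1_def powr_def) simp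
    finally show ?thesis by simp
  qed
  obtain C2 where C2: "C2 > 0" "\<And>x. Re x \<ge> 1/2 \<Longrightarrow> norm (summand k x) \<le> C2 * exp (- Re x)"
    using summand_bound[of "1/2" k] by auto
  obtain C3 where C3: "C3 > 0" "\<And>x. Re x \<ge> 1/2 \<Longrightarrow> norm (log_Phi' x) \<le> C3"
    using log_Phi'_bound[of "1/2"] by auto
  have large: "norm (summand k x) \<le> C2 * exp (- Re x / 2)" if x: "x \<in> sector" "Re x \<ge> 1/2" for x
  proof -
    have "norm (summand k x) \<le> C2 * exp (- Re x)" using C2(2) x by blast
    also have "\<dots> \<le> C2 * exp (- Re x / 2)" using C2(1) x by (intro mult_left_mono) auto
    finally show ?thesis .
  qed
  \<comment> \<open>\<open>2 * D\<close>, 1 and \<open>pi\<^sup>2\<close> bound the remainder, the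
    1/(2 x) term and the leading term of the logarithmic derivative, each against 1 / |x|^2. The
    leading 1 accounts for the - 1 in \<open>summand'\<close>.\<close>
  define C4 where "C4 = C1 * (1 + real k * (2 * D + 1 + pi\<^sup>2))"
  have small': "norm (x * summand' k x) \<le> C4 * norm x powr (- (real k / 2 + 1)) * exp (- A / (2 * norm x))"
    if x: "x \<in> sector" "norm x \<le> 1" for x
  proof -
    have x0: "norm x > 0" "x \<noteq> 0" using x by (auto simp: sector_def)
    have nl: "norm (log_Phi' x) \<le> (2 * D + 1 + pi\<^sup>2) / (norm x)\<^sup>2"
    proof -
      have "log_Phi' x = (log_Phi' x + 1 / (2 * x) - of_real (pi\<^sup>2) / (6 * x\<^sup>2)) + (of_real (pi\<^sup>2) / (6 * x\<^sup>2) - 1 / (2 * x))"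
        by simp
      then have "norm (log_Phi' x) \<le> norm (log_Phi' x + 1 / (2 * x) - of_real (pi\<^sup>2) / (6 * x\<^sup>2)) + norm (of_real (pi\<^sup>2) / (6 * x\<^sup>2) - 1 / (2 * x))"
        using norm_triangle_ineq by metis
      also have "\<dots> \<le> D * (1 + norm x) + (norm (of_real (pi\<^sup>2) / (6 * x\<^sup>2)) + norm (1 / (2 * x)))"
        by (intro add_mono D(2) x(1) norm_triangle_ineq4)
      also have "norm (of_real (pi\<^sup>2) / (6 * x\<^sup>2)) = pi\<^sup>2 / (6 * (norm x)\<^sup>2)"
        by (simp add: norm_divide norm_mult norm_power)
      also have "norm (1 / (2 * x)) = 1 / (2 * norm x)" by (simp add: norm_divide norm_mult)
      also have "D * (1 + norm x) \<le> 2 * D / (norm x)\<^sup>2"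
      proof -
        have "D * (1 + norm x) * (norm x)\<^sup>2 \<le> D * 2 * 1"
          using D(1) x(2) by (intro mult_mono) (auto simp: power_le_one)
        then show ?thesis using x0 by (simp add: pos_le_divide_eq mult_ac)
      qed
      also have "pi\<^sup>2 / (6 * (norm x)\<^sup>2) \<le> pi\<^sup>2 / (norm x)\<^sup>2" using x0 by (intro divide_left_mono) auto
      also have "1 / (2 * norm x) \<le> 1 / (norm x)\<^sup>2"
        using x0 x(2) by (intro divide_left_mono) (auto simp: power2_eq_square)
      finally show ?thesis by (simp add: add_divide_distrib)
    qed
    have "norm (of_nat k * log_Phi' x - 1) \<le> real k * norm (log_Phi' x) + 1"
      using norm_triangle_ineq4[of "of_nat k * log_Phi' x" 1] by (simp add: norm_mult)
    also have "\<dots> \<le> real k * ((2 * D + 1 + pi\<^sup>2) / (norm x)\<^sup>2) + 1 / (norm x)\<^sup>2"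
      using x0 x(2) by (intro add_mono mult_left_mono nl) (auto simp: power_le_one)
    also have "\<dots> = (1 + real k * (2 * D + 1 + pi\<^sup>2)) / (norm x)\<^sup>2"
      unfolding add_divide_distrib[of 1] times_divide_eq_right by (rule add.commute)
    finally have m: "norm (of_nat k * log_Phi' x - 1) \<le> (1 + real k * (2 * D + 1 + pi\<^sup>2)) / (norm x)\<^sup>2" .
    have "norm (x * summand' k x) = norm x * (norm (summand k x) * norm (of_nat k * log_Phi' x - 1))"
      by (simp add: summand'_def norm_mult)
    also have "\<dots> \<le> norm x * ((C1 * norm x powr (- (real k / 2)) * exp (- A / (2 * norm x))) * ((1 + real k * (2 * D + 1 + pi\<^sup>2)) / (norm x)\<^sup>2))"
      by (intro mult_left_mono mult_mono small x m) (auto simp: C1_def)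
    also have "\<dots> = C4 * (norm x powr (- (real k / 2)) * (norm x powr (-1))) * exp (- A / (2 * norm x))"
      using x0 by (simp add: C4_def power2_eq_square powr_minus field_simps)
    also have "norm x powr (- (real k / 2)) * (norm x powr (-1)) = norm x powr (- (real k / 2 + 1))"
      unfolding powr_add[symmetric] by simp
    finally show ?thesis .
  qed
  have large': "norm (x * summand' k x) \<le> (4 * C2 * (real k * C3 + 1)) * exp (- Re x / 2)" if x: "x \<in> sector" "Re x \<ge> 1/2" for x
  proof -
    have "norm (of_nat k * log_Phi' x - 1) \<le> real k * norm (log_Phi' x) + 1"
      using norm_triangle_ineq4[of "of_nat k * log_Phi' x" 1] by (simp add: norm_mult)
    also have "\<dots> \<le> real k * C3 + 1" using C3(2)[OF x(2)] by (simp add: mult_left_mono)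
    finally have m: "norm (of_nat k * log_Phi' x - 1) \<le> real k * C3 + 1" .
    have "norm (x * summand' k x) = norm x * (norm (summand k x) * norm (of_nat k * log_Phi' x - 1))"
      by (simp add: summand'_def norm_mult)
    also have "\<dots> \<le> (2 * Re x) * ((C2 * exp (- Re x)) * (real k * C3 + 1))"
      using C2 C3 x by (intro mult_mono m norm_le_sector C2(2) mult_nonneg_nonneg) auto
    also have "\<dots> = (4 * C2 * (real k * C3 + 1)) * ((Re x / 2) * exp (- Re x))" by simp
    also have "(Re x / 2) * exp (- Re x) \<le> exp (Re x / 2) * exp (- Re x)"
      using exp_ge_add_one_self[of "Re x / 2"] by (intro mult_right_mono; linarith?) simp
    also have "exp (Re x / 2) * exp (- Re x) = exp (- Re x / 2)" by (simp add: exp_add[symmetric])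
    finally show ?thesis using C2 C3 by (simp add: mult_left_mono)
  qed
  define c where "c = exp (of_nat k * of_real l - of_nat k / 2 * Ln (1 + \<i>))"
  define c0 where "c0 = exp (real k * l - real k / 2 * ln (sqrt 2))"
  have c_eq: "c = of_real c0 * cis (- (real k * pi / 8))"
  proof -
    have "Ln (1 + \<i>) = of_real (ln (sqrt 2)) + \<i> * of_real (pi / 4)"
    proof (rule Ln_unique)
      have "exp (of_real (ln (sqrt 2)) + \<i> * of_real (pi / 4)) = of_real (sqrt 2) * cis (pi / 4)"
        unfolding exp_add exp_of_real by (simp add: cis_conv_exp)
      also have "\<dots> = 1 + \<i>" by (simp add: complex_eq_iff cos_45 sin_45)
      finally show "exp (of_real (ln (sqrt 2)) + \<i> * of_real (pi / 4)) = 1 + \<i>" .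
    qed (use pi_gt3 in auto)
    then have "of_nat k * of_real l - of_nat k / 2 * Ln (1 + \<i>) =
        of_real (real k * l - real k / 2 * ln (sqrt 2)) + \<i> * of_real (- (real k * pi / 8))"
      by (simp add: algebra_simps)
    then show ?thesis unfolding c_def c0_def cis_conv_exp by (simp only: exp_add exp_of_real)
  qed
  define X where "X r = of_real r * (1 + \<i>)" for r :: real
  have Xs: "X r \<in> sector" if "r > 0" for r using ray_in_sector[OF that] by (simp add: X_def)
  have X0: "(X \<longlongrightarrow> 0) (at_right 0)"
  proof -
    have "((\<lambda>r. of_real r * (1 + \<i>)) \<longlongrightarrow> of_real 0 * (1 + \<i>)) (at_right 0)"
      by (intro tendsto_intros)
    then show ?thesis unfolding X_def by simp
  qed
  have iX: "1 / X r = (1 - \<i>) / of_real (2 * r)" if "r > 0" for r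
    using that by (simp add: X_def complex_eq_iff Re_divide Im_divide field_simps power2_eq_square)
  have reg: "((\<lambda>r. log_Phi_reg (X r)) \<longlongrightarrow> of_real l) (at_right 0)"
  proof (rule Lim_transform_bound[of _ "\<lambda>r. C * norm (X r)"] | rule LIM_zero_cancel, rule Lim_null_comparison)
    show "((\<lambda>r. C * norm (X r)) \<longlongrightarrow> 0) (at_right 0)"
      using tendsto_mult_right_zero[OF tendsto_norm_zero[OF X0]] .
    have "\<forall>\<^sub>F r in at_right 0. norm (X r) < 1"
      using tendsto_norm_zero[OF X0] by (rule order_tendstoD) simp
    moreover have "\<forall>\<^sub>F r::real in at_right 0. r > 0" by (rule eventually_at_right_less)
    ultimately show "\<forall>\<^sub>F r in at_right 0. norm (log_Phi_reg (X r) - of_real l) \<le> C * norm (X r)"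
      by eventually_elim (use C(2) Xs in auto)
  qed
  have pos: "\<forall>\<^sub>F r::real in at_right 0. r > 0" by (rule eventually_at_right_less)
  have lim: "((\<lambda>r. summand k (X r) * of_real (r powr (real k / 2)) * exp (of_real A * (1 - \<i>) / of_real (2 * r))) \<longlongrightarrow> c) (at_right 0)"
  proof -
    have "((\<lambda>r. exp (- X r + of_nat k * log_Phi_reg (X r) - of_nat k / 2 * Ln (1 + \<i>))) \<longlongrightarrow>
       exp (- 0 + of_nat k * of_real l - of_nat k / 2 * Ln (1 + \<i>))) (at_right 0)"
      by (intro tendsto_intros X0 reg)
    moreover have "\<forall>\<^sub>F r in at_right 0. exp (- X r + of_nat k * log_Phi_reg (X r) - of_nat k / 2 * Ln (1 + \<i>)) =
       summand k (X r) * of_real (r powr (real k / 2)) * exp (of_real A * (1 - \<i>) / of_real (2 * r))"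
      using pos
    proof eventually_elim
      case (elim r)
      have L: "Ln (X r) = of_real (ln r) + Ln (1 + \<i>)"
        unfolding X_def using elim by (subst Ln_times_of_real) (auto simp: complex_eq_iff)
      have p: "of_real (r powr (real k / 2)) = exp (of_nat k / 2 * of_real (ln r) :: complex)"
        using elim by (simp add: powr_def exp_of_real[symmetric])
      have a: "of_real A * (1 - \<i>) / of_real (2 * r) = of_real A / X r"
        using iX[OF elim] by (metis times_divide_eq_right mult.right_neutral)
      show ?case unfolding eq[OF Xs[OF elim]] p a exp_add[symmetric] L by (simp add: algebra_simps)
    qed
    ultimately show ?thesis by (simp add: c_def tendsto_cong)
  qed
  have lim': "((\<lambda>r. X r * summand' k (X r) * of_real (r powr (real k / 2 + 1)) * exp (of_real A * (1 - \<i>) / of_real (2 * r))) \<longlongrightarrow> c * (of_real A * (1 - \<i>) / 2)) (at_right 0)"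
  proof -
    define R where "R r = log_Phi' (X r) + 1 / (2 * X r) - of_real (pi\<^sup>2) / (6 * (X r)\<^sup>2)" for r
    have r0: "((\<lambda>r. of_real r :: complex) \<longlongrightarrow> 0) (at_right 0)"
      using tendsto_of_real[OF tendsto_ident_at, of "0::real"] by simp
    have XR: "((\<lambda>r. X r * R r) \<longlongrightarrow> 0) (at_right 0)"
    proof (rule Lim_null_comparison)
      show "((\<lambda>r. norm (X r) * (D * (1 + norm (X r)))) \<longlongrightarrow> 0) (at_right 0)"
      proof -
        have "((\<lambda>r. norm (X r) * (D * (1 + norm (X r)))) \<longlongrightarrow> 0 * (D * (1 + 0))) (at_right 0)"
          by (intro tendsto_intros tendsto_norm_zero X0)
        then show ?thesis by simp
      qed
      show "\<forall>\<^sub>F r in at_right 0. norm (X r * R r) \<le> norm (X r) * (D * (1 + norm (X r)))"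
        using pos
      proof eventually_elim
        case (elim r)
        show ?case unfolding norm_mult R_def by (intro mult_left_mono D(2) Xs elim norm_ge_zero)
      qed
    qed
    \<comment> \<open>Multiplied by r, the product of \<open>X r\<close> and the logarithmic
      derivative has a finite limit: the remainder and the constant - 1/2 die out, while r / X r is
      the constant (1 - \<i>) / 2.\<close>
    have L1: "((\<lambda>r. (summand k (X r) * of_real (r powr (real k / 2)) * exp (of_real A * (1 - \<i>) / of_real (2 * r))) *
        (of_nat k * (of_real r * (X r * R r) - of_real r / 2 + of_real (pi\<^sup>2) * (1 - \<i>) / 12) - of_real r * X r)) \<longlongrightarrow>
        c * (of_nat k * (0 * 0 - 0 / 2 + of_real (pi\<^sup>2) * (1 - \<i>) / 12) - 0 * 0)) (at_right 0)"
      by (intro tendsto_intros lim XR r0 X0) simp_all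
    have L2: "c * (of_nat k * (0 * 0 - 0 / 2 + of_real (pi\<^sup>2) * (1 - \<i>) / 12) - 0 * 0) = c * (of_real A * (1 - \<i>) / 2)"
      by (simp add: A_def)
    have L3: "\<forall>\<^sub>F r in at_right 0. (summand k (X r) * of_real (r powr (real k / 2)) * exp (of_real A * (1 - \<i>) / of_real (2 * r))) *
        (of_nat k * (of_real r * (X r * R r) - of_real r / 2 + of_real (pi\<^sup>2) * (1 - \<i>) / 12) - of_real r * X r) =
        X r * summand' k (X r) * of_real (r powr (real k / 2 + 1)) * exp (of_real A * (1 - \<i>) / of_real (2 * r))"
      using pos
    proof eventually_elim
      case (elim r)
      have X_ne: "X r \<noteq> 0" using Xs[OF elim] by (auto simp: sector_def)
      have p: "of_real (r powr (real k / 2 + 1)) = of_real (r powr (real k / 2)) * (of_real r :: complex)"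
        using elim by (simp add: powr_add)
      have "X r * log_Phi' (X r) = X r * R r - 1 / 2 + of_real (pi\<^sup>2) / 6 * (1 / X r)"
        using X_ne by (simp add: R_def field_simps power2_eq_square)
      also have "\<dots> = X r * R r - 1 / 2 + of_real (pi\<^sup>2) / 6 * ((1 - \<i>) / of_real (2 * r))"
        by (simp only: iX[OF elim])
      finally have "of_real r * (X r * log_Phi' (X r)) = of_real r * (X r * R r) - of_real r / 2 + of_real (pi\<^sup>2) * (1 - \<i>) / 12"
        using elim by (simp add: field_simps)
      note XL = this[symmetric]
      show ?case unfolding p summand'_def XL by (simp add: algebra_simps)
    qed
    from Lim_transform_eventually[OF L1 L3] show ?thesis unfolding L2 .
  qed
  have hol: "summand k holomorphic_on {x. Re x > 0}"
    using has_field_derivative_summand by (auto simp: holomorphic_on_def field_differentiable_def intro: has_field_derivative_at_within)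
  have hol': "(\<lambda>x. x * summand' k x) holomorphic_on {x. Re x > 0}"
  proof -
    have "deriv (summand k) holomorphic_on {x. Re x > 0}"
      by (intro holomorphic_deriv hol open_halfspace_Re_gt)
    then have "summand' k holomorphic_on {x. Re x > 0}"
      by (rule holomorphic_transform) (auto intro: DERIV_imp_deriv has_field_derivative_summand)
    then show ?thesis by (intro holomorphic_intros)
  qed
  have "C4 > 0" "C1 > 0" using D(1) by (auto simp: C4_def C1_def add_pos_nonneg)
  have "4 * C2 * (real k * C3 + 1) > 0" using C2 C3 by (simp add: add_nonneg_pos)
  have k2: "real k / 2 > 0" "real k / 2 + 1 > 0" using k by auto
  note sd = sector_decay[OF A \<open>C1 > 0\<close> C2(1) k2(1) small large]
  note sd' = sector_decay[OF A \<open>C4 > 0\<close> \<open>4 * C2 * (real k * C3 + 1) > 0\<close> k2(2) small' large']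
  have "admissible A (real k / 2) c (summand k)"
    unfolding admissible_def using hol sd lim summand_cnj(1) by (auto simp: X_def)
  moreover have "admissible A (real k / 2 + 1) (c * (of_real A * (1 - \<i>) / 2)) (\<lambda>x. x * summand' k x)"
    unfolding admissible_def using hol' sd' lim' summand_cnj(2) by (auto simp: X_def)
  moreover have "c0 > 0" by (simp add: c0_def)
  ultimately show ?thesis unfolding c_eq by blast
qed

section \<open>Gaussian integrals\<close>

text \<open>The dominating function for the Gaussian integral and for Laplace's method, assembled
  from an exponential on the half-line and its reflection; they add up to it except at 0.\<close>

lemma integrable_exp_abs: "integrable lborel (\<lambda>v::real. exp (- \<bar>v\<bar> / 2))"
proof -
  have 1: "integrable lborel (\<lambda>v::real. indicator {0<..} v *\<^sub>R exp (- (v * (1 / 2))))"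
    using integrable_I0i_exp_mscale[of "1/2"] by (simp add: set_integrable_def)
  have 2: "integrable lborel (\<lambda>v::real. indicator {0<..} (0 + (-1) * v) *\<^sub>R exp (- ((0 + (-1) * v) * (1 / 2))))"
    by (rule lborel_integrable_real_affine[OF 1]) simp
  have "integrable lborel (\<lambda>v::real. indicator {0<..} v *\<^sub>R exp (- (v * (1 / 2))) +
      indicator {0<..} (0 + (-1) * v) *\<^sub>R exp (- ((0 + (-1) * v) * (1 / 2))))"
    by (rule Bochner_Integration.integrable_add[OF 1 2])
  also have "?this \<longleftrightarrow> ?thesis"
  proof (rule integrable_cong_AE)
    show "AE v in lborel. indicator {0<..} v *\<^sub>R exp (- (v * (1 / 2))) +
      indicator {0<..} (0 + (-1) * v) *\<^sub>R exp (- ((0 + (-1) * v) * (1 / 2))) = exp (- \<bar>v\<bar> / (2::real))"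
      using AE_lborel_singleton[of "0::real"] by eventually_elim (auto simp: indicator_def)
  qed measurable
  finally show ?thesis .
qed

text \<open>The principal square root of pi / (1 - \<i>). The coefficient 1 - \<i> is the constant
  complex factor of the exponent on the diagonal ray.\<close>

definition complex_gauss :: complex where
  "complex_gauss = (LINT v|lborel. exp (- ((1 - \<i>) * of_real (v\<^sup>2))))"

lemma norm_complex_gauss: "norm (exp (- ((1 - \<i>) * of_real (v\<^sup>2)))) = exp (- v\<^sup>2)"
  by (simp add: norm_exp_eq_Re)

lemma exp_minus_square_le: "exp (- (v::real)\<^sup>2) \<le> exp 1 * exp (- \<bar>v\<bar> / 2)"
proof -
  have "0 \<le> (\<bar>v\<bar> - 1 / 4)\<^sup>2" by simp
  then have "- v\<^sup>2 \<le> 1 + (- \<bar>v\<bar> / 2)" by (simp add: power2_diff power2_eq_square[of "1/4 :: real"])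
  then show ?thesis unfolding exp_add[symmetric] by simp
qed

text \<open>Rotating the line of integration by \<open>\<pi>/8\<close> turns the integral into a real Gaussian integral.\<close>
lemma complex_gauss_polar: "\<exists>\<gamma>>0. complex_gauss = of_real \<gamma> * cis (pi / 8)"
proof -
  \<comment> \<open>The square root of 1 - \<i> with positive real part: the substitution y = b v
    turns the integrand into exp (- y^2) on a rotated line.\<close>
  define b where "b = of_real (sqrt (sqrt 2)) * cis (- (pi / 8))"
  have b2: "b\<^sup>2 = 1 - \<i>"
  proof -
    have "b\<^sup>2 = of_real ((sqrt (sqrt 2))\<^sup>2) * cis (- (pi / 8) + - (pi / 8))"
      unfolding b_def power_mult_distrib power2_eq_square[of "cis _"] cis_mult of_real_power ..
    also have "- (pi / 8) + - (pi / 8) = - (pi / 4)" by simp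
    also have "of_real ((sqrt (sqrt 2))\<^sup>2) * cis (- (pi / 4)) = 1 - \<i>"
      by (simp add: complex_eq_iff cos_45 sin_45)
    finally show ?thesis .
  qed
  have bn: "b \<noteq> 0" using b2 by auto
  define B where "B = Re b"
  have Bpos: "B > 0" using cos_gt_zero_pi[of "pi/8"] by (simp add: B_def b_def)
  have ReIm: "B\<^sup>2 - (Im b)\<^sup>2 = 1"
  proof -
    have "Re (b\<^sup>2) = 1" by (simp add: b2)
    then show ?thesis by (simp add: B_def power2_eq_square)
  qed
  have hol: "(\<lambda>y::complex. exp (- (y\<^sup>2))) holomorphic_on UNIV" by (intro holomorphic_intros)
  \<comment> \<open>An entire primitive replaces the contour argument: the integrals over the
    rotated and over the real line become differences of E at endpoints, which only have to be
    compared.\<close>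
  have "\<exists>E. \<forall>y::complex. (E has_field_derivative exp (- (y\<^sup>2))) (at y)"
  proof (rule holomorphic_convex_primitive'[OF convex_UNIV open_UNIV hol])
    fix g assume "\<And>y::complex. y \<in> UNIV \<Longrightarrow> (g has_field_derivative exp (- (y\<^sup>2))) (at y)"
    then show ?thesis by (intro exI[of _ g]) simp
  qed
  then obtain E where "\<forall>y::complex. (E has_field_derivative exp (- (y\<^sup>2))) (at y)" ..
  note E = this[rule_format]
  have ftc: "((\<lambda>v. w * exp (- (w * of_real v)\<^sup>2)) has_integral (E (w * of_real R) - E (w * of_real (- R)))) {-R..R}"
    if "R \<ge> 0" for w R
  proof -
    have "((\<lambda>v. w * exp (- (w * of_real v)\<^sup>2)) has_integral (E (w * of_real R) - E (w * of_real (- R)))) {-R..R}"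
    proof (rule fundamental_theorem_of_calculus)
      fix x assume "x \<in> {-R..R}"
      have "((\<lambda>v. w * of_real v) has_vector_derivative w) (at x within {-R..R})"
        unfolding has_vector_derivative_def mult.commute[of w] scaleR_conv_of_real[symmetric]
        by (intro has_derivative_scaleR_left has_derivative_ident)
      from field_vector_diff_chain_within[OF this has_field_derivative_at_within[OF E]]
      show "((\<lambda>v. E (w * of_real v)) has_vector_derivative w * exp (- (w * of_real x)\<^sup>2)) (at x within {-R..R})"
        by (simp add: o_def)
    qed (use that in simp)
    then show ?thesis by simp
  qed
  define f where "f v = exp (- ((1 - \<i>) * of_real (v\<^sup>2)))" for v
  have f_meas: "f \<in> borel_measurable borel"
    unfolding f_def by (intro borel_measurable_continuous_onI continuous_intros)
  have dom: "integrable lborel (\<lambda>v::real. exp 1 * exp (- \<bar>v\<bar> / 2))"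
    by (intro integrable_mult_right integrable_exp_abs)
  have fi: "integrable lborel f"
    by (rule Bochner_Integration.integrable_bound[OF dom])
       (use f_meas exp_minus_square_le in \<open>auto simp: f_def norm_complex_gauss\<close>)
  have lim: "((\<lambda>R. LINT v|lborel. indicator {-R..R} v *\<^sub>R f v) \<longlongrightarrow> complex_gauss) at_top"
    unfolding complex_gauss_def f_def[symmetric]
  proof (rule integral_dominated_convergence_at_top[OF _ _ dom])
    show "AE x in lborel. ((\<lambda>R. indicator {-R..R} x *\<^sub>R f x) \<longlongrightarrow> f x) at_top"
    proof (intro AE_I2 tendsto_eventually)
      fix x :: real
      show "\<forall>\<^sub>F R in at_top. indicator {-R..R} x *\<^sub>R f x = f x"
        using eventually_ge_at_top[of "\<bar>x\<bar>"] by eventually_elim (auto simp: indicator_def)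
    qed
    show "\<forall>\<^sub>F R in at_top. AE v in lborel. norm (indicator {-R..R} v *\<^sub>R f v) \<le> exp 1 * exp (- \<bar>v\<bar> / 2)"
    proof (intro always_eventually allI AE_I2)
      fix R v :: real
      have "norm (indicator {-R..R} v *\<^sub>R f v) \<le> norm (f v)" by (auto simp: indicator_def)
      also have "norm (f v) = exp (- v\<^sup>2)" by (simp only: f_def norm_complex_gauss)
      also note exp_minus_square_le[of v]
      finally show "norm (indicator {-R..R} v *\<^sub>R f v) \<le> exp 1 * exp (- \<bar>v\<bar> / 2)" .
    qed
  qed (use f_meas in measurable)
  have int: "b * (LINT v|lborel. indicator {-R..R} v *\<^sub>R f v) = E (b * of_real R) - E (b * of_real (- R))" if "R \<ge> 0" for R
  proof -
    have "set_integrable lborel {-R..R} f"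
      using fi by (rule integrable_restrict_UNIV[THEN iffD2, OF _ ] | simp add: set_integrable_def integrable_mult_indicator)
    from set_borel_integral_eq_integral(2)[OF this]
    have "(LINT v|lborel. indicator {-R..R} v *\<^sub>R f v) = integral {-R..R} f"
      by (simp add: set_lebesgue_integral_def)
    moreover have "b * integral {-R..R} f = integral {-R..R} (\<lambda>v. b * f v)" by simp
    moreover have "(\<lambda>v. b * f v) = (\<lambda>v. b * exp (- (b * of_real v)\<^sup>2))"
      by (simp add: f_def power_mult_distrib b2)
    ultimately show ?thesis using integral_unique[OF ftc[OF that, of b]] by (simp only:)
  qed
  \<comment> \<open>On the segment joining b R to its real part B R one has Re (y^2) \<ge> R^2,
    because B^2 - (Im b)^2 = 1. So the endpoint values differ by a Gaussian small amount.\<close>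
  have close: "norm (E (b * of_real R) - E (of_real (B * R))) \<le> norm b * \<bar>R\<bar> * exp (- R\<^sup>2)" for R
  proof -
    have "norm (E (b * of_real R) - E (of_real (B * R))) \<le> exp (- R\<^sup>2) * norm (b * of_real R - of_real (B * R))"
    proof (rule field_differentiable_bound[of "closed_segment (b * of_real R) (of_real (B * R))" E "\<lambda>y. exp (- (y\<^sup>2))"])
      fix y assume "y \<in> closed_segment (b * of_real R) (complex_of_real (B * R))"
      then obtain u where u: "0 \<le> u" "u \<le> 1" "y = (1 - u) *\<^sub>R (b * of_real R) + u *\<^sub>R of_real (B * R)"
        by (auto simp: in_segment)
      have "Re y = B * R" "Im y = (1 - u) * (Im b * R)"
        by (auto simp: u B_def algebra_simps)
      then have "Re (- (y\<^sup>2)) = ((1 - u) * (Im b * R))\<^sup>2 - (B * R)\<^sup>2" by (simp add: power2_eq_square)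
      also have "\<dots> = ((1 - u)\<^sup>2 * (Im b)\<^sup>2 - B\<^sup>2) * R\<^sup>2" by (simp add: power2_eq_square algebra_simps)
      also have "\<dots> \<le> (1 * (Im b)\<^sup>2 - B\<^sup>2) * R\<^sup>2"
        using u by (intro mult_right_mono diff_right_mono power_le_one) auto
      also have "\<dots> = - R\<^sup>2" using ReIm by (simp add: algebra_simps)
      finally show "norm (exp (- (y\<^sup>2))) \<le> exp (- R\<^sup>2)" by (simp add: norm_exp_eq_Re)
    qed (auto intro: has_field_derivative_at_within E)
    also have "norm (b * of_real R - of_real (B * R)) = \<bar>Im b\<bar> * \<bar>R\<bar>"
      by (simp add: cmod_def B_def abs_mult power_mult_distrib real_sqrt_mult)
    also have "exp (- R\<^sup>2) * (\<bar>Im b\<bar> * \<bar>R\<bar>) \<le> exp (- R\<^sup>2) * (norm b * \<bar>R\<bar>)"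
      using abs_Im_le_cmod[of b] by (intro mult_left_mono mult_right_mono) auto
    finally show ?thesis by (simp add: mult_ac)
  qed
  define K where "K R = integral {-R..R} (\<lambda>v::real. exp (- v\<^sup>2))" for R
  have real_int: "E (of_real R) - E (of_real (- R)) = of_real (K R)" if "R \<ge> 0" for R
  proof -
    have i: "(\<lambda>v::real. exp (- v\<^sup>2)) integrable_on {-R..R}"
      by (intro integrable_continuous_interval continuous_intros)
    have "((\<lambda>v. complex_of_real (exp (- v\<^sup>2))) has_integral of_real (K R)) {-R..R}"
      unfolding K_def by (intro has_integral_of_real integrable_integral i)
    moreover have "((\<lambda>v. complex_of_real (exp (- v\<^sup>2))) has_integral (E (of_real R) - E (of_real (- R)))) {-R..R}"
      using ftc[OF that, of 1] by (simp add: exp_of_real[symmetric])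
    ultimately show ?thesis using has_integral_unique by blast
  qed
  have K_mono: "K 1 \<le> K R" if "R \<ge> 1" for R
    unfolding K_def using that
    by (intro integral_subset_le integrable_continuous_interval continuous_intros) auto
  have K1: "K 1 > 0"
  proof -
    have "integral {-1..1} (\<lambda>v::real. exp (-1)) \<le> K 1"
      unfolding K_def
      by (intro integral_le integrable_continuous_interval continuous_intros) (auto simp: abs_square_le_1 abs_le_iff)
    moreover have "integral {-1..1} (\<lambda>v::real. exp (-1)) = 2 * exp (-1::real)" by simp
    moreover have "2 * exp (-1::real) > 0" by simp
    ultimately show ?thesis by linarith
  qed
  have T: "((\<lambda>R. complex_of_real (K (B * R))) \<longlongrightarrow> b * complex_gauss) at_top"
  proof -
    have "((\<lambda>R. (E (b * of_real R) - E (b * of_real (- R))) - (E (of_real (B * R)) - E (of_real (B * (- R))))) \<longlongrightarrow> 0) at_top"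
    proof (rule Lim_null_comparison)
      show "((\<lambda>R. 2 * norm b * (R * exp (- R\<^sup>2))) \<longlongrightarrow> 0) at_top"
      proof -
        have "((\<lambda>R::real. R * exp (- R\<^sup>2)) \<longlongrightarrow> 0) at_top" by real_asymp
        then show ?thesis by (rule tendsto_mult_right_zero)
      qed
      show "\<forall>\<^sub>F R in at_top. norm ((E (b * of_real R) - E (b * of_real (- R))) - (E (of_real (B * R)) - E (of_real (B * (- R))))) \<le> 2 * norm b * (R * exp (- R\<^sup>2))"
        using eventually_ge_at_top[of 0]
      proof eventually_elim
        case (elim R)
        have c1: "norm (E (b * of_real R) - E (of_real (B * R))) \<le> norm b * R * exp (- R\<^sup>2)"
          using close[of R] elim by (simp only: abs_of_nonneg)
        have c2: "norm (E (b * of_real (- R)) - E (of_real (B * (- R)))) \<le> norm b * R * exp (- R\<^sup>2)"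
          using close[of "- R"] elim by (simp only: abs_minus_cancel power2_minus abs_of_nonneg)
        have eq: "(E (b * of_real R) - E (b * of_real (- R))) - (E (of_real (B * R)) - E (of_real (B * (- R)))) =
          (E (b * of_real R) - E (of_real (B * R))) - (E (b * of_real (- R)) - E (of_real (B * (- R))))" by simp
        have "2 * norm b * (R * exp (- R\<^sup>2)) = norm b * R * exp (- R\<^sup>2) + norm b * R * exp (- R\<^sup>2)" by simp
        then show ?case unfolding eq
          using norm_triangle_ineq4[of "E (b * of_real R) - E (of_real (B * R))" "E (b * of_real (- R)) - E (of_real (B * (- R)))"]
            c1 c2 by linarith
      qed
    qed
    moreover have "((\<lambda>R. b * (LINT v|lborel. indicator {-R..R} v *\<^sub>R f v)) \<longlongrightarrow> b * complex_gauss) at_top"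
      by (intro tendsto_mult_left lim)
    ultimately have "((\<lambda>R. b * (LINT v|lborel. indicator {-R..R} v *\<^sub>R f v) -
       ((E (b * of_real R) - E (b * of_real (- R))) - (E (of_real (B * R)) - E (of_real (B * (- R)))))) \<longlongrightarrow> b * complex_gauss - 0) at_top"
      by (intro tendsto_diff)
    moreover have "\<forall>\<^sub>F R in at_top. b * (LINT v|lborel. indicator {-R..R} v *\<^sub>R f v) -
       ((E (b * of_real R) - E (b * of_real (- R))) - (E (of_real (B * R)) - E (of_real (B * (- R))))) = of_real (K (B * R))"
      using eventually_ge_at_top[of 0]
    proof eventually_elim
      case (elim R)
      then have "B * R \<ge> 0" using Bpos by simp
      from real_int[OF this] int[OF elim] show ?case by simp
    qed
    ultimately show ?thesis by (simp add: tendsto_cong)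
  qed
  have TR: "((\<lambda>R. K (B * R)) \<longlongrightarrow> Re (b * complex_gauss)) at_top"
    using tendsto_Re[OF T] by simp
  have "Im (b * complex_gauss) = 0"
    using tendsto_unique[OF _ tendsto_const[of 0 at_top] tendsto_Im[OF T, unfolded Im_complex_of_real]] by simp
  then have real: "b * complex_gauss = of_real (Re (b * complex_gauss))" by (simp add: complex_eq_iff)
  have "\<forall>\<^sub>F R in at_top. K 1 \<le> K (B * R)"
    using eventually_ge_at_top[of "1 / B"]
    by eventually_elim (use Bpos in \<open>auto intro!: K_mono simp: field_simps\<close>)
  then have "K 1 \<le> Re (b * complex_gauss)"
    by (rule tendsto_lowerbound[OF TR]) simp
  with K1 have pos: "Re (b * complex_gauss) > 0" by simp
  have "complex_gauss = of_real (Re (b * complex_gauss)) / b" using real bn by (metis nonzero_mult_div_cancel_left)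
  also have "\<dots> = of_real (Re (b * complex_gauss) / sqrt (sqrt 2)) * cis (pi / 8)"
  proof -
    have "inverse (cis (- (pi / 8))) = cis (pi / 8)" by simp
    then show ?thesis unfolding b_def divide_inverse inverse_mult_distrib of_real_mult of_real_inverse
      by (simp only: mult.assoc)
  qed
  finally show ?thesis using pos by (intro exI[of _ "Re (b * complex_gauss) / sqrt (sqrt 2)"]) simp
qed

section \<open>Laplace asymptotics along the diagonal ray\<close>

text \<open>In the variables \<open>\<mu> = sqrt (A \<omega> / 2)\<close> and \<open>\<omega> = 2 \<pi> \<theta> / t\<close> this is the integrand
  \<open>G x e\<^sup>i\<^sup>\<omega>\<^sup>x / (1 - \<zeta> e\<^sup>2\<^sup>\<pi>\<^sup>i\<^sup>x\<^sup>/\<^sup>t)\<close> along the ray \<open>x = r (1 + \<i>)\<close>;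
  the saddle point sits at \<open>r = A / (2 \<mu>)\<close>.\<close>
definition ray_integrand :: "real \<Rightarrow> real \<Rightarrow> complex \<Rightarrow> (complex \<Rightarrow> complex) \<Rightarrow> real \<Rightarrow> real \<Rightarrow> complex" where
  "ray_integrand A \<theta> \<zeta> G \<mu> r = G (of_real r * (1 + \<i>)) * exp (- (of_real (2 * \<mu>\<^sup>2 / A * r) * (1 - \<i>))) /
     (1 - \<zeta> * exp (- (of_real (2 * \<mu>\<^sup>2 / (A * \<theta>) * r) * (1 - \<i>))))"

section \<open>Bounds for the integrand on the diagonal ray\<close>

lemma norm_exp_diag: "norm (exp (- (of_real y * (1 - \<i>)))) = exp (- y)"
  by (simp add: norm_exp_eq_Re)

lemma ray_denominator:
  assumes "norm \<zeta> = 1" "y > 0"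
  shows "norm (1 - \<zeta> * exp (- (of_real y * (1 - \<i>)))) \<ge> 1 - exp (- y)"
proof -
  have "norm (\<zeta> * exp (- (of_real y * (1 - \<i>)))) = exp (- y)"
    using assms by (simp add: norm_mult norm_exp_eq_Re)
  then show ?thesis using norm_triangle_ineq2[of 1 "\<zeta> * exp (- (of_real y * (1 - \<i>)))"] by simp
qed

lemma ray_denominator_nz:
  assumes "norm \<zeta> = 1" "y > 0"
  shows "1 - \<zeta> * exp (- (of_real y * (1 - \<i>))) \<noteq> 0"
proof -
  have "1 - exp (- y) > 0" using assms by simp
  then show ?thesis using ray_denominator[OF assms] by auto
qed

lemma inverse_one_minus_exp_le:
  fixes y :: real
  assumes "y > 0"
  shows "1 / (1 - exp (- y)) \<le> 1 + 1 / y"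
proof -
  have "exp (- y) = 1 / exp y" by (simp add: exp_minus divide_inverse)
  also have "\<dots> \<le> 1 / (1 + y)" using assms exp_ge_add_one_self[of y] by (intro divide_left_mono) auto
  finally have "1 - exp (- y) \<ge> 1 - 1 / (1 + y)" by simp
  also have "1 - 1 / (1 + y) = y / (1 + y)" using assms by (simp add: field_simps)
  finally have "1 / (1 - exp (- y)) \<le> 1 / (y / (1 + y))" using assms by (intro divide_left_mono) auto
  also have "\<dots> = 1 + 1 / y" using assms by (simp add: field_simps)
  finally show ?thesis .
qed

lemma powr_exp_bounded:
  fixes \<kappa> :: real
  assumes "\<kappa> > 0"
  shows "\<exists>M>0. \<forall>y\<ge>0. (1 + y powr \<kappa>) * (1 + y) * exp (- y / 8) \<le> M"
proof -
  have "((\<lambda>y. (1 + y powr \<kappa>) * (1 + y) * exp (- y / 8)) \<longlongrightarrow> 0) at_top"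
    using assms by real_asymp
  then have "\<forall>\<^sub>F y in at_top. (1 + y powr \<kappa>) * (1 + y) * exp (- y / 8) < 1"
    by (rule order_tendstoD) simp
  then obtain Y where Y: "\<And>y. y \<ge> Y \<Longrightarrow> (1 + y powr \<kappa>) * (1 + y) * exp (- y / 8) < 1"
    unfolding eventually_at_top_linorder by blast
  have "(1 + y powr \<kappa>) * (1 + y) * exp (- y / 8) \<le> 1 + (1 + \<bar>Y\<bar> powr \<kappa>) * (1 + \<bar>Y\<bar>)" if "y \<ge> 0" for y
  proof (cases "y \<ge> Y")
    case True
    have "0 \<le> (1 + \<bar>Y\<bar> powr \<kappa>) * (1 + \<bar>Y\<bar>)" by simp
    then show ?thesis using Y[OF True] by linarith
  next
    case False
    have "y powr \<kappa> \<le> \<bar>Y\<bar> powr \<kappa>" using False that assms by (intro powr_mono2) auto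
    then have "(1 + y powr \<kappa>) * (1 + y) * exp (- y / 8) \<le> (1 + \<bar>Y\<bar> powr \<kappa>) * (1 + \<bar>Y\<bar>) * 1"
      using False that by (intro mult_mono) auto
    then show ?thesis by simp
  qed
  moreover have "1 + (1 + \<bar>Y\<bar> powr \<kappa>) * (1 + \<bar>Y\<bar>) > 0" by (intro add_pos_nonneg mult_nonneg_nonneg) auto
  ultimately show ?thesis by blast
qed

text \<open>Here \<sigma> = 1 + v / sqrt \<mu> is the distance from the origin in units of the
  saddle. For \<sigma> \<ge> 1/2 the algebraic factors are bounded, and v^2 / \<sigma> still
  dominates |v| / 2 because \<sigma> grows at most linearly in v. For \<sigma> < 1/2 one has v^2
  \<ge> 1/4, and v^2 / \<sigma> is split in two: one half is at least 1 / (8 \<sigma>) and absorbs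
  the powers of 1 / \<sigma>, the other is at least |v| / 2. This is the origin of the rate 1/8 in
  \<open>powr_exp_bounded\<close>.\<close>

lemma laplace_bound:
  fixes \<kappa> :: real
  assumes "\<kappa> > 0"
  shows "\<exists>M>0. \<forall>\<mu>\<ge>1. \<forall>v. 1 + v / sqrt \<mu> > 0 \<longrightarrow>
     (1 + (1 + v / sqrt \<mu>) powr (- \<kappa>)) * (1 + 1 / (1 + v / sqrt \<mu>)) * exp (- (v\<^sup>2 / (1 + v / sqrt \<mu>))) \<le> M * exp (- \<bar>v\<bar> / 2)"
proof -
  obtain M0 where M0: "M0 > 0" "\<And>y. y \<ge> 0 \<Longrightarrow> (1 + y powr \<kappa>) * (1 + y) * exp (- y / 8) \<le> M0"
    using powr_exp_bounded[OF assms] by blast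
  define M1 where "M1 = (1 + 2 powr \<kappa>) * (1 + 2) * exp (1/2 :: real)"
  have M1: "M1 > 0" by (simp add: M1_def add_pos_nonneg)
  have "(1 + (1 + v / sqrt \<mu>) powr (- \<kappa>)) * (1 + 1 / (1 + v / sqrt \<mu>)) * exp (- (v\<^sup>2 / (1 + v / sqrt \<mu>))) \<le> (M0 + M1) * exp (- \<bar>v\<bar> / 2)"
    if \<mu>: "\<mu> \<ge> 1" and pos: "1 + v / sqrt \<mu> > 0" for \<mu> v
  proof -
    define \<sigma> where "\<sigma> = 1 + v / sqrt \<mu>"
    have s: "\<sigma> > 0" using pos by (simp add: \<sigma>_def)
    have v: "v = sqrt \<mu> * (\<sigma> - 1)" using \<mu> by (simp add: \<sigma>_def)
    have inv: "\<sigma> powr (- \<kappa>) = (1 / \<sigma>) powr \<kappa>" using s by (simp add: powr_minus_divide powr_divide)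
    have "(1 + \<sigma> powr (- \<kappa>)) * (1 + 1 / \<sigma>) * exp (- (v\<^sup>2 / \<sigma>)) \<le> (M0 + M1) * exp (- \<bar>v\<bar> / 2)"
    proof (cases "\<sigma> \<ge> 1 / 2")
      case True
      have "\<bar>v\<bar> / 2 \<le> 1 / 2 + v\<^sup>2 / \<sigma>"
      proof (cases "\<bar>v\<bar> \<le> 1")
        case True
        moreover have "v\<^sup>2 / \<sigma> \<ge> 0" using s by simp
        ultimately show ?thesis by linarith
      next
        case False
        have "v / sqrt \<mu> \<le> \<bar>v\<bar>"
        proof -
          have "\<bar>v\<bar> / sqrt \<mu> \<le> \<bar>v\<bar> / 1" using \<mu> by (intro divide_left_mono) auto
          moreover have "v / sqrt \<mu> \<le> \<bar>v\<bar> / sqrt \<mu>" using \<mu> by (intro divide_right_mono) auto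
          ultimately show ?thesis by simp
        qed
        then have "\<sigma> \<le> 2 * \<bar>v\<bar>" using False by (simp add: \<sigma>_def)
        then have "\<bar>v\<bar> * \<sigma> \<le> \<bar>v\<bar> * (2 * \<bar>v\<bar>)" by (intro mult_left_mono) auto
        also have "\<dots> = 2 * v\<^sup>2" by (simp add: power2_eq_square)
        finally have "\<bar>v\<bar> \<le> 2 * v\<^sup>2 / \<sigma>" using s by (simp add: pos_le_divide_eq)
        then have "\<bar>v\<bar> \<le> 2 * (v\<^sup>2 / \<sigma>)" by simp
        then show ?thesis by linarith
      qed
      then have "exp (- (v\<^sup>2 / \<sigma>)) \<le> exp (1/2 + - \<bar>v\<bar> / 2)" by simp
      then have e: "exp (- (v\<^sup>2 / \<sigma>)) \<le> exp (1/2) * exp (- \<bar>v\<bar> / 2)" by (simp only: exp_add)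
      have i: "1 / \<sigma> \<le> 2" using True s by (simp add: field_simps)
      then have "(1 / \<sigma>) powr \<kappa> \<le> 2 powr \<kappa>" using assms s by (intro powr_mono2) auto
      then have "(1 + \<sigma> powr (- \<kappa>)) * (1 + 1 / \<sigma>) * exp (- (v\<^sup>2 / \<sigma>)) \<le> (1 + 2 powr \<kappa>) * (1 + 2) * (exp (1/2) * exp (- \<bar>v\<bar> / 2))"
        using i s e unfolding inv by (intro mult_mono) auto
      also have "\<dots> = M1 * exp (- \<bar>v\<bar> / 2)" by (simp add: M1_def)
      also have "\<dots> \<le> (M0 + M1) * exp (- \<bar>v\<bar> / 2)" using M0(1) by (intro mult_right_mono) auto
      finally show ?thesis .
    next
      case False
      have v2: "v\<^sup>2 = \<mu> * (1 - \<sigma>)\<^sup>2" using \<mu> by (simp add: v power_mult_distrib power2_commute)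
      have "1 * (1/2)\<^sup>2 \<le> \<mu> * (1 - \<sigma>)\<^sup>2" using \<mu> False s by (intro mult_mono power_mono) auto
      then have v4: "1 / 4 \<le> v\<^sup>2" unfolding v2 by (simp add: power_divide)
      then have av: "1 / 2 \<le> \<bar>v\<bar>" using abs_le_square_iff[of "1/2" v] by (simp add: power2_eq_square)
      have v5: "\<bar>v\<bar> / 2 \<le> v\<^sup>2"
      proof -
        have "\<bar>v\<bar> * (1/2) \<le> \<bar>v\<bar> * \<bar>v\<bar>" using av by (intro mult_left_mono) auto
        then show ?thesis by (simp add: power2_eq_square)
      qed
      have "v\<^sup>2 / \<sigma> = v\<^sup>2 / (2 * \<sigma>) + v\<^sup>2 / (2 * \<sigma>)" using s by (simp add: field_simps)
      moreover have "v\<^sup>2 / (2 * \<sigma>) \<ge> (1/4) / (2 * \<sigma>)" using v4 s by (intro divide_right_mono) auto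
      moreover have "v\<^sup>2 / (2 * \<sigma>) \<ge> v\<^sup>2 / 1" using s False by (intro divide_left_mono) auto
      ultimately have "v\<^sup>2 / \<sigma> \<ge> (1 / \<sigma>) / 8 + \<bar>v\<bar> / 2" using v5 by (simp add: field_simps)
      then have "exp (- (v\<^sup>2 / \<sigma>)) \<le> exp (- (1 / \<sigma>) / 8 + - \<bar>v\<bar> / 2)" by simp
      then have e: "exp (- (v\<^sup>2 / \<sigma>)) \<le> exp (- (1 / \<sigma>) / 8) * exp (- \<bar>v\<bar> / 2)" by (simp only: exp_add)
      have "(1 + \<sigma> powr (- \<kappa>)) * (1 + 1 / \<sigma>) * exp (- (v\<^sup>2 / \<sigma>)) \<le> (1 + \<sigma> powr (- \<kappa>)) * (1 + 1 / \<sigma>) * (exp (- (1 / \<sigma>) / 8) * exp (- \<bar>v\<bar> / 2))"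
        using s by (intro mult_left_mono e) auto
      also have "\<dots> = (1 + (1 / \<sigma>) powr \<kappa>) * (1 + 1 / \<sigma>) * exp (- (1 / \<sigma>) / 8) * exp (- \<bar>v\<bar> / 2)"
        by (simp add: inv)
      also have "\<dots> \<le> M0 * exp (- \<bar>v\<bar> / 2)" using s by (intro mult_right_mono M0(2)) auto
      also have "\<dots> \<le> (M0 + M1) * exp (- \<bar>v\<bar> / 2)" using M1 by (intro mult_right_mono) auto
      finally show ?thesis .
    qed
    then show ?thesis by (simp only: \<sigma>_def)
  qed
  moreover have "M0 + M1 > 0" using M0(1) M1 by simp
  ultimately show ?thesis by blast
qed

text \<open>G on the ray divided by its predicted behaviour, written with 1 / x = (1 - \<i>) / (2
  r).\<close>

definition ray_quotient :: "real \<Rightarrow> real \<Rightarrow> (complex \<Rightarrow> complex) \<Rightarrow> real \<Rightarrow> complex" where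
  "ray_quotient A \<kappa> G r = G (of_real r * (1 + \<i>)) * of_real (r powr \<kappa>) * exp (of_real A * (1 - \<i>) / of_real (2 * r))"

text \<open>With r equal to \<sigma> times the saddle radius, the exponents combine exactly: \<mu>
  \<sigma> + \<mu> / \<sigma> - 2 \<mu> = \<mu> (\<sigma> - 1)^2 / \<sigma> = v^2 / \<sigma>. The
  Gaussian therefore appears through \<sigma> tending to 1, with no Taylor remainder in the
  exponent.\<close>

lemma ray_integrand_rescaled:
  assumes A: "A > 0" and \<theta>: "\<theta> > 0" and \<mu>: "\<mu> > 0" and s: "\<sigma> > 0" and \<sigma>: "\<sigma> = 1 + v / sqrt \<mu>"
  shows "of_real ((A / (2 * \<mu>)) powr \<kappa>) * exp (2 * of_real \<mu> * (1 - \<i>)) * ray_integrand A \<theta> \<zeta> G \<mu> (A / (2 * \<mu>) * \<sigma>) =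
     ray_quotient A \<kappa> G (A / (2 * \<mu>) * \<sigma>) * of_real (\<sigma> powr (- \<kappa>)) * exp (- ((1 - \<i>) * of_real (v\<^sup>2 / \<sigma>))) /
       (1 - \<zeta> * exp (- (of_real (\<mu> * \<sigma> / \<theta>) * (1 - \<i>))))"
proof -
  define r where "r = A / (2 * \<mu>) * \<sigma>"
  have r: "r > 0" using A \<mu> s by (simp add: r_def)
  have p: "(A / (2 * \<mu>)) powr \<kappa> = r powr \<kappa> * \<sigma> powr (- \<kappa>)"
  proof -
    have "r powr \<kappa> = (A / (2 * \<mu>)) powr \<kappa> * \<sigma> powr \<kappa>"
      unfolding r_def by (rule powr_mult)
    then show ?thesis using s by (simp add: powr_minus)
  qed
  have e1: "2 * \<mu>\<^sup>2 / A * r = \<mu> * \<sigma>" using A \<mu> by (simp add: r_def power2_eq_square)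
  have e2: "2 * \<mu>\<^sup>2 / (A * \<theta>) * r = \<mu> * \<sigma> / \<theta>" using A \<mu> by (simp add: r_def power2_eq_square)
  have e3: "A / (2 * r) = \<mu> / \<sigma>" using A \<mu> s by (simp add: r_def)
  have v: "v\<^sup>2 / \<sigma> = \<mu> * \<sigma> + \<mu> / \<sigma> - 2 * \<mu>"
  proof -
    have "v = sqrt \<mu> * (\<sigma> - 1)" using \<mu> by (simp add: \<sigma>)
    then have "v\<^sup>2 = \<mu> * (\<sigma> - 1)\<^sup>2" using \<mu> by (simp add: power_mult_distrib)
    then show ?thesis using s by (simp add: field_simps power2_eq_square)
  qed
  have "of_real A * (1 - \<i>) / of_real (2 * r) = of_real (A / (2 * r)) * (1 - \<i>)" by simp
  then have q: "ray_quotient A \<kappa> G r = G (of_real r * (1 + \<i>)) * of_real (r powr \<kappa>) * exp (of_real (\<mu> / \<sigma>) * (1 - \<i>))"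
    unfolding ray_quotient_def e3 by simp
  have x: "exp (2 * of_real \<mu> * (1 - \<i>)) * exp (- (of_real (\<mu> * \<sigma>) * (1 - \<i>))) =
      exp (of_real (\<mu> / \<sigma>) * (1 - \<i>)) * exp (- ((1 - \<i>) * of_real (v\<^sup>2 / \<sigma>)))"
    unfolding exp_add[symmetric] v by (simp add: algebra_simps)
  have "of_real ((A / (2 * \<mu>)) powr \<kappa>) * exp (2 * of_real \<mu> * (1 - \<i>)) * ray_integrand A \<theta> \<zeta> G \<mu> r =
     of_real (r powr \<kappa>) * of_real (\<sigma> powr (- \<kappa>)) * G (of_real r * (1 + \<i>)) *
      (exp (2 * of_real \<mu> * (1 - \<i>)) * exp (- (of_real (\<mu> * \<sigma>) * (1 - \<i>)))) /
       (1 - \<zeta> * exp (- (of_real (\<mu> * \<sigma> / \<theta>) * (1 - \<i>))))"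
    unfolding ray_integrand_def e1 e2 p by simp
  also have "\<dots> = ray_quotient A \<kappa> G r * of_real (\<sigma> powr (- \<kappa>)) * exp (- ((1 - \<i>) * of_real (v\<^sup>2 / \<sigma>))) /
       (1 - \<zeta> * exp (- (of_real (\<mu> * \<sigma> / \<theta>) * (1 - \<i>))))"
    unfolding x q by simp
  finally show ?thesis unfolding r_def .
qed

text \<open>The limit c bounds the quotient near 0. Elsewhere G and the exponential are bounded and
  only \<open>r powr \<kappa>\<close> can grow.\<close>

lemma ray_quotient_bound:
  assumes A: "A > 0" and \<kappa>: "\<kappa> > 0" and G: "admissible A \<kappa> c G"
  shows "\<exists>M>0. \<forall>r>0. norm (ray_quotient A \<kappa> G r) \<le> M * (1 + r powr \<kappa>)"
proof -
  have lim: "(ray_quotient A \<kappa> G \<longlongrightarrow> c) (at_right 0)"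
    using G unfolding admissible_def ray_quotient_def[abs_def] by blast
  obtain C where C: "C > 0" "\<And>x. x \<in> sector \<Longrightarrow> norm (G x) \<le> C * exp (- Re x / 2)"
    using G unfolding admissible_def by blast
  have "\<forall>\<^sub>F r in at_right 0. norm (ray_quotient A \<kappa> G r) < norm c + 1"
    using tendsto_norm[OF lim] by (rule order_tendstoD) simp
  then obtain b where b: "b > 0" "\<And>r. 0 < r \<Longrightarrow> r < b \<Longrightarrow> norm (ray_quotient A \<kappa> G r) < norm c + 1"
    unfolding eventually_at_right_field by auto
  define M where "M = norm c + 1 + C * exp (A / (2 * b))"
  have "norm (ray_quotient A \<kappa> G r) \<le> M * (1 + r powr \<kappa>)" if r: "r > 0" for r
  proof (cases "r < b")
    case True
    have "norm (ray_quotient A \<kappa> G r) \<le> (norm c + 1) * 1" using b(2)[OF r True] by simp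
    also have "\<dots> \<le> M * (1 + r powr \<kappa>)" using C(1) by (intro mult_mono) (auto simp: M_def)
    finally show ?thesis .
  next
    case False
    have "norm (G (of_real r * (1 + \<i>))) \<le> C * exp (- Re (of_real r * (1 + \<i>)) / 2)"
      by (rule C(2)[OF ray_in_sector[OF r]])
    also have "\<dots> \<le> C * 1" using C(1) r by (intro mult_left_mono) auto
    finally have g: "norm (G (of_real r * (1 + \<i>))) \<le> C" by simp
    have "of_real A * (1 - \<i>) / of_real (2 * r) = of_real (A / (2 * r)) * (1 - \<i>)" by simp
    then have "norm (exp (of_real A * (1 - \<i>) / of_real (2 * r))) = exp (A / (2 * r))"
      by (simp only: norm_exp_eq_Re) simp
    also have "\<dots> \<le> exp (A / (2 * b))"
      using False b(1) A r by (simp add: frac_le)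
    finally have "norm (ray_quotient A \<kappa> G r) \<le> C * r powr \<kappa> * exp (A / (2 * b))"
      unfolding ray_quotient_def norm_mult using C(1) g by (intro mult_mono) auto
    also have "\<dots> = (C * exp (A / (2 * b))) * r powr \<kappa>" by simp
    also have "\<dots> \<le> M * (1 + r powr \<kappa>)" using C(1) by (intro mult_mono) (auto simp: M_def)
    finally show ?thesis .
  qed
  moreover have "M > 0" unfolding M_def using C(1) by (intro add_pos_pos add_nonneg_pos) auto
  ultimately show ?thesis by blast
qed

text \<open>After rescaling, the integrand converges pointwise to c times the complex Gaussian:
  \<sigma> tends to 1, the argument of the quotient to 0, and the denominator to 1. Dominated
  convergence applies by \<open>laplace_bound\<close>, and the same bound gives integrability. The
  Jacobian A / (2 \<mu>) / sqrt \<mu> turns the exponent \<kappa> into \<kappa> - 1 and produces the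
  factor sqrt \<mu>.\<close>

lemma ray_laplace:
  assumes A: "A > 0" and \<kappa>: "\<kappa> > 0" and \<theta>: "\<theta> > 0" and \<zeta>: "norm \<zeta> = 1" and G: "admissible A \<kappa> c G"
  shows "\<And>\<mu>. \<mu> \<ge> 1 \<Longrightarrow> set_integrable lborel {0<..} (ray_integrand A \<theta> \<zeta> G \<mu>)"
    and "((\<lambda>\<mu>. of_real ((A / (2 * \<mu>)) powr (\<kappa> - 1) * sqrt \<mu>) * exp (2 * of_real \<mu> * (1 - \<i>)) *
            (LINT r:{0<..}|lborel. ray_integrand A \<theta> \<zeta> G \<mu> r)) \<longlongrightarrow> c * complex_gauss) at_top"
proof -
  have hol: "G holomorphic_on {x. Re x > 0}" and lim: "(ray_quotient A \<kappa> G \<longlongrightarrow> c) (at_right 0)"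
    using G unfolding admissible_def ray_quotient_def[abs_def] by blast+
  obtain M where M: "M > 0" "\<And>r. r > 0 \<Longrightarrow> norm (ray_quotient A \<kappa> G r) \<le> M * (1 + r powr \<kappa>)"
    using ray_quotient_bound[OF A \<kappa> G] by blast
  obtain L where L: "L > 0" "\<And>\<mu> v. \<mu> \<ge> 1 \<Longrightarrow> 1 + v / sqrt \<mu> > 0 \<Longrightarrow>
     (1 + (1 + v / sqrt \<mu>) powr (- \<kappa>)) * (1 + 1 / (1 + v / sqrt \<mu>)) * exp (- (v\<^sup>2 / (1 + v / sqrt \<mu>))) \<le> L * exp (- \<bar>v\<bar> / 2)"
    using laplace_bound[OF \<kappa>] by blast
  \<comment> \<open>Extension by zero lets the affine substitution run over the whole line, so the
    domain of v does not depend on \<mu>.\<close>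
  define F where "F \<mu> r = indicator {0<..} r *\<^sub>R ray_integrand A \<theta> \<zeta> G \<mu> r" for \<mu> r :: real
  define h where "h \<mu> v = of_real ((A / (2 * \<mu>)) powr \<kappa>) * exp (2 * of_real \<mu> * (1 - \<i>)) *
      F \<mu> (A / (2 * \<mu>) + A / (2 * \<mu>) / sqrt \<mu> * v)" for \<mu> v :: real
  have F_meas: "F \<mu> \<in> borel_measurable borel" if "\<mu> > 0" for \<mu>
  proof -
    have "continuous_on {0<..} (\<lambda>r. G (of_real r * (1 + \<i>)))"
      by (rule continuous_on_compose2[OF holomorphic_on_imp_continuous_on[OF hol]]) (auto intro!: continuous_intros)
    moreover have "1 - \<zeta> * exp (- (of_real (2 * \<mu>\<^sup>2 / (A * \<theta>) * r) * (1 - \<i>))) \<noteq> 0" if "r \<in> {0<..}" for r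
      using that \<open>\<mu> > 0\<close> A \<theta> by (intro ray_denominator_nz[OF \<zeta>]) auto
    ultimately have "continuous_on {0<..} (ray_integrand A \<theta> \<zeta> G \<mu>)"
      unfolding ray_integrand_def by (intro continuous_intros) auto
    then show ?thesis unfolding F_def by (intro borel_measurable_continuous_on_indicator) auto
  qed
  have h_meas: "h \<mu> \<in> borel_measurable borel" if "\<mu> > 0" for \<mu>
    unfolding h_def using F_meas[OF that] by measurable
  have h_eq: "h \<mu> v = (if 1 + v / sqrt \<mu> > 0 then
       ray_quotient A \<kappa> G (A / (2 * \<mu>) * (1 + v / sqrt \<mu>)) * of_real ((1 + v / sqrt \<mu>) powr (- \<kappa>)) *
         exp (- ((1 - \<i>) * of_real (v\<^sup>2 / (1 + v / sqrt \<mu>)))) /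
       (1 - \<zeta> * exp (- (of_real (\<mu> * (1 + v / sqrt \<mu>) / \<theta>) * (1 - \<i>)))) else 0)" if \<mu>: "\<mu> > 0" for \<mu> v
  proof -
    have e: "A / (2 * \<mu>) + A / (2 * \<mu>) / sqrt \<mu> * v = A / (2 * \<mu>) * (1 + v / sqrt \<mu>)"
      by (simp add: distrib_left)
    have s: "A / (2 * \<mu>) * (1 + v / sqrt \<mu>) > 0 \<longleftrightarrow> 1 + v / sqrt \<mu> > 0"
    proof -
      have "A / (2 * \<mu>) > 0" using A \<mu> by simp
      then show ?thesis by (metis mult_pos_pos zero_less_mult_pos)
    qed
    show ?thesis
    proof (cases "1 + v / sqrt \<mu> > 0")
      case True
      then have "F \<mu> (A / (2 * \<mu>) * (1 + v / sqrt \<mu>)) = ray_integrand A \<theta> \<zeta> G \<mu> (A / (2 * \<mu>) * (1 + v / sqrt \<mu>))"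
        unfolding F_def using s by simp
      then show ?thesis unfolding h_def e using True ray_integrand_rescaled[OF A \<theta> \<mu> True refl] by simp
    next
      case False
      then have "F \<mu> (A / (2 * \<mu>) * (1 + v / sqrt \<mu>)) = 0"
        unfolding F_def using s by simp
      then show ?thesis unfolding h_def e using False by simp
    qed
  qed
  define W where "W = M * (1 + (A / 2) powr \<kappa>) * (1 + \<theta>) * L"
  have h_bound: "norm (h \<mu> v) \<le> W * exp (- \<bar>v\<bar> / 2)" if \<mu>: "\<mu> \<ge> 1" for \<mu> v
  proof (cases "1 + v / sqrt \<mu> > 0")
    case False
    then show ?thesis using M(1) L(1) \<theta> \<mu> by (simp add: h_eq W_def)
  next
    case True
    define \<sigma> where "\<sigma> = 1 + v / sqrt \<mu>"
    have s: "\<sigma> > 0" using True by (simp add: \<sigma>_def)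
    have r: "A / (2 * \<mu>) * \<sigma> > 0" using A \<mu> s by simp
    have sk: "\<sigma> powr \<kappa> * \<sigma> powr (- \<kappa>) = 1" using s by (simp add: powr_minus)
    have "norm (ray_quotient A \<kappa> G (A / (2 * \<mu>) * \<sigma>)) * \<sigma> powr (- \<kappa>) \<le> M * (1 + (A / (2 * \<mu>) * \<sigma>) powr \<kappa>) * \<sigma> powr (- \<kappa>)"
      by (intro mult_right_mono M(2)[OF r]) auto
    also have "(A / (2 * \<mu>) * \<sigma>) powr \<kappa> = (A / (2 * \<mu>)) powr \<kappa> * \<sigma> powr \<kappa>"
      by (rule powr_mult)
    also have "M * (1 + (A / (2 * \<mu>)) powr \<kappa> * \<sigma> powr \<kappa>) * \<sigma> powr (- \<kappa>) = M * (\<sigma> powr (- \<kappa>) + (A / (2 * \<mu>)) powr \<kappa> * (\<sigma> powr \<kappa> * \<sigma> powr (- \<kappa>)))"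
      by (simp add: algebra_simps)
    also have "\<dots> = M * (\<sigma> powr (- \<kappa>) + (A / (2 * \<mu>)) powr \<kappa>)" by (simp only: sk mult_1_right)
    also have "\<dots> \<le> M * (\<sigma> powr (- \<kappa>) + (A / 2) powr \<kappa>)"
    proof -
      have "A / (2 * \<mu>) \<le> A / (2 * 1)" using A \<mu> by (intro divide_left_mono mult_left_mono) auto
      then show ?thesis
        using M(1) A \<mu> \<kappa> by (intro mult_left_mono add_left_mono powr_mono2) auto
    qed
    also have "\<dots> \<le> M * ((1 + (A / 2) powr \<kappa>) * (1 + \<sigma> powr (- \<kappa>)))"
      using M(1) by (intro mult_left_mono) (auto simp: algebra_simps)
    finally have b1: "norm (ray_quotient A \<kappa> G (A / (2 * \<mu>) * \<sigma>)) * \<sigma> powr (- \<kappa>) \<le> M * ((1 + (A / 2) powr \<kappa>) * (1 + \<sigma> powr (- \<kappa>)))" .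
    have y: "\<mu> * \<sigma> / \<theta> > 0" using \<mu> s \<theta> by simp
    have b2: "1 / norm (1 - \<zeta> * exp (- (of_real (\<mu> * \<sigma> / \<theta>) * (1 - \<i>)))) \<le> (1 + \<theta>) * (1 + 1 / \<sigma>)"
    proof -
      have "1 / norm (1 - \<zeta> * exp (- (of_real (\<mu> * \<sigma> / \<theta>) * (1 - \<i>)))) \<le> 1 / (1 - exp (- (\<mu> * \<sigma> / \<theta>)))"
        by (intro frac_le ray_denominator[OF \<zeta> y]) (use y in auto)
      also have "\<dots> \<le> 1 + 1 / (\<mu> * \<sigma> / \<theta>)" by (rule inverse_one_minus_exp_le[OF y])
      also have "1 / (\<mu> * \<sigma> / \<theta>) = \<theta> / (\<mu> * \<sigma>)" by simp
      also have "\<theta> / (\<mu> * \<sigma>) \<le> \<theta> / \<sigma>" using \<mu> s \<theta> by (intro divide_left_mono) auto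
      also have "1 + \<theta> / \<sigma> \<le> (1 + \<theta> / \<sigma>) + (\<theta> + 1 / \<sigma>)" using s \<theta> by simp
      also have "\<dots> = (1 + \<theta>) * (1 + 1 / \<sigma>)" by (simp add: algebra_simps add_divide_distrib)
      finally show ?thesis by simp
    qed
    have b3: "norm (exp (- ((1 - \<i>) * of_real (v\<^sup>2 / \<sigma>)))) = exp (- (v\<^sup>2 / \<sigma>))"
      by (simp only: norm_exp_eq_Re) simp
    have "norm (h \<mu> v) = (norm (ray_quotient A \<kappa> G (A / (2 * \<mu>) * \<sigma>)) * \<sigma> powr (- \<kappa>)) * exp (- (v\<^sup>2 / \<sigma>)) *
        (1 / norm (1 - \<zeta> * exp (- (of_real (\<mu> * \<sigma> / \<theta>) * (1 - \<i>)))))"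
      using h_eq[of \<mu> v] True \<mu> unfolding \<sigma>_def[symmetric] b3[symmetric] by (simp add: norm_mult norm_divide)
    also have "\<dots> \<le> (M * ((1 + (A / 2) powr \<kappa>) * (1 + \<sigma> powr (- \<kappa>)))) * exp (- (v\<^sup>2 / \<sigma>)) * ((1 + \<theta>) * (1 + 1 / \<sigma>))"
      using M(1) \<theta> s by (intro mult_mono b1 b2 order_refl) auto
    also have "\<dots> = M * (1 + (A / 2) powr \<kappa>) * (1 + \<theta>) * ((1 + \<sigma> powr (- \<kappa>)) * (1 + 1 / \<sigma>) * exp (- (v\<^sup>2 / \<sigma>)))"
      by (simp only: mult_ac)
    also have "\<dots> \<le> M * (1 + (A / 2) powr \<kappa>) * (1 + \<theta>) * (L * exp (- \<bar>v\<bar> / 2))"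
      using M(1) \<theta> L(2)[OF \<mu> True] unfolding \<sigma>_def[symmetric] by (intro mult_left_mono) auto
    also have "\<dots> = W * exp (- \<bar>v\<bar> / 2)" by (simp add: W_def)
    finally show ?thesis .
  qed
  have dom: "integrable lborel (\<lambda>v::real. W * exp (- \<bar>v\<bar> / 2))"
    by (intro integrable_mult_right integrable_exp_abs)
  have h_int: "integrable lborel (h \<mu>)" if "\<mu> \<ge> 1" for \<mu>
  proof (rule Bochner_Integration.integrable_bound[OF dom])
    show "h \<mu> \<in> borel_measurable lborel" using h_meas[of \<mu>] that by simp
    show "AE v in lborel. norm (h \<mu> v) \<le> norm (W * exp (- \<bar>v\<bar> / 2))"
      using h_bound[OF that] by (intro AE_I2) (metis abs_ge_self order.trans real_norm_def)
  qed
  have cne: "A / (2 * \<mu>) / sqrt \<mu> \<noteq> 0" "of_real ((A / (2 * \<mu>)) powr \<kappa>) * exp (2 * of_real \<mu> * (1 - \<i>)) \<noteq> (0::complex)" if "\<mu> \<ge> 1" for \<mu>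
    using that A by auto
  show "set_integrable lborel {0<..} (ray_integrand A \<theta> \<zeta> G \<mu>)" if \<mu>: "\<mu> \<ge> 1" for \<mu>
  proof -
    have "integrable lborel (\<lambda>v. F \<mu> (A / (2 * \<mu>) + A / (2 * \<mu>) / sqrt \<mu> * v))"
    proof -
      define K where "K = of_real ((A / (2 * \<mu>)) powr \<kappa>) * exp (2 * of_real \<mu> * (1 - \<i>))"
      have "integrable lborel (\<lambda>v. inverse K * h \<mu> v)"
        by (intro integrable_mult_right h_int[OF \<mu>])
      moreover have "inverse K * h \<mu> v = F \<mu> (A / (2 * \<mu>) + A / (2 * \<mu>) / sqrt \<mu> * v)" for v
        unfolding h_def K_def[symmetric] mult.assoc[symmetric]
        by (simp only: left_inverse[OF cne(2)[OF \<mu>, folded K_def]] mult_1_left)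
      ultimately show ?thesis by (simp only:)
    qed
    then have "integrable lborel (F \<mu>)"
      using lborel_integrable_real_affine_iff[OF cne(1)[OF \<mu>]] by blast
    then show ?thesis by (simp add: set_integrable_def F_def[abs_def])
  qed
  have eq: "of_real ((A / (2 * \<mu>)) powr (\<kappa> - 1) * sqrt \<mu>) * exp (2 * of_real \<mu> * (1 - \<i>)) *
            (LINT r:{0<..}|lborel. ray_integrand A \<theta> \<zeta> G \<mu> r) = (LINT v|lborel. h \<mu> v)" if \<mu>: "\<mu> \<ge> 1" for \<mu>
  proof -
    have p: "(A / (2 * \<mu>)) powr \<kappa> = (A / (2 * \<mu>)) powr (\<kappa> - 1) * (A / (2 * \<mu>))"
      using A \<mu> by (simp add: powr_diff)
    have a: "\<bar>A / (2 * \<mu>) / sqrt \<mu>\<bar> = A / (2 * \<mu>) / sqrt \<mu>" using A \<mu> by simp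
    have sq: "sqrt \<mu> * (A / (2 * \<mu>) / sqrt \<mu>) = A / (2 * \<mu>)" using \<mu> by simp
    have "(LINT r:{0<..}|lborel. ray_integrand A \<theta> \<zeta> G \<mu> r) =
       of_real (A / (2 * \<mu>) / sqrt \<mu>) * (LINT v|lborel. F \<mu> (A / (2 * \<mu>) + A / (2 * \<mu>) / sqrt \<mu> * v))"
      unfolding set_lebesgue_integral_def F_def[symmetric]
      by (subst lborel_integral_real_affine[OF cne(1)[OF \<mu>], of "F \<mu>" "A / (2 * \<mu>)"]) (simp only: a scaleR_conv_of_real)
    moreover have "(LINT v|lborel. h \<mu> v) = of_real ((A / (2 * \<mu>)) powr \<kappa>) * exp (2 * of_real \<mu> * (1 - \<i>)) *
        (LINT v|lborel. F \<mu> (A / (2 * \<mu>) + A / (2 * \<mu>) / sqrt \<mu> * v))"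
      unfolding h_def by simp
    moreover have "of_real ((A / (2 * \<mu>)) powr (\<kappa> - 1) * sqrt \<mu>) * of_real (A / (2 * \<mu>) / sqrt \<mu>) =
        (of_real ((A / (2 * \<mu>)) powr \<kappa>) :: complex)"
      unfolding of_real_mult[symmetric] mult.assoc sq p[symmetric] ..
    moreover have "p' * E * (q * I) = (p' * q) * E * I" for p' E q I :: complex by (simp only: mult_ac)
    ultimately show ?thesis by (simp only:)
  qed
  \<comment> \<open>Dominated convergence asks for measurability at every parameter, which
    \<open>max 1 \<mu>\<close> secures; for \<mu> \<ge> 1 nothing changes.\<close>
  have "((\<lambda>\<mu>. LINT v|lborel. h (max 1 \<mu>) v) \<longlongrightarrow> (LINT v|lborel. c * exp (- ((1 - \<i>) * of_real (v\<^sup>2))))) at_top"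
  proof (rule integral_dominated_convergence_at_top[OF _ _ dom])
    show "(\<lambda>v. c * exp (- ((1 - \<i>) * of_real (v\<^sup>2)))) \<in> borel_measurable lborel"
      unfolding measurable_lborel2 by (intro borel_measurable_continuous_onI continuous_intros)
    show "h (max 1 \<mu>) \<in> borel_measurable lborel" for \<mu>
      using h_meas[of "max 1 \<mu>"] by simp
    show "\<forall>\<^sub>F \<mu> in at_top. AE v in lborel. norm (h (max 1 \<mu>) v) \<le> W * exp (- \<bar>v\<bar> / 2)"
      by (intro always_eventually allI AE_I2 h_bound) simp
    show "AE v in lborel. ((\<lambda>\<mu>. h (max 1 \<mu>) v) \<longlongrightarrow> c * exp (- ((1 - \<i>) * of_real (v\<^sup>2)))) at_top"
    proof (intro AE_I2)
      fix v :: real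
      have s1: "((\<lambda>\<mu>. 1 + v / sqrt \<mu>) \<longlongrightarrow> 1) at_top" by real_asymp
      have spos: "\<forall>\<^sub>F \<mu> in at_top. 1 + v / sqrt \<mu> > 0" using s1 by (rule order_tendstoD) simp
      have r0: "((\<lambda>\<mu>. A / (2 * \<mu>) * (1 + v / sqrt \<mu>)) \<longlongrightarrow> 0) at_top"
      proof -
        have "((\<lambda>\<mu>. A / (2 * \<mu>)) \<longlongrightarrow> 0) at_top" by real_asymp
        from tendsto_mult[OF this s1] show ?thesis by simp
      qed
      have "filterlim (\<lambda>\<mu>. A / (2 * \<mu>) * (1 + v / sqrt \<mu>)) (at_right 0) at_top"
        unfolding filterlim_at
      proof (intro conjI r0)
        show "\<forall>\<^sub>F \<mu> in at_top. A / (2 * \<mu>) * (1 + v / sqrt \<mu>) \<in> {0<..} \<and> A / (2 * \<mu>) * (1 + v / sqrt \<mu>) \<noteq> 0"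
          using spos eventually_gt_at_top[of 0]
        proof eventually_elim
          case (elim \<mu>)
          then have "A / (2 * \<mu>) * (1 + v / sqrt \<mu>) > 0" using A by (intro mult_pos_pos) auto
          then show ?case by (metis greaterThan_iff less_irrefl)
        qed
      qed
      from filterlim_compose[OF lim this]
      have q: "((\<lambda>\<mu>. ray_quotient A \<kappa> G (A / (2 * \<mu>) * (1 + v / sqrt \<mu>))) \<longlongrightarrow> c) at_top" .
      have pw: "((\<lambda>\<mu>. complex_of_real ((1 + v / sqrt \<mu>) powr (- \<kappa>))) \<longlongrightarrow> of_real (1 powr (- \<kappa>))) at_top"
        by (intro tendsto_of_real tendsto_powr s1 tendsto_const) auto
      have ex: "((\<lambda>\<mu>. exp (- ((1 - \<i>) * of_real (v\<^sup>2 / (1 + v / sqrt \<mu>))))) \<longlongrightarrow> exp (- ((1 - \<i>) * of_real (v\<^sup>2 / 1)))) at_top"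
        by (intro tendsto_intros s1) auto
      have de: "((\<lambda>\<mu>. 1 - \<zeta> * exp (- (of_real (\<mu> * (1 + v / sqrt \<mu>) / \<theta>) * (1 - \<i>)))) \<longlongrightarrow> 1 - \<zeta> * 0) at_top"
      proof (intro tendsto_diff tendsto_const tendsto_mult)
        have "filterlim (\<lambda>\<mu>. (1 + v / sqrt \<mu>) / \<theta> * \<mu>) at_top at_top"
        proof (rule filterlim_tendsto_pos_mult_at_top)
          show "((\<lambda>\<mu>. (1 + v / sqrt \<mu>) / \<theta>) \<longlongrightarrow> 1 / \<theta>) at_top" by (intro tendsto_intros s1) (use \<theta> in auto)
        qed (use \<theta> filterlim_ident in auto)
        then have "filterlim (\<lambda>\<mu>. - ((1 + v / sqrt \<mu>) / \<theta> * \<mu>)) at_bot at_top"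
          by (simp only: filterlim_uminus_at_bot minus_minus)
        then have "((\<lambda>\<mu>. exp (- ((1 + v / sqrt \<mu>) / \<theta> * \<mu>))) \<longlongrightarrow> 0) at_top"
          by (rule filterlim_compose[OF exp_at_bot])
        moreover have "norm (exp (- (of_real (\<mu> * (1 + v / sqrt \<mu>) / \<theta>) * (1 - \<i>)))) = exp (- ((1 + v / sqrt \<mu>) / \<theta> * \<mu>))" for \<mu>
          unfolding norm_exp_diag times_divide_eq_left by (simp only: mult.commute)
        ultimately show "((\<lambda>\<mu>. exp (- (of_real (\<mu> * (1 + v / sqrt \<mu>) / \<theta>) * (1 - \<i>)))) \<longlongrightarrow> 0) at_top"
          by - (rule tendsto_norm_zero_cancel, simp only:)
      qed
      have "((\<lambda>\<mu>. ray_quotient A \<kappa> G (A / (2 * \<mu>) * (1 + v / sqrt \<mu>)) * of_real ((1 + v / sqrt \<mu>) powr (- \<kappa>)) *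
         exp (- ((1 - \<i>) * of_real (v\<^sup>2 / (1 + v / sqrt \<mu>)))) /
         (1 - \<zeta> * exp (- (of_real (\<mu> * (1 + v / sqrt \<mu>) / \<theta>) * (1 - \<i>))))) \<longlongrightarrow>
         c * of_real (1 powr (- \<kappa>)) * exp (- ((1 - \<i>) * of_real (v\<^sup>2 / 1))) / (1 - \<zeta> * 0)) at_top"
        by (intro tendsto_divide tendsto_mult q pw ex de) auto
      then have "((\<lambda>\<mu>. ray_quotient A \<kappa> G (A / (2 * \<mu>) * (1 + v / sqrt \<mu>)) * of_real ((1 + v / sqrt \<mu>) powr (- \<kappa>)) *
         exp (- ((1 - \<i>) * of_real (v\<^sup>2 / (1 + v / sqrt \<mu>)))) /
         (1 - \<zeta> * exp (- (of_real (\<mu> * (1 + v / sqrt \<mu>) / \<theta>) * (1 - \<i>))))) \<longlongrightarrow>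
         c * exp (- ((1 - \<i>) * of_real (v\<^sup>2)))) at_top" by simp
      moreover have "\<forall>\<^sub>F \<mu> in at_top. ray_quotient A \<kappa> G (A / (2 * \<mu>) * (1 + v / sqrt \<mu>)) * of_real ((1 + v / sqrt \<mu>) powr (- \<kappa>)) *
         exp (- ((1 - \<i>) * of_real (v\<^sup>2 / (1 + v / sqrt \<mu>)))) /
         (1 - \<zeta> * exp (- (of_real (\<mu> * (1 + v / sqrt \<mu>) / \<theta>) * (1 - \<i>)))) = h (max 1 \<mu>) v"
        using spos eventually_ge_at_top[of 1]
      proof eventually_elim
        case (elim \<mu>)
        then have "max 1 \<mu> = \<mu>" "\<mu> > 0" by auto
        then show ?case using h_eq[of \<mu> v] elim by simp
      qed
      ultimately show "((\<lambda>\<mu>. h (max 1 \<mu>) v) \<longlongrightarrow> c * exp (- ((1 - \<i>) * of_real (v\<^sup>2)))) at_top"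
        by (rule Lim_transform_eventually)
    qed
  qed
  moreover have "(LINT v|lborel. c * exp (- ((1 - \<i>) * of_real (v\<^sup>2)))) = c * complex_gauss"
    by (simp add: complex_gauss_def)
  moreover have "\<forall>\<^sub>F \<mu> in at_top. (LINT v|lborel. h (max 1 \<mu>) v) = of_real ((A / (2 * \<mu>)) powr (\<kappa> - 1) * sqrt \<mu>) * exp (2 * of_real \<mu> * (1 - \<i>)) *
            (LINT r:{0<..}|lborel. ray_integrand A \<theta> \<zeta> G \<mu> r)"
    using eventually_ge_at_top[of 1]
  proof eventually_elim
    case (elim \<mu>)
    then have "max 1 \<mu> = \<mu>" by auto
    then show ?case by (simp only: eq[OF elim])
  qed
  ultimately show "((\<lambda>\<mu>. of_real ((A / (2 * \<mu>)) powr (\<kappa> - 1) * sqrt \<mu>) * exp (2 * of_real \<mu> * (1 - \<i>)) *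
            (LINT r:{0<..}|lborel. ray_integrand A \<theta> \<zeta> G \<mu> r)) \<longlongrightarrow> c * complex_gauss) at_top"
    by (simp only: tendsto_cong)
qed

section \<open>Contour integration\<close>

text \<open>A summation kernel: its poles in the right half-plane are the sampling points t (m + s),
  with residues proportional to z^m G. For 0 < \<theta> < 1 the quotient of exponentials decays in
  both vertical directions, like frequency \<theta> above the real axis and 1 - \<theta> below
  it.\<close>

definition contour_kernel :: "real \<Rightarrow> real \<Rightarrow> real \<Rightarrow> (complex \<Rightarrow> complex) \<Rightarrow> complex \<Rightarrow> complex" where
  "contour_kernel \<theta> s t G x = G x * exp (2 * pi * \<i> * \<theta> * (x / t - s)) / (exp (2 * pi * \<i> * (x / t - s)) - 1)"

lemma exp_eq_1_lattice:
  assumes t: "t > 0"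
  shows "exp (2 * pi * \<i> * (x / complex_of_real t - complex_of_real s)) = 1 \<longleftrightarrow> (\<exists>n::int. x = of_real (t * (of_int n + s)))"
proof
  assume "exp (2 * pi * \<i> * (x / complex_of_real t - complex_of_real s)) = 1"
  then obtain n :: int where n: "Re (2 * pi * \<i> * (x / complex_of_real t - complex_of_real s)) = 0"
    "Im (2 * pi * \<i> * (x / complex_of_real t - complex_of_real s)) = of_int (2 * n) * pi"
    unfolding exp_eq_1 by auto
  then have 1: "Im x = 0" and 2: "(2 * pi) * (Re x / t - s) = (2 * pi) * of_int n"
    using t by simp_all
  from 2 have "Re x / t - s = of_int n" unfolding mult_cancel_left by simp
  then have "Im x = 0" "Re x = t * (of_int n + s)"
    using t 1 by (simp_all add: field_simps)
  then show "\<exists>n::int. x = of_real (t * (of_int n + s))" by (intro exI[of _ n]) (simp add: complex_eq_iff)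
next
  assume "\<exists>n::int. x = of_real (t * (of_int n + s))"
  then obtain n :: int where "x = of_real (t * (of_int n + s))" by blast
  then have "x / complex_of_real t - complex_of_real s = of_int n" using t by simp
  then show "exp (2 * pi * \<i> * (x / complex_of_real t - complex_of_real s)) = 1"
    using exp_integer_2pi[of "of_int n"] by (simp add: mult_ac)
qed

lemma contour_kernel_holomorphic:
  assumes hol: "G holomorphic_on {x. Re x > 0}" and t: "t > 0"
    and A: "\<And>x. x \<in> A \<Longrightarrow> Re x > 0 \<and> (\<forall>n::int. x \<noteq> of_real (t * (of_int n + s)))"
  shows "contour_kernel \<theta> s t G holomorphic_on A"
proof -
  have "G holomorphic_on A" by (rule holomorphic_on_subset[OF hol]) (use A in auto)
  moreover have "exp (2 * pi * \<i> * (x / complex_of_real t - complex_of_real s)) - 1 \<noteq> 0" if "x \<in> A" for x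
    using A[OF that] exp_eq_1_lattice[OF t, of x s] by auto
  ultimately show ?thesis
    unfolding contour_kernel_def by (intro holomorphic_intros) (use t in auto)
qed

lemma contour_kernel_residue:
  assumes hol: "G holomorphic_on {x. Re x > 0}" and t: "t > 0" and s: "s > 0"
  shows "residue (contour_kernel \<theta> s t G) (of_real (t * (real m + s))) =
     cis (2 * pi * \<theta>) ^ m * G (of_real (t * (real m + s))) * of_real t / (2 * pi * \<i>)"
proof -
  define p where "p = complex_of_real (t * (real m + s))"
  \<comment> \<open>The strip reaches to the two neighbouring lattice points but is cut at 0, where
    holomorphy of G ends. So p is the only pole in it.\<close>
  define S where "S = {x. Re x > max 0 (t * (real m + s - 1))} \<inter> {x. Re x < t * (real m + s + 1)}"
  have S: "open S" unfolding S_def by (intro open_Int open_halfspace_Re_gt open_halfspace_Re_lt)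
  have pp: "Re p > 0" using t s by (simp add: p_def add_nonneg_pos)
  have pS: "p \<in> S" using t pp by (simp add: S_def p_def)
  have holF: "contour_kernel \<theta> s t G holomorphic_on (S - {p})"
  proof (rule contour_kernel_holomorphic[OF hol t])
    fix x assume x: "x \<in> S - {p}"
    have "x \<noteq> of_real (t * (of_int n + s))" for n :: int
    proof
      assume xn: "x = of_real (t * (of_int n + s))"
      have "t * (real m + s - 1) < t * (of_int n + s)" "t * (of_int n + s) < t * (real m + s + 1)"
        using x xn by (auto simp: S_def)
      then have "real m + s - 1 < of_int n + s" "of_int n + s < real m + s + 1"
        using t by (simp_all only: mult_less_cancel_left_pos)
      then have "n = int m" by linarith
      then show False using x xn by (simp add: p_def)
    qed
    then show "Re x > 0 \<and> (\<forall>n::int. x \<noteq> of_real (t * (of_int n + s)))" using x by (auto simp: S_def)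
  qed
  have isG: "isCont G p"
    using holomorphic_on_imp_continuous_on[OF hol] pp open_halfspace_Re_gt[of 0]
    by (simp add: continuous_on_eq_continuous_at)
  define e where "e x = exp (2 * pi * \<i> * (x / complex_of_real t - complex_of_real s))" for x
  have ep: "e p = 1" using exp_eq_1_lattice[OF t, of p s] unfolding e_def p_def by (metis of_int_of_nat_eq)
  have "(e has_field_derivative 2 * pi * \<i> / t) (at p)"
    unfolding e_def[abs_def] using ep t by (auto intro!: derivative_eq_intros simp: e_def)
  then have L1: "((\<lambda>x. (e x - 1) / (x - p)) \<longlongrightarrow> 2 * pi * \<i> / t) (at p)"
    by (simp add: has_field_derivative_iff ep)
  have L2: "((\<lambda>x. G x * exp (2 * pi * \<i> * \<theta> * (x / t - s))) \<longlongrightarrow> G p * exp (2 * pi * \<i> * \<theta> * (p / t - s))) (at p)"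
    using isG t by (intro tendsto_intros) (auto simp: isCont_def)
  have "2 * pi * \<i> / complex_of_real t \<noteq> 0" using t by simp
  from tendsto_divide[OF L2 L1 this] have "((\<lambda>x. (G x * exp (2 * pi * \<i> * \<theta> * (x / t - s))) / ((e x - 1) / (x - p))) \<longlongrightarrow>
     G p * exp (2 * pi * \<i> * \<theta> * (p / t - s)) / (2 * pi * \<i> / t)) (at p)" .
  then have "((\<lambda>x. contour_kernel \<theta> s t G x * (x - p)) \<longlongrightarrow> G p * exp (2 * pi * \<i> * \<theta> * (p / t - s)) / (2 * pi * \<i> / t)) (at p)"
    unfolding contour_kernel_def e_def by simp
  from residue_simple'[OF S pS holF this]
  have "residue (contour_kernel \<theta> s t G) p = G p * exp (2 * pi * \<i> * \<theta> * (p / t - s)) / (2 * pi * \<i> / t)" .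
  moreover have "exp (2 * pi * \<i> * \<theta> * (p / t - s)) = cis (2 * pi * \<theta>) ^ m"
  proof -
    have "p / t - s = of_nat m" using t by (simp add: p_def)
    then show ?thesis unfolding cis_conv_exp exp_of_nat_mult[symmetric] by (simp add: mult_ac)
  qed
  ultimately show ?thesis unfolding p_def by simp
qed

text \<open>Residue theorem on a rectangle; its upper and lower parts are then moved to the two diagonal rays.\<close>
lemma finite_contour_sum:
  assumes hol: "G holomorphic_on {x. Re x > 0}" and t: "t > 0" and s: "0 < s" "s \<le> 1"
    and \<delta>: "0 < \<delta>" "\<delta> < t * s" and R: "R = t * (real N + s + 1 / 2)"
  shows "of_real t * (\<Sum>m\<le>N. cis (2 * pi * \<theta>) ^ m * G (of_real (t * (real m + s)))) =
     contour_integral (linepath (of_real \<delta> * (1 - \<i>)) (of_real R * (1 - \<i>))) (contour_kernel \<theta> s t G)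
   - contour_integral (linepath (of_real \<delta> * (1 + \<i>)) (of_real R * (1 + \<i>))) (contour_kernel \<theta> s t G)
   + contour_integral (linepath (of_real R * (1 - \<i>)) (of_real R * (1 + \<i>))) (contour_kernel \<theta> s t G)
   + contour_integral (linepath (of_real \<delta> * (1 + \<i>)) (of_real \<delta> * (1 - \<i>))) (contour_kernel \<theta> s t G)"
proof -
  define F where "F = contour_kernel \<theta> s t G"
  \<comment> \<open>The corners of the rectangle, counterclockwise from the lower left;
    \<open>a2\<close> and \<open>a3\<close> lie on the diagonals, and \<open>c1\<close>,
    \<open>c2\<close> are the points where the diagonals cross the left edge. The right edge runs
    halfway between two lattice points.\<close>
  define a1 a2 a3 a4 where "a1 = Complex \<delta> (-R)" and "a2 = Complex R (-R)" and "a3 = Complex R R" and "a4 = Complex \<delta> R"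
  define c1 c2 where "c1 = Complex \<delta> \<delta>" and "c2 = Complex \<delta> (-\<delta>)"
  have "t * s \<le> t * (real N + s + 1 / 2)" using t by (intro mult_left_mono) auto
  then have dR: "\<delta> < R" using \<delta> unfolding R by linarith
  have names: "of_real \<delta> * (1 - \<i>) = c2" "of_real R * (1 - \<i>) = a2" "of_real \<delta> * (1 + \<i>) = c1" "of_real R * (1 + \<i>) = a3"
    by (simp_all add: complex_eq_iff a2_def a3_def c1_def c2_def)
  define NP where "NP = {x. Re x > 0 \<and> (\<forall>n::int. x \<noteq> of_real (t * (of_int n + s)))}"
  have holNP: "F holomorphic_on A" if "A \<subseteq> NP" for A
    unfolding F_def by (rule contour_kernel_holomorphic[OF hol t]) (use that in \<open>auto simp: NP_def\<close>)
  have NP1: "x \<in> NP" if "Re x > 0" "Im x \<noteq> 0" for x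
    using that by (auto simp: NP_def)
  \<comment> \<open>The left edge passes below the first sampling point t s, and the preceding
    lattice point t (s - 1) is not positive because s \<le> 1.\<close>
  have NP2: "x \<in> NP" if "Re x = \<delta>" for x
  proof -
    have "x \<noteq> of_real (t * (of_int n + s))" for n :: int
    proof
      assume "x = of_real (t * (of_int n + s))"
      then have *: "\<delta> = t * (of_int n + s)" using that by simp
      then have "0 < t * (of_int n + s)" "t * (of_int n + s) < t * s" using \<delta> by simp_all
      then have "0 < of_int n + s" "of_int n + s < s" using t by (simp_all add: zero_less_mult_iff)
      moreover from this have "real_of_int n < 0" by linarith
      then have "n \<le> -1" by simp
      then have "real_of_int n \<le> -1" by linarith
      ultimately show False using s by linarith
    qed
    then show ?thesis using that \<delta> by (auto simp: NP_def)
  qed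
  have NP3: "x \<in> NP" if "Re x = R" for x
  proof -
    have "x \<noteq> of_real (t * (of_int n + s))" for n :: int
    proof
      assume "x = of_real (t * (of_int n + s))"
      then have "t * (of_int n + s) = t * (real N + s + 1/2)" using that by (simp add: R)
      then have "of_int n + s = real N + s + 1/2" using t by simp
      then have "(of_int (2 * n) :: real) = of_int (2 * int N + 1)" by simp
      then have "2 * n = 2 * int N + 1" by (simp only: of_int_eq_iff)
      then show False by presburger
    qed
    then show ?thesis using that \<delta> dR by (auto simp: NP_def)
  qed
  have seg12: "closed_segment a1 a2 \<subseteq> NP"
    using \<delta> dR by (auto simp: a1_def a2_def closed_segment_same_Im closed_segment_eq_real_ivl intro!: NP1)
  have seg23: "closed_segment a2 a3 \<subseteq> NP"
    by (auto simp: a2_def a3_def closed_segment_same_Re intro!: NP3)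
  have seg34: "closed_segment a3 a4 \<subseteq> NP"
    using \<delta> dR by (auto simp: a3_def a4_def closed_segment_same_Im closed_segment_eq_real_ivl intro!: NP1)
  have seg41: "closed_segment a4 a1 \<subseteq> NP"
    by (auto simp: a4_def a1_def closed_segment_same_Re intro!: NP2)
  have cont: "continuous_on A F" if "A \<subseteq> NP" for A
    by (rule holomorphic_on_imp_continuous_on[OF holNP[OF that]])
  have ci: "F contour_integrable_on (linepath a b)" if "closed_segment a b \<subseteq> NP" for a b
    by (rule contour_integrable_continuous_linepath[OF cont[OF that]])
  have rect: "rectpath a1 a3 = linepath a1 a2 +++ linepath a2 a3 +++ linepath a3 a4 +++ linepath a4 a1"
    by (simp add: rectpath_def Let_def a1_def a2_def a3_def a4_def)
  have int_rect: "contour_integral (rectpath a1 a3) F = contour_integral (linepath a1 a2) F +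
      (contour_integral (linepath a2 a3) F + (contour_integral (linepath a3 a4) F + contour_integral (linepath a4 a1) F))"
    unfolding rect using seg12 seg23 seg34 seg41 
    by (simp add: ci contour_integrable_joinI valid_path_join)
  define pts where "pts = (\<lambda>m. complex_of_real (t * (real m + s))) ` {..N}"
  define S where "S = {x. Re x > 0} \<inter> {x. Re x < t * (real N + s + 1)}"
  have "contour_integral (rectpath a1 a3) F = 2 * pi * \<i> * (\<Sum>p\<in>pts. winding_number (rectpath a1 a3) p * residue F p)"
  proof (rule Residue_theorem[of S])
    show "open S" unfolding S_def by (intro open_Int open_halfspace_Re_gt open_halfspace_Re_lt)
    show "connected S" unfolding S_def by (intro convex_connected convex_Int convex_halfspace_Re_gt convex_halfspace_Re_lt)
    show "finite pts" by (simp add: pts_def)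
    show "F holomorphic_on S - pts"
    proof (rule holNP, rule subsetI)
      fix x assume x: "x \<in> S - pts"
      have "x \<noteq> of_real (t * (of_int n + s))" for n :: int
      proof
        assume xn: "x = of_real (t * (of_int n + s))"
        have "t * 0 < t * (of_int n + s)" "t * (of_int n + s) < t * (real N + s + 1)"
          using x xn by (auto simp: S_def)
        then have "0 < of_int n + s" "of_int n + s < real N + s + 1"
          using t by (simp_all only: mult_less_cancel_left_pos)
        then have n: "0 \<le> n" "nat n \<le> N" using s by linarith+
        then have "x = of_real (t * (real (nat n) + s))" using xn by simp
        then have "x \<in> pts" unfolding pts_def by (rule image_eqI) (use n in simp)
        then show False using x by blast
      qed
      then show "x \<in> NP" using x by (auto simp: S_def NP_def)
    qed
    have img: "path_image (rectpath a1 a3) = closed_segment a1 a2 \<union> closed_segment a2 a3 \<union> closed_segment a3 a4 \<union> closed_segment a4 a1"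
      unfolding rect by (simp add: path_image_join Un_assoc)
    have "pts \<inter> NP = {}"
    proof -
      have "complex_of_real (t * (real m + s)) \<notin> NP" for m
        unfolding NP_def by (auto intro!: exI[of _ "int m"])
      then show ?thesis by (auto simp: pts_def)
    qed
    moreover have boxS: "cbox a1 a3 \<subseteq> S"
      using \<delta> dR t by (auto simp: S_def in_cbox_complex_iff a1_def a3_def R algebra_simps)
    moreover have "path_image (rectpath a1 a3) \<subseteq> cbox a1 a3"
      using dR \<delta> by (intro path_image_rectpath_subset_cbox) (auto simp: a1_def a3_def)
    moreover have "path_image (rectpath a1 a3) \<subseteq> NP" unfolding img using seg12 seg23 seg34 seg41 by blast
    ultimately show "path_image (rectpath a1 a3) \<subseteq> S - pts" by blast
    show "\<forall>z. z \<notin> S \<longrightarrow> winding_number (rectpath a1 a3) z = 0"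
      using boxS dR \<delta> by (intro allI impI winding_number_rectpath_outside) (auto simp: a1_def a3_def)
  qed auto
  also have "(\<Sum>p\<in>pts. winding_number (rectpath a1 a3) p * residue F p) = (\<Sum>p\<in>pts. residue F p)"
  proof (rule sum.cong[OF refl])
    fix p assume "p \<in> pts"
    then obtain m where m: "m \<le> N" "p = of_real (t * (real m + s))" by (auto simp: pts_def)
    have "p \<in> box a1 a3"
    proof -
      have "t * (0 + s) \<le> t * (real m + s)" using t by (intro mult_left_mono) auto
      then have "\<delta> < t * (real m + s)" using \<delta>(2) by simp
      moreover have "t * (real m + s) < R" unfolding R using t m by (intro mult_strict_left_mono) auto
      ultimately show ?thesis using dR \<delta> by (simp add: in_box_complex_iff a1_def a3_def m)
    qed
    then show "winding_number (rectpath a1 a3) p * residue F p = residue F p"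
      by (simp add: winding_number_rectpath)
  qed
  also have "(\<Sum>p\<in>pts. residue F p) = (\<Sum>m\<le>N. residue F (of_real (t * (real m + s))))"
    unfolding pts_def using t by (subst sum.reindex) (auto simp: inj_on_def)
  also have "\<dots> = (\<Sum>m\<le>N. cis (2 * pi * \<theta>) ^ m * G (of_real (t * (real m + s))) * (of_real t / (2 * pi * \<i>)))"
    unfolding F_def contour_kernel_residue[OF hol t s(1)] by simp
  also have "2 * pi * \<i> * \<dots> = of_real t * (\<Sum>m\<le>N. cis (2 * pi * \<theta>) ^ m * G (of_real (t * (real m + s))))"
    unfolding sum_distrib_right[symmetric] by simp
  finally have main: "of_real t * (\<Sum>m\<le>N. cis (2 * pi * \<theta>) ^ m * G (of_real (t * (real m + s)))) =
     contour_integral (linepath a1 a2) F + (contour_integral (linepath a2 a3) F + (contour_integral (linepath a3 a4) F + contour_integral (linepath a4 a1) F))"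
    unfolding int_rect ..
  have left: "contour_integral (linepath a4 a1) F = contour_integral (linepath a4 c1) F + (contour_integral (linepath c1 c2) F + contour_integral (linepath c2 a1) F)"
  proof -
    have c1: "c1 \<in> closed_segment a4 a1"
      using \<delta> dR by (auto simp: a4_def a1_def c1_def closed_segment_same_Re closed_segment_eq_real_ivl)
    have c2: "c2 \<in> closed_segment c1 a1"
      using \<delta> dR by (auto simp: c2_def a1_def c1_def closed_segment_same_Re closed_segment_eq_real_ivl)
    have s1: "closed_segment c1 a1 \<subseteq> NP"
      by (auto simp: c1_def a1_def closed_segment_same_Re intro!: NP2)
    show ?thesis
      using contour_integral_split_linepath[OF cont[OF seg41] c1] contour_integral_split_linepath[OF cont[OF s1] c2] by simp
  qed
  have tri: "contour_integral (linepath a b) F + contour_integral (linepath b c) F = - contour_integral (linepath c a) F"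
    if T: "convex T" "T \<subseteq> NP" "{a, b, c} \<subseteq> T" for a b c T
  proof -
    have hull: "convex hull {a, b, c} \<subseteq> NP" using hull_minimal[of "{a,b,c}" T convex] T by blast
    have segs: "closed_segment a b \<subseteq> NP" "closed_segment b c \<subseteq> NP" "closed_segment c a \<subseteq> NP"
      by (rule subset_trans[OF closed_segment_subset T(2)]; use T in simp)+
    have "contour_integral (linepath a b +++ linepath b c +++ linepath c a) F = 0"
      by (rule contour_integral_unique[OF Cauchy_theorem_triangle[OF holNP[OF hull]]])
    then show ?thesis using segs by (simp add: ci contour_integrable_joinI valid_path_join add_eq_0_iff2 add.assoc[symmetric])
  qed
  \<comment> \<open>The triangle between the upper and left edges and the diagonal lies strictly
    above the real axis, free of poles, so two sides can be traded for the diagonal; the lower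
    triangle is treated likewise.\<close>
  have up: "contour_integral (linepath a3 a4) F + contour_integral (linepath a4 c1) F = - contour_integral (linepath c1 a3) F"
  proof (rule tri)
    show "convex ({x. Re x > 0} \<inter> {x. Im x > 0})" by (intro convex_Int convex_halfspace_Re_gt convex_halfspace_Im_gt)
    show "{x. Re x > 0} \<inter> {x. Im x > 0} \<subseteq> NP" by (auto intro!: NP1)
    show "{a3, a4, c1} \<subseteq> {x. Re x > 0} \<inter> {x. Im x > 0}" using \<delta> dR by (auto simp: a3_def a4_def c1_def)
  qed
  have low: "contour_integral (linepath c2 a1) F + contour_integral (linepath a1 a2) F = - contour_integral (linepath a2 c2) F"
  proof (rule tri)
    show "convex ({x. Re x > 0} \<inter> {x. Im x < 0})" by (intro convex_Int convex_halfspace_Re_gt convex_halfspace_Im_lt)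
    show "{x. Re x > 0} \<inter> {x. Im x < 0} \<subseteq> NP" by (auto intro!: NP1)
    show "{c2, a1, a2} \<subseteq> {x. Re x > 0} \<inter> {x. Im x < 0}" using \<delta> dR by (auto simp: a1_def a2_def c2_def)
  qed
  have "closed_segment a2 c2 \<subseteq> {x. Re x > 0} \<inter> {x. Im x < 0}"
    using \<delta> dR by (intro closed_segment_subset convex_Int convex_halfspace_Re_gt convex_halfspace_Im_lt) (auto simp: a2_def c2_def)
  then have "closed_segment a2 c2 \<subseteq> NP" by (auto intro!: NP1)
  then have rev: "contour_integral (linepath a2 c2) F = - contour_integral (linepath c2 a2) F"
    by (intro contour_integral_reverse_linepath cont)
  have "b + (r + (a + (l + (m + l')))) = p - u + r + m"
    if "a + l = - u" "l' + b = - q" "q = - p" for a b l l' m p q r u :: complex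
    using that by algebra
  then show ?thesis
    unfolding names F_def[symmetric] main left using up low rev by blast
qed

text \<open>The contribution of the upper ray to the sum of \<open>e\<^sup>2\<^sup>\<pi>\<^sup>i\<^sup>\<theta>\<^sup>m G ((m + s) t)\<close>, multiplied by \<open>t\<close>.\<close>
definition ray_part :: "real \<Rightarrow> real \<Rightarrow> (complex \<Rightarrow> complex) \<Rightarrow> real \<Rightarrow> real \<Rightarrow> complex" where
  "ray_part A s G \<theta> t = (1 + \<i>) * cis (- (2 * pi * \<theta> * s)) *
     (LINT r:{0<..}|lborel. ray_integrand A \<theta> (cis (- (2 * pi * s))) G (sqrt (A * pi * \<theta> / t)) r)"

text \<open>Here \<open>sqrt (A * pi * \<theta> / t)\<close> is sqrt (A \<omega> / 2) with \<omega>
  = 2 pi \<theta> / t. The sign comes from writing 1 / (w - 1) as - 1 / (1 - w), so that the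
  denominator tends to 1 along the ray.\<close>

lemma contour_kernel_ray:
  assumes "A > 0" "\<theta> > 0" "t > 0"
  shows "contour_kernel \<theta> s t G (of_real r * (1 + \<i>)) =
    - (cis (- (2 * pi * \<theta> * s)) * ray_integrand A \<theta> (cis (- (2 * pi * s))) G (sqrt (A * pi * \<theta> / t)) r)"
proof -
  define \<mu> where "\<mu> = sqrt (A * pi * \<theta> / t)"
  have \<mu>: "\<mu>\<^sup>2 = A * pi * \<theta> / t" using assms by (simp add: \<mu>_def)
  have e1: "2 * \<mu>\<^sup>2 / A * r = 2 * pi * \<theta> * r / t" unfolding \<mu> using assms by simp
  have e2: "2 * \<mu>\<^sup>2 / (A * \<theta>) * r = 2 * pi * r / t" unfolding \<mu> using assms by simp
  have x1: "exp (2 * pi * \<i> * \<theta> * (of_real r * (1 + \<i>) / t - s)) =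
      cis (- (2 * pi * \<theta> * s)) * exp (- (of_real (2 * pi * \<theta> * r / t) * (1 - \<i>)))"
    unfolding cis_conv_exp exp_add[symmetric] by (rule arg_cong[where f=exp]) (simp add: complex_eq_iff algebra_simps)
  have x2: "exp (2 * pi * \<i> * (of_real r * (1 + \<i>) / t - s)) =
      cis (- (2 * pi * s)) * exp (- (of_real (2 * pi * r / t) * (1 - \<i>)))"
    unfolding cis_conv_exp exp_add[symmetric] by (rule arg_cong[where f=exp]) (simp add: complex_eq_iff algebra_simps)
  have neg: "(1::complex) / (z - 1) = - (1 / (1 - z))" for z
    by (metis minus_diff_eq divide_minus_right)
  have "contour_kernel \<theta> s t G (of_real r * (1 + \<i>)) = (G (of_real r * (1 + \<i>)) * (cis (- (2 * pi * \<theta> * s)) * exp (- (of_real (2 * pi * \<theta> * r / t) * (1 - \<i>))))) *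
     (1 / (cis (- (2 * pi * s)) * exp (- (of_real (2 * pi * r / t) * (1 - \<i>))) - 1))"
    unfolding contour_kernel_def x1 x2 by simp
  then show ?thesis unfolding neg ray_integrand_def \<mu>_def[symmetric] e1 e2 by simp
qed

text \<open>The identity exp ((1 - \<theta>) y) / (exp y - 1) = - exp (- \<theta> y) / (exp (- y) -
  1) makes reflection in the real axis exchange \<theta> and 1 - \<theta>. The lower ray thus
  reduces to the upper one.\<close>

lemma contour_kernel_cnj:
  assumes "cnj (G x) = G (cnj x)" "exp (2 * pi * \<i> * (x / complex_of_real t - complex_of_real s)) \<noteq> 1"
  shows "contour_kernel \<theta> s t G (cnj x) = - cnj (contour_kernel (1 - \<theta>) s t G x)"
proof -
  define y where "y = 2 * pi * \<i> * (x / complex_of_real t - complex_of_real s)"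
  have y1: "2 * pi * \<i> * complex_of_real (1 - \<theta>) * (x / complex_of_real t - complex_of_real s) = y - \<theta> * y"
    by (simp add: y_def algebra_simps)
  have y2: "2 * pi * \<i> * \<theta> * (cnj x / complex_of_real t - complex_of_real s) = cnj (- (\<theta> * y))"
    by (simp add: y_def algebra_simps)
  have y3: "2 * pi * \<i> * (cnj x / complex_of_real t - complex_of_real s) = cnj (- y)"
    by (simp add: y_def algebra_simps)
  have ne: "exp y - 1 \<noteq> 0" using assms(2) unfolding y_def by simp
  have "exp (y - \<theta> * y) / (exp y - 1) = - (exp (- (\<theta> * y)) / (exp (- y) - 1))"
  proof -
    have "exp (- y) - 1 = - (exp y - 1) / exp y" by (simp add: exp_minus field_simps)
    then have "exp (- (\<theta> * y)) / (exp (- y) - 1) = exp (- (\<theta> * y)) * exp y / (- (exp y - 1))"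
      by simp
    also have "exp (- (\<theta> * y)) * exp y = exp (y - \<theta> * y)" unfolding exp_add[symmetric] by simp
    finally show ?thesis by (simp only: divide_minus_right minus_minus)
  qed
  then have "contour_kernel (1 - \<theta>) s t G x = - (G x * exp (- (\<theta> * y)) / (exp (- y) - 1))"
    unfolding contour_kernel_def y1 y_def[symmetric] times_divide_eq_right[symmetric] by simp
  then have "cnj (contour_kernel (1 - \<theta>) s t G x) = - (cnj (G x) * exp (cnj (- (\<theta> * y))) / (exp (cnj (- y)) - 1))"
    by (simp add: exp_cnj)
  then show ?thesis unfolding contour_kernel_def y2 y3 assms(1) by simp
qed

lemma contour_integral_ray:
  assumes "a < b" "w \<noteq> 0" "continuous_on {a..b} (\<lambda>r. f (of_real r * w))"
  shows "contour_integral (linepath (of_real a * w) (of_real b * w)) f = w * integral {a..b} (\<lambda>r. f (of_real r * w))"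
proof -
  define J where "J = integral {a..b} (\<lambda>r. f (of_real r * w))"
  have "((\<lambda>r. f (of_real r * w)) has_integral J) (cbox a b)"
    unfolding J_def using assms(3) by (simp add: integrable_integral integrable_continuous_interval)
  note aff = has_integral_affinity[OF this, of "b - a" a]
  have "((\<lambda>x. f (of_real ((b - a) * x + a) * w)) has_integral (1 / (b - a)) *\<^sub>R J) {0..1}"
  proof -
    have im: "(\<lambda>x. (x - a) / (b - a)) ` {a..b} = {0..1}"
    proof (intro equalityI subsetI)
      fix y :: real assume "y \<in> {0..1}"
      then have "(b - a) * 0 \<le> (b - a) * y" "(b - a) * y \<le> (b - a) * 1"
        using assms(1) by (auto intro!: mult_left_mono)
      then have "(b - a) * y + a \<in> {a..b}" by auto
      then show "y \<in> (\<lambda>x. (x - a) / (b - a)) ` {a..b}"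
        by (rule rev_image_eqI) (use assms(1) in simp)
    qed (use assms(1) in \<open>auto simp: divide_le_eq\<close>)
    show ?thesis
      using aff assms(1) by (simp add: scaleR_conv_of_real im[unfolded diff_divide_distrib])
  qed
  then have "((\<lambda>x. f (of_real ((b - a) * x + a) * w) * (of_real (b - a) * w)) has_integral ((1 / (b - a)) *\<^sub>R J) * (of_real (b - a) * w)) {0..1}"
    by (rule has_integral_mult_left)
  moreover have "((1 / (b - a)) *\<^sub>R J) * (of_real (b - a) * w) = w * J"
    using assms(1) by (simp add: scaleR_conv_of_real)
  moreover have "linepath (of_real a * w) (of_real b * w) x = of_real ((b - a) * x + a) * w" for x
    by (simp add: linepath_def scaleR_conv_of_real algebra_simps)
  moreover have "of_real b * w - of_real a * w = of_real (b - a) * w" by (simp add: algebra_simps)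
  ultimately have "(f has_contour_integral w * J) (linepath (of_real a * w) (of_real b * w))"
    unfolding has_contour_integral_linepath by simp
  then show ?thesis unfolding J_def by (rule contour_integral_unique)
qed

text \<open>For s = 1 the vertex is itself a lattice point and the denominator has a simple zero
  there; for s < 1 it stays away from zero. A linear lower bound covers both, and it is enough since
  G tends to 0 while the short edge has length proportional to its distance from the vertex.\<close>

lemma kernel_near_zero:
  assumes t: "t > 0" and s: "0 < s" "s \<le> 1"
  shows "\<exists>c>0. \<forall>\<^sub>F x in at 0. norm (exp (2 * pi * \<i> * (x / complex_of_real t - complex_of_real s)) - 1) \<ge> c * norm x"
proof (cases "s = 1")
  case True
  define e where "e x = exp (2 * pi * \<i> * (x / complex_of_real t - complex_of_real s))" for x
  have e0: "e 0 = 1" using exp_eq_1_lattice[OF t, of 0 s] unfolding e_def True by (metis add.left_neutral add_diff_cancel_left' diff_numeral_special(12) mult_zero_right of_int_1 of_int_minus of_real_0 add.commute add.right_inverse)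
  have "(e has_field_derivative 2 * pi * \<i> / t) (at 0)"
    unfolding e_def[abs_def] using e0 t by (auto intro!: derivative_eq_intros simp: e_def)
  then have "((\<lambda>x. (e x - 1) / x) \<longlongrightarrow> 2 * pi * \<i> / t) (at 0)"
    by (simp add: has_field_derivative_iff e0)
  from tendsto_norm[OF this] have "((\<lambda>x. norm ((e x - 1) / x)) \<longlongrightarrow> 2 * pi / t) (at 0)"
    using t by (simp add: norm_divide norm_mult)
  then have "\<forall>\<^sub>F x in at 0. norm ((e x - 1) / x) > pi / t"
    by (rule order_tendstoD) (use t in \<open>simp add: divide_strict_right_mono\<close>)
  moreover have "\<forall>\<^sub>F x in at (0::complex). x \<noteq> 0" by (simp add: eventually_at_filter)
  ultimately have "\<forall>\<^sub>F x in at 0. norm (e x - 1) \<ge> (pi / t) * norm x"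
  proof eventually_elim
    case (elim x)
    then have "pi / t < norm (e x - 1) / norm x" by (simp add: norm_divide)
    moreover have nx: "0 < norm x" using elim(2) by simp
    ultimately have "(pi / t) * norm x < norm (e x - 1)" by (simp only: pos_less_divide_eq[OF nx])
    then show ?case by simp
  qed
  then show ?thesis using t unfolding e_def by (intro exI[of _ "pi / t"]) auto
next
  case False
  define e where "e x = exp (2 * pi * \<i> * (x / complex_of_real t - complex_of_real s)) - 1" for x
  have e0: "e 0 \<noteq> 0"
  proof
    assume "e 0 = 0"
    then obtain n :: int where "0 = complex_of_real (t * (of_int n + s))"
      using exp_eq_1_lattice[OF t, of 0 s] by (auto simp: e_def)
    then have n: "of_int n + s = 0" using t by (metis mult_eq_0_iff of_real_eq_0_iff less_irrefl)
    then have "real_of_int n < 0" "real_of_int n > -1" using s False by linarith+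
    then have "n < 0" "-1 < n" by simp_all
    then show False by linarith
  qed
  have "(e \<longlongrightarrow> e 0) (at 0)" unfolding e_def by (intro tendsto_intros) (use t in auto)
  from tendsto_norm[OF this] have "\<forall>\<^sub>F x in at 0. norm (e x) > norm (e 0) / 2"
    by (rule order_tendstoD) (use e0 in simp)
  moreover have "\<forall>\<^sub>F x in at (0::complex). norm x < 1"
    using tendsto_norm_zero[OF tendsto_ident_at] by (rule order_tendstoD) simp
  ultimately have "\<forall>\<^sub>F x in at 0. norm (e x) \<ge> norm (e 0) / 2 * norm x"
  proof eventually_elim
    case (elim x)
    have "norm (e 0) / 2 * norm x \<le> norm (e 0) / 2 * 1" using elim by (intro mult_left_mono) auto
    then show ?case using elim by simp
  qed
  then show ?thesis using e0 unfolding e_def[symmetric] by (intro exI[of _ "norm (e 0) / 2"]) auto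
qed

text \<open>In the limit of growing rectangles the two short vertical pieces disappear: on the right
  G decays exponentially, on the left G tends to 0 against the linear bound of the denominator. What
  remains is one ray integral and the conjugate of another. The upper bounds on t put both Laplace
  parameters into the range \<mu> \<ge> 1, where the ray integrals are known to converge.\<close>

lemma admissible_sum:
  assumes A: "A > 0" and \<kappa>: "\<kappa> > 0" and G: "admissible A \<kappa> c G" and \<theta>: "0 < \<theta>" "\<theta> < 1"
    and s: "0 < s" "s \<le> 1" and t: "0 < t" "t \<le> A * pi * \<theta>" "t \<le> A * pi * (1 - \<theta>)"
  shows "(\<lambda>m. cis (2 * pi * \<theta>) ^ m * G (of_real (t * (real m + s)))) sums
     ((ray_part A s G \<theta> t + cnj (ray_part A s G (1 - \<theta>) t)) / of_real t)"
proof -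
  have hol: "G holomorphic_on {x. Re x > 0}" and cnjG: "\<And>x. Re x > 0 \<Longrightarrow> G (cnj x) = cnj (G x)"
    and G0: "(G \<longlongrightarrow> 0) (at 0 within sector)"
    using G unfolding admissible_def by blast+
  obtain C where C: "C > 0" "\<And>x. x \<in> sector \<Longrightarrow> norm (G x) \<le> C * exp (- Re x / 2)"
    using G unfolding admissible_def by blast
  define R where "R N = t * (real N + s + 1 / 2)" for N
  define \<delta> where "\<delta> N = t * s / (real N + 2)" for N
  have \<delta>: "0 < \<delta> N" "\<delta> N < t * s" for N
    using t s by (simp_all add: \<delta>_def divide_less_eq mult_pos_pos)
  have \<delta>R: "\<delta> N < R N" for N
  proof -
    have "t * s \<le> R N" unfolding R_def using t by (intro mult_left_mono) auto
    then show ?thesis using \<delta>(2)[of N] by simp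
  qed
  have \<delta>0: "\<delta> \<longlonglongrightarrow> 0" unfolding \<delta>_def by real_asymp
  have Rinf: "filterlim R at_top sequentially" unfolding R_def using t(1) by real_asymp
  define F where "F = contour_kernel \<theta> s t G"
  define f where "f \<theta>' = ray_integrand A \<theta>' (cis (- (2 * pi * s))) G (sqrt (A * pi * \<theta>' / t))" for \<theta>'
  have f_int: "set_integrable lborel {0<..} (f \<theta>')" if "\<theta>' = \<theta> \<or> \<theta>' = 1 - \<theta>" for \<theta>'
  proof -
    have "\<theta>' > 0" "t \<le> A * pi * \<theta>'" using that \<theta> t by auto
    moreover from this have "sqrt (A * pi * \<theta>' / t) \<ge> 1" using t(1) by (simp add: pos_le_divide_eq)
    ultimately show ?thesis unfolding f_def by (intro ray_laplace(1)[OF A \<kappa> _ _ G]) auto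
  qed
  have f_cont: "continuous_on {a..b} (f \<theta>')" if "a > 0" "\<theta>' > 0" for a b \<theta>'
  proof -
    have "continuous_on {a..b} (\<lambda>r. G (of_real r * (1 + \<i>)))"
      by (rule continuous_on_compose2[OF holomorphic_on_imp_continuous_on[OF hol]])
         (use that in \<open>auto intro!: continuous_intros\<close>)
    moreover have "1 - cis (- (2 * pi * s)) * exp (- (of_real (2 * (sqrt (A * pi * \<theta>' / t))\<^sup>2 / (A * \<theta>') * r) * (1 - \<i>))) \<noteq> 0" if r: "r \<in> {a..b}" for r
      using r that \<open>a > 0\<close> \<open>\<theta>' > 0\<close> A t by (intro ray_denominator_nz) (auto intro!: mult_pos_pos divide_pos_pos)
    ultimately show ?thesis
      unfolding f_def ray_integrand_def by (intro continuous_intros) auto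
  qed
  define U where "U \<theta>' N = integral {\<delta> N..R N} (f \<theta>')" for \<theta>' N
  have U_lim: "U \<theta>' \<longlonglongrightarrow> (LINT r:{0<..}|lborel. f \<theta>' r)" if th: "\<theta>' = \<theta> \<or> \<theta>' = 1 - \<theta>" for \<theta>'
  proof -
    have U_eq: "U \<theta>' N = (LINT r|lborel. indicator {\<delta> N..R N} r *\<^sub>R (indicator {0<..} r *\<^sub>R f \<theta>' r))" for N
    proof -
      have "set_integrable lborel {\<delta> N..R N} (f \<theta>')"
        by (rule set_integrable_subset[OF f_int[OF th]]) (use \<delta>(1)[of N] in auto)
      from set_borel_integral_eq_integral(2)[OF this]
      have "U \<theta>' N = (LINT r|lborel. indicator {\<delta> N..R N} r *\<^sub>R f \<theta>' r)"
        by (simp add: U_def set_lebesgue_integral_def)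
      also have "\<dots> = (LINT r|lborel. indicator {\<delta> N..R N} r *\<^sub>R (indicator {0<..} r *\<^sub>R f \<theta>' r))"
        using \<delta>(1)[of N] by (intro Bochner_Integration.integral_cong) (auto simp: indicator_def)
      finally show ?thesis .
    qed
    have i: "integrable lborel (\<lambda>r. indicator {0<..} r *\<^sub>R f \<theta>' r)"
      using f_int[OF th] by (simp add: set_integrable_def)
    have "(\<lambda>N. LINT r|lborel. indicator {\<delta> N..R N} r *\<^sub>R (indicator {0<..} r *\<^sub>R f \<theta>' r)) \<longlonglongrightarrow> (LINT r|lborel. indicator {0<..} r *\<^sub>R f \<theta>' r)"
    proof (rule integral_dominated_convergence[where w="\<lambda>r. norm (indicator {0<..} r *\<^sub>R f \<theta>' r)"])
      show "AE r in lborel. (\<lambda>N. indicator {\<delta> N..R N} r *\<^sub>R (indicator {0<..} r *\<^sub>R f \<theta>' r)) \<longlonglongrightarrow> indicator {0<..} r *\<^sub>R f \<theta>' r"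
      proof (intro AE_I2 tendsto_eventually)
        fix r :: real
        show "\<forall>\<^sub>F N in sequentially. indicator {\<delta> N..R N} r *\<^sub>R (indicator {0<..} r *\<^sub>R f \<theta>' r) = indicator {0<..} r *\<^sub>R f \<theta>' r"
        proof (cases "r > 0")
          case True
          have "\<forall>\<^sub>F N in sequentially. \<delta> N < r" using \<delta>0 True by (rule order_tendstoD)
          moreover have "\<forall>\<^sub>F N in sequentially. r \<le> R N" using Rinf by (simp add: filterlim_at_top)
          ultimately show ?thesis by eventually_elim (simp add: indicator_def)
        qed simp
      qed
      show "(\<lambda>r. indicator {\<delta> N..R N} r *\<^sub>R (indicator {0<..} r *\<^sub>R f \<theta>' r)) \<in> borel_measurable lborel" for N
        using borel_measurable_integrable[OF i] by measurable
      show "integrable lborel (\<lambda>r. norm (indicator {0<..} r *\<^sub>R f \<theta>' r))" by (rule integrable_norm[OF i])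
      show "(\<lambda>r. indicator {0<..} r *\<^sub>R f \<theta>' r) \<in> borel_measurable lborel" by (rule borel_measurable_integrable[OF i])
      show "AE r in lborel. norm (indicator {\<delta> N..R N} r *\<^sub>R (indicator {0<..} r *\<^sub>R f \<theta>' r)) \<le> norm (indicator {0<..} r *\<^sub>R f \<theta>' r)" for N
        by (intro AE_I2) (auto simp: indicator_def)
    qed
    then show ?thesis unfolding U_eq set_lebesgue_integral_def .
  qed
  have up: "contour_integral (linepath (of_real (\<delta> N) * (1 + \<i>)) (of_real (R N) * (1 + \<i>))) (contour_kernel \<theta>' s t G)
      = - ((1 + \<i>) * cis (- (2 * pi * \<theta>' * s)) * U \<theta>' N)" if "\<theta>' > 0" for \<theta>' N
  proof -
    have eq: "contour_kernel \<theta>' s t G (of_real r * (1 + \<i>)) = - cis (- (2 * pi * \<theta>' * s)) * f \<theta>' r" for r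
      using contour_kernel_ray[OF A that t(1)] by (simp add: f_def)
    have "contour_integral (linepath (of_real (\<delta> N) * (1 + \<i>)) (of_real (R N) * (1 + \<i>))) (contour_kernel \<theta>' s t G) =
       (1 + \<i>) * integral {\<delta> N..R N} (\<lambda>r. contour_kernel \<theta>' s t G (of_real r * (1 + \<i>)))"
      by (rule contour_integral_ray[OF \<delta>R]) (auto simp: eq complex_eq_iff intro!: continuous_intros f_cont \<delta> that)
    also have "integral {\<delta> N..R N} (\<lambda>r. contour_kernel \<theta>' s t G (of_real r * (1 + \<i>))) = - cis (- (2 * pi * \<theta>' * s)) * U \<theta>' N"
      unfolding eq U_def by (rule integral_mult_right)
    finally show ?thesis by simp
  qed
  have low: "contour_integral (linepath (of_real (\<delta> N) * (1 - \<i>)) (of_real (R N) * (1 - \<i>))) F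
      = cnj ((1 + \<i>) * cis (- (2 * pi * (1 - \<theta>) * s)) * U (1 - \<theta>) N)" for N
  proof -
    have th1: "1 - \<theta> > 0" using \<theta> by simp
    have eq0: "contour_kernel (1 - \<theta>) s t G (of_real r * (1 + \<i>)) = - cis (- (2 * pi * (1 - \<theta>) * s)) * f (1 - \<theta>) r" for r
      using contour_kernel_ray[OF A th1 t(1)] by (simp add: f_def)
    have eq: "F (of_real r * (1 - \<i>)) = cnj (cis (- (2 * pi * (1 - \<theta>) * s)) * f (1 - \<theta>) r)" if "r > 0" for r
    proof -
      have "exp (2 * pi * \<i> * (of_real r * (1 + \<i>) / complex_of_real t - complex_of_real s)) \<noteq> 1"
        unfolding exp_eq_1_lattice[OF t(1)] using that by (auto simp: complex_eq_iff)
      moreover have "cnj (G (of_real r * (1 + \<i>))) = G (cnj (of_real r * (1 + \<i>)))"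
        using that by (intro cnjG[symmetric]) simp
      ultimately have "F (cnj (of_real r * (1 + \<i>))) = - cnj (contour_kernel (1 - \<theta>) s t G (of_real r * (1 + \<i>)))"
        unfolding F_def by (intro contour_kernel_cnj)
      moreover have "cnj (of_real r * (1 + \<i>)) = of_real r * (1 - \<i>)" by (simp add: complex_eq_iff)
      ultimately show ?thesis unfolding eq0 by simp
    qed
    have "continuous_on {\<delta> N..R N} (\<lambda>r. cnj (cis (- (2 * pi * (1 - \<theta>) * s)) * f (1 - \<theta>) r))"
      by (intro continuous_intros f_cont \<delta> th1)
    then have c: "continuous_on {\<delta> N..R N} (\<lambda>r. F (of_real r * (1 - \<i>)))"
      by (rule continuous_on_eq) (use eq \<delta>(1)[of N] in auto)
    have "contour_integral (linepath (of_real (\<delta> N) * (1 - \<i>)) (of_real (R N) * (1 - \<i>))) F =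
       (1 - \<i>) * integral {\<delta> N..R N} (\<lambda>r. F (of_real r * (1 - \<i>)))"
      by (rule contour_integral_ray[OF \<delta>R _ c]) (simp add: complex_eq_iff)
    also have "integral {\<delta> N..R N} (\<lambda>r. F (of_real r * (1 - \<i>))) = integral {\<delta> N..R N} (\<lambda>r. cnj (cis (- (2 * pi * (1 - \<theta>) * s)) * f (1 - \<theta>) r))"
      by (rule integral_cong) (use eq \<delta>(1)[of N] in auto)
    also have "\<dots> = cnj (integral {\<delta> N..R N} (\<lambda>r. cis (- (2 * pi * (1 - \<theta>) * s)) * f (1 - \<theta>) r))"
      by (rule integral_cnj[symmetric])
    also have "integral {\<delta> N..R N} (\<lambda>r. cis (- (2 * pi * (1 - \<theta>) * s)) * f (1 - \<theta>) r) = cis (- (2 * pi * (1 - \<theta>) * s)) * U (1 - \<theta>) N"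
      unfolding U_def by (rule integral_mult_right)
    finally show ?thesis by simp
  qed
  have segR: "Re x = R N \<and> \<bar>Im x\<bar> \<le> R N" if "x \<in> closed_segment (of_real (R N) * (1 - \<i>)) (of_real (R N) * (1 + \<i>))" for x N
    using that \<delta>R[of N] \<delta>(1)[of N] by (auto simp: closed_segment_same_Re closed_segment_eq_real_ivl abs_le_iff)
  have segL: "Re x = \<delta> N \<and> \<bar>Im x\<bar> \<le> \<delta> N" if "x \<in> closed_segment (of_real (\<delta> N) * (1 + \<i>)) (of_real (\<delta> N) * (1 - \<i>))" for x N
    using that \<delta>(1)[of N] by (auto simp: closed_segment_same_Re closed_segment_eq_real_ivl abs_le_iff)
  have numer: "norm (exp (2 * pi * \<i> * \<theta> * (x / complex_of_real t - complex_of_real s))) = exp (- (2 * pi * \<theta> * Im x / t))" for x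
    by (simp add: norm_exp_eq_Re)
  have right: "(\<lambda>N. contour_integral (linepath (of_real (R N) * (1 - \<i>)) (of_real (R N) * (1 + \<i>))) F) \<longlonglongrightarrow> 0"
  proof (rule Lim_null_comparison)
    have bnd: "norm (F x) \<le> C * exp (- R N / 2)" if x: "x \<in> closed_segment (of_real (R N) * (1 - \<i>)) (of_real (R N) * (1 + \<i>))" for x N
    proof -
      have xs: "x \<in> sector" using segR[OF x] \<delta>R[of N] \<delta>(1)[of N] by (auto simp: sector_def)
      define v where "v = 2 * pi * Im x / t"
      \<comment> \<open>Halfway between lattice points the exponential is a negative real number, so
        subtracting 1 causes no cancellation.\<close>
      have "exp (2 * pi * \<i> * (x / complex_of_real t - complex_of_real s)) = - of_real (exp (- v))"
      proof -
        have e1: "2 * pi * \<i> * (x / complex_of_real t - complex_of_real s) = of_real (- v) + (\<i> * of_real pi + of_nat N * (2 * of_real pi * \<i>))"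
          using segR[OF x] t(1) by (simp add: complex_eq_iff v_def R_def algebra_simps add_divide_distrib)
        have e2: "exp (of_nat N * (2 * of_real pi * \<i>)) = (1::complex)"
          using exp_integer_2pi[of "of_nat N"] by (simp add: mult_ac)
        show ?thesis unfolding e1 exp_add e2 exp_of_real exp_pi_i' by simp
      qed
      then have "exp (2 * pi * \<i> * (x / complex_of_real t - complex_of_real s)) - 1 = - of_real (exp (- v) + 1)" by simp
      then have den: "norm (exp (2 * pi * \<i> * (x / complex_of_real t - complex_of_real s)) - 1) = 1 + exp (- v)"
        by (simp only: norm_minus_cancel norm_of_real) (simp add: add_nonneg_nonneg)
      \<comment> \<open>For v \<ge> 0 the left side is at most 1 because \<theta> is positive; for v
        < 0 it is at most exp (- v) because \<theta> is below 1.\<close>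
      have num: "exp (- (2 * pi * \<theta> * Im x / t)) \<le> 1 + exp (- v)"
      proof (cases "v \<ge> 0")
        case True
        have "2 * pi * \<theta> * Im x / t = \<theta> * v" by (simp add: v_def)
        then have "exp (- (2 * pi * \<theta> * Im x / t)) \<le> 1" using True \<theta> by simp
        then show ?thesis using exp_ge_zero[of "-v"] by linarith
      next
        case False
        have "2 * pi * \<theta> * Im x / t = \<theta> * v" by (simp add: v_def)
        moreover have "- (\<theta> * v) \<le> - v" using False \<theta> mult_right_mono_neg[of \<theta> 1 v] by simp
        ultimately have "exp (- (2 * pi * \<theta> * Im x / t)) \<le> exp (- v)" by simp
        then show ?thesis by linarith
      qed
      have "norm (F x) = norm (G x) * (exp (- (2 * pi * \<theta> * Im x / t)) / (1 + exp (- v)))"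
        unfolding F_def contour_kernel_def norm_divide norm_mult[of "G x"] den numer by simp
      also have "\<dots> \<le> (C * exp (- R N / 2)) * 1"
        using C(2)[OF xs] C(1) segR[OF x] num by (intro mult_mono) (auto simp: divide_le_eq add_pos_pos)
      finally show ?thesis by simp
    qed
    have ci: "F contour_integrable_on (linepath (of_real (R N) * (1 - \<i>)) (of_real (R N) * (1 + \<i>)))" for N
    proof (rule contour_integrable_continuous_linepath, rule holomorphic_on_imp_continuous_on)
      show "F holomorphic_on closed_segment (of_real (R N) * (1 - \<i>)) (of_real (R N) * (1 + \<i>))"
        unfolding F_def
      proof (rule contour_kernel_holomorphic[OF hol t(1)])
        fix x assume x: "x \<in> closed_segment (of_real (R N) * (1 - \<i>)) (of_real (R N) * (1 + \<i>))"
        have "x \<noteq> of_real (t * (of_int n + s))" for n :: int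
        proof
          assume "x = of_real (t * (of_int n + s))"
          then have "t * (of_int n + s) = t * (real N + s + 1/2)" using segR[OF x] by (simp add: R_def)
          then have "of_int n + s = real N + s + 1/2" using t(1) by simp
          then have "(of_int (2 * n) :: real) = of_int (2 * int N + 1)" by simp
          then have "2 * n = 2 * int N + 1" by (simp only: of_int_eq_iff)
          then show False by presburger
        qed
        then show "0 < Re x \<and> (\<forall>n::int. x \<noteq> of_real (t * (of_int n + s)))"
          using segR[OF x] \<delta>R[of N] \<delta>(1)[of N] by auto
      qed
    qed
    show "\<forall>\<^sub>F N in sequentially. norm (contour_integral (linepath (of_real (R N) * (1 - \<i>)) (of_real (R N) * (1 + \<i>))) F) \<le> C * exp (- R N / 2) * (2 * R N)"
    proof (intro always_eventually allI)
      fix N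
      have "norm (contour_integral (linepath (of_real (R N) * (1 - \<i>)) (of_real (R N) * (1 + \<i>))) F) \<le>
          C * exp (- R N / 2) * norm (of_real (R N) * (1 + \<i>) - of_real (R N) * (1 - \<i>))"
        by (rule contour_integral_bound_linepath[OF ci _ bnd]) (use C in auto)
      also have "of_real (R N) * (1 + \<i>) - of_real (R N) * (1 - \<i>) = of_real (2 * R N) * \<i>" by (simp add: algebra_simps)
      also have "norm (of_real (2 * R N) * \<i>) = 2 * R N" using \<delta>R[of N] \<delta>(1)[of N] by (simp add: norm_mult)
      finally show "norm (contour_integral (linepath (of_real (R N) * (1 - \<i>)) (of_real (R N) * (1 + \<i>))) F) \<le> C * exp (- R N / 2) * (2 * R N)" .
    qed
    have "((\<lambda>y. C * exp (- y / 2) * (2 * y)) \<longlongrightarrow> 0) at_top" by real_asymp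
    then show "(\<lambda>N. C * exp (- R N / 2) * (2 * R N)) \<longlonglongrightarrow> 0" by (rule filterlim_compose[OF _ Rinf])
  qed
  have left: "(\<lambda>N. contour_integral (linepath (of_real (\<delta> N) * (1 + \<i>)) (of_real (\<delta> N) * (1 - \<i>))) F) \<longlonglongrightarrow> 0"
  proof (rule tendstoI)
    fix \<epsilon> :: real assume \<epsilon>: "\<epsilon> > 0"
    obtain c1 where c1: "c1 > 0" "\<forall>\<^sub>F x in at 0. norm (exp (2 * pi * \<i> * (x / complex_of_real t - complex_of_real s)) - 1) \<ge> c1 * norm x"
      using kernel_near_zero[OF t(1) s] by blast
    then obtain d1 where d1: "d1 > 0" "\<And>x. x \<noteq> 0 \<Longrightarrow> norm x < d1 \<Longrightarrow> norm (exp (2 * pi * \<i> * (x / complex_of_real t - complex_of_real s)) - 1) \<ge> c1 * norm x"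
      unfolding eventually_at by (auto simp: dist_norm)
    \<comment> \<open>On the left edge |Im x| < t, so exp (2 pi) bounds the numerator. The kernel is
      then at most \<epsilon> / (4 \<delta>) on an edge of length 2 \<delta>, leaving \<epsilon> /
      2.\<close>
    define \<eta> where "\<eta> = \<epsilon> * c1 / (4 * exp (2 * pi))"
    have \<eta>: "\<eta> > 0" using \<epsilon> c1(1) by (simp add: \<eta>_def)
    have "\<forall>\<^sub>F x in at 0 within sector. norm (G x) < \<eta>"
      using tendstoD[OF G0 \<eta>] by (simp add: dist_norm)
    then obtain d2 where d2: "d2 > 0" "\<And>x. x \<in> sector \<Longrightarrow> x \<noteq> 0 \<Longrightarrow> norm x < d2 \<Longrightarrow> norm (G x) < \<eta>"
      unfolding eventually_at by (auto simp: dist_norm)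
    have "\<forall>\<^sub>F N in sequentially. \<delta> N < min (min d1 d2 / 2) t"
      using \<delta>0 by (rule order_tendstoD) (use d1(1) d2(1) t(1) in auto)
    then show "\<forall>\<^sub>F N in sequentially. dist (contour_integral (linepath (of_real (\<delta> N) * (1 + \<i>)) (of_real (\<delta> N) * (1 - \<i>))) F) 0 < \<epsilon>"
    proof eventually_elim
      case (elim N)
      have bnd: "norm (F x) \<le> \<epsilon> / (4 * \<delta> N)" if x: "x \<in> closed_segment (of_real (\<delta> N) * (1 + \<i>)) (of_real (\<delta> N) * (1 - \<i>))" for x
      proof -
        have xs: "x \<in> sector" using segL[OF x] \<delta>(1)[of N] by (auto simp: sector_def)
        have x0: "x \<noteq> 0" using xs by (auto simp: sector_def)
        have "norm x \<le> 2 * \<delta> N" using norm_le_sector[OF xs] segL[OF x] by simp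
        then have nx: "norm x < d1" "norm x < d2" using elim by auto
        have xd: "\<delta> N \<le> norm x" using segL[OF x] complex_Re_le_cmod[of x] by simp
        have "c1 * \<delta> N \<le> c1 * norm x" using c1(1) xd by (intro mult_left_mono) auto
        also have "\<dots> \<le> norm (exp (2 * pi * \<i> * (x / complex_of_real t - complex_of_real s)) - 1)" by (rule d1(2)[OF x0 nx(1)])
        finally have den: "c1 * \<delta> N \<le> norm (exp (2 * pi * \<i> * (x / complex_of_real t - complex_of_real s)) - 1)" .
        have "- (\<theta> * Im x / t) \<le> 1"
        proof -
          have "\<bar>\<theta> * Im x / t\<bar> = \<theta> * (\<bar>Im x\<bar> / t)" using \<theta> t(1) by (simp add: abs_mult)
          also have "\<dots> \<le> 1 * 1" using \<theta> t(1) segL[OF x] elim by (intro mult_mono) (auto simp: divide_le_eq)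
          finally show ?thesis by linarith
        qed
        then have "2 * pi * (- (\<theta> * Im x / t)) \<le> 2 * pi * 1" by (intro mult_left_mono) auto
        then have num: "exp (- (2 * pi * \<theta> * Im x / t)) \<le> exp (2 * pi)" by simp
        have "norm (F x) = norm (G x) * exp (- (2 * pi * \<theta> * Im x / t)) / norm (exp (2 * pi * \<i> * (x / complex_of_real t - complex_of_real s)) - 1)"
          unfolding F_def contour_kernel_def norm_divide norm_mult[of "G x"] numer ..
        also have "\<dots> \<le> \<eta> * exp (2 * pi) / (c1 * \<delta> N)"
          using d2(2)[OF xs x0 nx(2)] num den \<eta> c1(1) \<delta>(1)[of N] by (intro frac_le mult_mono) auto
        also have "\<dots> = \<epsilon> / (4 * \<delta> N)" using c1(1) by (simp add: \<eta>_def)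
        finally show ?thesis .
      qed
      have ci: "F contour_integrable_on (linepath (of_real (\<delta> N) * (1 + \<i>)) (of_real (\<delta> N) * (1 - \<i>)))"
      proof (rule contour_integrable_continuous_linepath, rule holomorphic_on_imp_continuous_on)
        show "F holomorphic_on closed_segment (of_real (\<delta> N) * (1 + \<i>)) (of_real (\<delta> N) * (1 - \<i>))"
          unfolding F_def
        proof (rule contour_kernel_holomorphic[OF hol t(1)])
          fix x assume x: "x \<in> closed_segment (of_real (\<delta> N) * (1 + \<i>)) (of_real (\<delta> N) * (1 - \<i>))"
          have "x \<noteq> of_real (t * (of_int n + s))" for n :: int
          proof
            assume "x = of_real (t * (of_int n + s))"
            then have *: "\<delta> N = t * (of_int n + s)" using segL[OF x] by simp
            then have "0 < t * (of_int n + s)" "t * (of_int n + s) < t * s" using \<delta>[of N] by simp_all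
            then have "0 < of_int n + s" "of_int n + s < s" using t(1) by (simp_all add: zero_less_mult_iff)
            moreover from this have "real_of_int n < 0" by linarith
            then have "n \<le> -1" by simp
            then have "real_of_int n \<le> -1" by linarith
            ultimately show False using s by linarith
          qed
          then show "0 < Re x \<and> (\<forall>n::int. x \<noteq> of_real (t * (of_int n + s)))"
            using segL[OF x] \<delta>(1)[of N] by auto
        qed
      qed
      have "norm (contour_integral (linepath (of_real (\<delta> N) * (1 + \<i>)) (of_real (\<delta> N) * (1 - \<i>))) F) \<le>
          \<epsilon> / (4 * \<delta> N) * norm (of_real (\<delta> N) * (1 - \<i>) - of_real (\<delta> N) * (1 + \<i>))"
        by (rule contour_integral_bound_linepath[OF ci _ bnd]) (use \<epsilon> \<delta>(1)[of N] in auto)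
      also have "of_real (\<delta> N) * (1 - \<i>) - of_real (\<delta> N) * (1 + \<i>) = of_real (- (2 * \<delta> N)) * \<i>" by (simp add: algebra_simps)
      also have "norm (of_real (- (2 * \<delta> N)) * \<i>) = 2 * \<delta> N" using \<delta>(1)[of N] by (simp add: norm_mult)
      also have "\<epsilon> / (4 * \<delta> N) * (2 * \<delta> N) = \<epsilon> / 2" using \<delta>(1)[of N] by simp
      finally show ?case using \<epsilon> by simp
    qed
  qed
  have "(\<lambda>N. of_real t * (\<Sum>m\<le>N. cis (2 * pi * \<theta>) ^ m * G (of_real (t * (real m + s))))) \<longlonglongrightarrow>
     cnj (ray_part A s G (1 - \<theta>) t) - (- ray_part A s G \<theta> t) + 0 + 0"
  proof -
    have rp: "(\<lambda>N. (1 + \<i>) * cis (- (2 * pi * \<theta>' * s)) * U \<theta>' N) \<longlonglongrightarrow> ray_part A s G \<theta>' t" if "\<theta>' = \<theta> \<or> \<theta>' = 1 - \<theta>" for \<theta>'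
      unfolding ray_part_def f_def[symmetric] by (intro tendsto_mult_left U_lim that)
    have eq: "of_real t * (\<Sum>m\<le>N. cis (2 * pi * \<theta>) ^ m * G (of_real (t * (real m + s)))) =
      cnj ((1 + \<i>) * cis (- (2 * pi * (1 - \<theta>) * s)) * U (1 - \<theta>) N) - (- ((1 + \<i>) * cis (- (2 * pi * \<theta> * s)) * U \<theta> N)) +
      contour_integral (linepath (of_real (R N) * (1 - \<i>)) (of_real (R N) * (1 + \<i>))) F +
      contour_integral (linepath (of_real (\<delta> N) * (1 + \<i>)) (of_real (\<delta> N) * (1 - \<i>))) F" for N
      using finite_contour_sum[OF hol t(1) s \<delta>(1)[of N] \<delta>(2)[of N] R_def[of N], of \<theta>, folded F_def]
      unfolding low using up[OF \<theta>(1), of N, folded F_def] by (simp only:)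
    show ?thesis unfolding eq by (intro tendsto_intros rp left right) auto
  qed
  from tendsto_mult_left[OF this, of "1 / of_real t"]
  show ?thesis unfolding sums_def_le using t(1) by (simp add: add.commute)
qed

section \<open>Twisted sums\<close>

definition twisted_sum :: "nat \<Rightarrow> complex \<Rightarrow> real \<Rightarrow> complex \<Rightarrow> complex" where
  "twisted_sum k z s t = (\<Sum>m. z ^ m * summand k (of_real (real m + s) * t))"

definition twisted_sum' :: "nat \<Rightarrow> complex \<Rightarrow> real \<Rightarrow> complex \<Rightarrow> complex" where
  "twisted_sum' k z s t = (\<Sum>m. z ^ m * (of_real (real m + s) * summand' k (of_real (real m + s) * t)))"

text \<open>The exponential bound of the summand on a half-plane dominates the series locally by a
  geometric one. The differentiated series is handled by the termwise differentiation theorem,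
  without an estimate of its own.\<close>

lemma twisted_sum_aux:
  assumes z: "norm z = 1" and s: "s > 0" and t: "Re t > 0"
  shows "(\<lambda>m. z ^ m * summand k (of_real (real m + s) * t)) sums twisted_sum k z s t"
    and "(\<lambda>m. z ^ m * (of_real (real m + s) * summand' k (of_real (real m + s) * t))) sums twisted_sum' k z s t"
    and "(twisted_sum k z s has_field_derivative twisted_sum' k z s t) (at t)"
proof -
  define S where "S = {x::complex. Re x > 0}"
  have S: "open S" by (simp add: S_def open_halfspace_Re_gt)
  have "\<exists>g g'. \<forall>x \<in> S. ((\<lambda>m. z ^ m * summand k (of_real (real m + s) * x)) sums g x) \<and>
      ((\<lambda>m. z ^ m * (of_real (real m + s) * summand' k (of_real (real m + s) * x))) sums g' x) \<and>
      (g has_field_derivative g' x) (at x)"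
  proof (rule series_and_derivative_comparison_local[OF S])
    fix n x assume "x \<in> S"
    then have *: "Re (of_real (real n + s) * x) > 0" using s by (simp add: S_def add_nonneg_pos)
    have "((\<lambda>x. of_real (real n + s) * x) has_field_derivative of_real (real n + s)) (at x)"
      using DERIV_cmult[OF DERIV_ident, of "of_real (real n + s)" x] by simp
    from DERIV_chain2[OF has_field_derivative_summand[OF *] this, of k]
    show "((\<lambda>x. z ^ n * summand k (of_real (real n + s) * x)) has_field_derivative
       z ^ n * (of_real (real n + s) * summand' k (of_real (real n + s) * x))) (at x)"
      by (intro DERIV_cmult) (simp add: mult.commute)
  next
    fix x assume "x \<in> S"
    define \<rho> where "\<rho> = Re x / 2"
    have \<rho>: "\<rho> > 0" using \<open>x \<in> S\<close> by (simp add: S_def \<rho>_def)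
    obtain C where C: "C > 0" "\<And>x. Re x \<ge> s * \<rho> \<Longrightarrow> norm (summand k x) \<le> C * exp (- Re x)"
      using summand_bound[of "s * \<rho>" k] s \<rho> by auto
    define h where "h n = C * exp (-\<rho>) ^ n" for n
    have "summable h"
      unfolding h_def using \<rho> by (intro summable_mult summable_geometric) simp
    moreover have "norm (z ^ n * summand k (of_real (real n + s) * y)) \<le> h n" if y: "y \<in> ball x \<rho> \<inter> S" for n y
    proof -
      have "\<bar>Re x - Re y\<bar> < \<rho>"
        using y abs_Re_le_cmod[of "x - y"] by (auto simp: dist_norm)
      then have Ry: "Re y \<ge> \<rho>" by (simp add: \<rho>_def abs_if split: if_splits)
      have "s * \<rho> \<le> (real n + s) * Re y" using s Ry \<rho> by (intro mult_mono) auto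
      then have "norm (summand k (of_real (real n + s) * y)) \<le> C * exp (- Re (of_real (real n + s) * y))"
        by (intro C(2)) simp
      also have "\<dots> \<le> C * exp (- (real n * \<rho>))"
      proof -
        have "real n * \<rho> \<le> (real n + s) * Re y" using s Ry \<rho> by (intro mult_mono) auto
        then show ?thesis using C(1) by (intro mult_left_mono) auto
      qed
      also have "\<dots> = h n" by (simp add: h_def exp_of_nat_mult[symmetric])
      finally show ?thesis by (simp add: norm_mult norm_power z)
    qed
    ultimately show "\<exists>d h. 0 < d \<and> summable h \<and> (\<forall>\<^sub>F n in sequentially. \<forall>y\<in>ball x d \<inter> S. norm (z ^ n * summand k (of_real (real n + s) * y)) \<le> h n)"
      using \<rho> by (intro exI[of _ \<rho>] exI[of _ h]) auto
  qed
  then obtain g g' where gg0: "\<forall>x \<in> S. ((\<lambda>m. z ^ m * summand k (of_real (real m + s) * x)) sums g x) \<and>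
      ((\<lambda>m. z ^ m * (of_real (real m + s) * summand' k (of_real (real m + s) * x))) sums g' x) \<and>
      (g has_field_derivative g' x) (at x)"
    by (elim exE)
  note gg = bspec[OF gg0, THEN conjunct1] bspec[OF gg0, THEN conjunct2, THEN conjunct1]
    bspec[OF gg0, THEN conjunct2, THEN conjunct2]
  have g: "g y = twisted_sum k z s y" "g' y = twisted_sum' k z s y" if "y \<in> S" for y
    using gg(1,2)[OF that] by (simp_all add: twisted_sum_def twisted_sum'_def sums_iff)
  have x: "t \<in> S" using t by (simp add: S_def)
  show "(\<lambda>m. z ^ m * summand k (of_real (real m + s) * t)) sums twisted_sum k z s t"
    "(\<lambda>m. z ^ m * (of_real (real m + s) * summand' k (of_real (real m + s) * t))) sums twisted_sum' k z s t"
    using gg(1,2)[OF x] g[OF x] by simp_all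
  show "(twisted_sum k z s has_field_derivative twisted_sum' k z s t) (at t)"
    using has_field_derivative_transform_within_open[OF gg(3)[OF x] S x g(1)] g(2)[OF x] by simp
qed

text \<open>A normalising factor: the ray integral multiplied by it and by exp (2 \<mu> (1 - \<i>))
  converges. It is thus the reciprocal of the algebraic size of the integral.\<close>

definition amplitude :: "real \<Rightarrow> real \<Rightarrow> real \<Rightarrow> real" where
  "amplitude A \<kappa> \<mu> = (A / (2 * \<mu>)) powr (\<kappa> - 1) * sqrt \<mu>"

lemma sqrt_at_top: "B > 0 \<Longrightarrow> filterlim (\<lambda>t. sqrt (B / t)) at_top (at_right 0)"
  by real_asymp

lemma ray_part_limit:
  assumes A: "A > 0" and \<kappa>: "\<kappa> > 0" and \<theta>: "\<theta> > 0" and G: "admissible A \<kappa> c G"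
  shows "((\<lambda>t. of_real (amplitude A \<kappa> (sqrt (A * pi * \<theta> / t))) * exp (2 * of_real (sqrt (A * pi * \<theta> / t)) * (1 - \<i>)) * ray_part A s G \<theta> t)
     \<longlongrightarrow> (1 + \<i>) * cis (- (2 * pi * \<theta> * s)) * (c * complex_gauss)) (at_right 0)"
proof -
  have "norm (cis (- (2 * pi * s))) = 1" by simp
  note L = filterlim_compose[OF ray_laplace(2)[OF A \<kappa> \<theta> this G] sqrt_at_top[of "A * pi * \<theta>"]]
  have "((\<lambda>t. (1 + \<i>) * cis (- (2 * pi * \<theta> * s)) * (of_real ((A / (2 * sqrt (A * pi * \<theta> / t))) powr (\<kappa> - 1) * sqrt (sqrt (A * pi * \<theta> / t))) *
     exp (2 * of_real (sqrt (A * pi * \<theta> / t)) * (1 - \<i>)) *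
     (LINT r:{0<..}|lborel. ray_integrand A \<theta> (cis (- (2 * pi * s))) G (sqrt (A * pi * \<theta> / t)) r)))
     \<longlongrightarrow> (1 + \<i>) * cis (- (2 * pi * \<theta> * s)) * (c * complex_gauss)) (at_right 0)"
    by (rule tendsto_mult_left, rule L) (use A \<theta> in simp)
  then show ?thesis unfolding amplitude_def ray_part_def by (simp only: mult_ac)
qed

lemma complex_gauss_nonzero: "complex_gauss \<noteq> 0"
  using complex_gauss_polar by auto

text \<open>For \<open>\<theta> < 1/2\<close> the ray with the lower frequency \<open>\<theta>\<close> dominates the one with frequency \<open>1 - \<theta>\<close>.\<close>
lemma dominant_ray:
  assumes A: "A > 0" and \<kappa>: "\<kappa> > 0" and \<theta>: "0 < \<theta>" "\<theta> < 1 / 2" and G: "admissible A \<kappa> c G" and c: "c \<noteq> 0"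
  shows "\<forall>\<^sub>F t in at_right 0. ray_part A s G \<theta> t + cnj (ray_part A s G (1 - \<theta>) t) \<noteq> 0"
proof -
  define \<mu> \<nu> where "\<mu> t = sqrt (A * pi * \<theta> / t)" and "\<nu> t = sqrt (A * pi * (1 - \<theta>) / t)" for t
  define P where "P t = of_real (amplitude A \<kappa> (\<mu> t)) * exp (2 * of_real (\<mu> t) * (1 - \<i>))" for t
  define Q where "Q t = of_real (amplitude A \<kappa> (\<nu> t)) * exp (2 * of_real (\<nu> t) * (1 - \<i>))" for t
  define L where "L = (1 + \<i>) * cis (- (2 * pi * \<theta> * s)) * (c * complex_gauss)"
  have "1 + \<i> \<noteq> (0::complex)" by (simp add: complex_eq_iff)
  then have L0: "L \<noteq> 0" using c complex_gauss_nonzero by (simp add: L_def)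
  have l1: "((\<lambda>t. P t * ray_part A s G \<theta> t) \<longlongrightarrow> L) (at_right 0)"
    unfolding P_def \<mu>_def L_def by (rule ray_part_limit[OF A \<kappa> \<theta>(1) G])
  obtain L' where l2: "((\<lambda>t. Q t * ray_part A s G (1 - \<theta>) t) \<longlongrightarrow> L') (at_right 0)"
    unfolding Q_def \<nu>_def using ray_part_limit[OF A \<kappa> _ G, of "1 - \<theta>" s] \<theta> by auto
  \<comment> \<open>The ratio of the two Laplace parameters, constant in t and above 1 because
    \<theta> < 1/2. Normalising the second ray by P instead of Q costs a factor of order exp (- 2
    (\<rho> - 1) \<mu>), which tends to 0. Unequal moduli then exclude cancellation.\<close>
  define \<rho> where "\<rho> = sqrt ((1 - \<theta>) / \<theta>)"
  have \<rho>: "\<rho> > 1" using \<theta> by (simp add: \<rho>_def)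
  have pos: "\<forall>\<^sub>F t::real in at_right 0. t > 0" by (rule eventually_at_right_less)
  have \<nu>\<mu>: "\<nu> t = \<rho> * \<mu> t" for t
    unfolding \<nu>_def \<mu>_def \<rho>_def real_sqrt_mult[symmetric] using \<theta> by simp
  have ratio: "((\<lambda>t. norm (P t / Q t)) \<longlongrightarrow> 0) (at_right 0)"
  proof -
    have m: "filterlim \<mu> at_top (at_right 0)"
      unfolding \<mu>_def using A \<theta> by (intro sqrt_at_top) simp
    have "((\<lambda>x. \<rho> powr (\<kappa> - 1) / sqrt \<rho> * exp (- (2 * (\<rho> - 1)) * x)) \<longlongrightarrow> 0) at_top"
      using \<rho> by real_asymp
    from filterlim_compose[OF this m]
    have "((\<lambda>t. \<rho> powr (\<kappa> - 1) / sqrt \<rho> * exp (- (2 * (\<rho> - 1)) * \<mu> t)) \<longlongrightarrow> 0) (at_right 0)" .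
    moreover have "\<forall>\<^sub>F t in at_right 0. \<rho> powr (\<kappa> - 1) / sqrt \<rho> * exp (- (2 * (\<rho> - 1)) * \<mu> t) = norm (P t / Q t)"
      using pos
    proof eventually_elim
      case (elim t)
      have m0: "\<mu> t > 0" using elim A \<theta> by (simp add: \<mu>_def)
      have am: "amplitude A \<kappa> x \<ge> 0" if "x > 0" for x using that by (simp add: amplitude_def)
      have nP: "norm (of_real (amplitude A \<kappa> x) * exp (2 * of_real x * (1 - \<i>))) = amplitude A \<kappa> x * exp (2 * x)" if "x > 0" for x
        using am[OF that] by (simp add: norm_mult norm_exp_eq_Re)
      have a: "amplitude A \<kappa> (\<nu> t) = amplitude A \<kappa> (\<mu> t) / (\<rho> powr (\<kappa> - 1) / sqrt \<rho>)"
      proof -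
        have "A / (2 * \<nu> t) = (A / (2 * \<mu> t)) / \<rho>" by (simp add: \<nu>\<mu>)
        then have "(A / (2 * \<nu> t)) powr (\<kappa> - 1) = (A / (2 * \<mu> t)) powr (\<kappa> - 1) / \<rho> powr (\<kappa> - 1)"
          using A m0 \<rho> by (simp only: powr_divide)
        then show ?thesis unfolding amplitude_def by (simp add: \<nu>\<mu> real_sqrt_mult)
      qed
      have ap: "amplitude A \<kappa> (\<mu> t) > 0" using A m0 by (simp add: amplitude_def)
      have "norm (P t / Q t) = (amplitude A \<kappa> (\<mu> t) * exp (2 * \<mu> t)) / (amplitude A \<kappa> (\<nu> t) * exp (2 * \<nu> t))"
        unfolding P_def Q_def norm_divide using nP[OF m0] nP[of "\<nu> t"] m0 \<rho> by (simp add: \<nu>\<mu>)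
      also have "\<dots> = \<rho> powr (\<kappa> - 1) / sqrt \<rho> * (exp (2 * \<mu> t) / exp (2 * \<nu> t))"
        unfolding a using ap by simp
      also have "exp (2 * \<mu> t) / exp (2 * \<nu> t) = exp (- (2 * (\<rho> - 1)) * \<mu> t)"
        unfolding exp_diff[symmetric] \<nu>\<mu> by (simp add: algebra_simps)
      finally show ?case by simp
    qed
    ultimately show ?thesis by (simp only: tendsto_cong)
  qed
  have "((\<lambda>t. norm (P t / Q t) * norm (Q t * ray_part A s G (1 - \<theta>) t)) \<longlongrightarrow> 0 * norm L') (at_right 0)"
    by (intro tendsto_mult ratio tendsto_norm l2)
  then have small: "((\<lambda>t. norm (P t / Q t) * norm (Q t * ray_part A s G (1 - \<theta>) t)) \<longlongrightarrow> 0) (at_right 0)" by simp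
  have "\<forall>\<^sub>F t in at_right 0. norm (P t * ray_part A s G \<theta> t) > norm L / 2"
    using tendsto_norm[OF l1] by (rule order_tendstoD) (use L0 in simp)
  moreover have "\<forall>\<^sub>F t in at_right 0. norm (P t / Q t) * norm (Q t * ray_part A s G (1 - \<theta>) t) < norm L / 2"
    using small by (rule order_tendstoD) (use L0 in simp)
  ultimately show ?thesis using pos
  proof eventually_elim
    case (elim t)
    have "Q t \<noteq> 0" using elim(3) A \<theta> by (simp add: Q_def amplitude_def \<nu>_def)
    then have "norm (P t) * norm (ray_part A s G (1 - \<theta>) t) < norm L / 2"
      using elim(2) by (simp add: norm_mult norm_divide)
    moreover have "norm (P t) * norm (ray_part A s G \<theta> t) > norm L / 2"
      using elim(1) by (simp add: norm_mult)
    ultimately have "norm (ray_part A s G (1 - \<theta>) t) \<noteq> norm (ray_part A s G \<theta> t)" by auto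
    then show ?case by (metis complex_mod_cnj add_eq_0_iff2 norm_minus_cancel)
  qed
qed

lemma twisted_sum_eq_ray_parts:
  assumes A: "A > 0" and \<kappa>: "\<kappa> > 0" and G: "admissible A \<kappa> c (summand k)" and \<theta>: "0 < \<theta>" "\<theta> < 1" and s: "0 < s" "s \<le> 1"
  shows "\<forall>\<^sub>F t in at_right 0. twisted_sum k (cis (2 * pi * \<theta>)) s (of_real t) =
    (ray_part A s (summand k) \<theta> t + cnj (ray_part A s (summand k) (1 - \<theta>) t)) / of_real t"
proof -
  have "\<forall>\<^sub>F t::real in at_right 0. t > 0" by (rule eventually_at_right_less)
  moreover have "\<forall>\<^sub>F t::real in at_right 0. t < A * pi * \<theta>" "\<forall>\<^sub>F t::real in at_right 0. t < A * pi * (1 - \<theta>)"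
    using A \<theta> by (auto intro!: order_tendstoD(2)[OF tendsto_ident_at])
  ultimately show ?thesis
  proof eventually_elim
    case (elim t)
    have "(\<lambda>m. cis (2 * pi * \<theta>) ^ m * summand k (of_real (t * (real m + s)))) sums
     ((ray_part A s (summand k) \<theta> t + cnj (ray_part A s (summand k) (1 - \<theta>) t)) / of_real t)"
      by (rule admissible_sum[OF A \<kappa> G \<theta> s]) (use elim in auto)
    then show ?case unfolding twisted_sum_def by (simp add: sums_iff mult.commute)
  qed
qed

lemma twisted_sum_nonzero:
  assumes k: "k \<ge> 1" and z: "norm z = 1" "z \<noteq> - 1"
  shows "\<forall>\<^sub>F t in at_right 0. twisted_sum k z 1 (of_real t) \<noteq> 0"
proof (cases "z = 1")
  case True
  have "\<forall>\<^sub>F t::real in at_right 0. t > 0" by (rule eventually_at_right_less)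
  then show ?thesis
  proof eventually_elim
    case (elim t)
    have s: "(\<lambda>m. Re (z ^ m * summand k (of_real (real m + 1) * of_real t))) sums Re (twisted_sum k z 1 (of_real t))"
      by (intro sums_Re twisted_sum_aux z) (use elim in auto)
    have pos: "Re (z ^ m * summand k (of_real (real m + 1) * of_real t)) > 0" for m
      using summand_of_real_pos[of "(real m + 1) * t" k] elim by (auto simp: True add_nonneg_pos)
    have "Re (twisted_sum k z 1 (of_real t)) > 0"
      using suminf_pos[OF sums_summable[OF s] pos] s by (simp add: sums_iff)
    then show ?case by auto
  qed
next
  case False
  define A where "A = real k * pi\<^sup>2 / 6"
  have A: "A > 0" using k by (simp add: A_def)
  have \<kappa>: "real k / 2 > 0" using k by simp
  obtain c0 where c0: "c0 > 0" "admissible A (real k / 2) (of_real c0 * cis (- (real k * pi / 8))) (summand k)"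
    using admissible_summand[OF k A_def] by blast
  have c: "of_real c0 * cis (- (real k * pi / 8)) \<noteq> 0" using c0(1) by simp
  define \<theta> where "\<theta> = Arg2pi z / (2 * pi)"
  have z_eq: "z = cis (2 * pi * \<theta>)"
    using Arg2pi_eq[of z] z(1) by (simp add: \<theta>_def cis_conv_exp mult.commute)
  have "0 \<le> \<theta>" "\<theta> < 1" using Arg2pi[of z] by (auto simp: \<theta>_def)
  moreover have "\<theta> \<noteq> 0" using False z_eq by auto
  ultimately have \<theta>: "0 < \<theta>" "\<theta> < 1" by auto
  have half: "\<theta> \<noteq> 1 / 2"
  proof
    assume "\<theta> = 1 / 2"
    then have e: "2 * pi * \<theta> = pi" by simp
    show False using z(2) unfolding z_eq e by simp
  qed
  have "\<forall>\<^sub>F t in at_right 0. ray_part A 1 (summand k) \<theta> t + cnj (ray_part A 1 (summand k) (1 - \<theta>) t) \<noteq> 0"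
  proof (cases "\<theta> < 1 / 2")
    case True
    then show ?thesis by (rule dominant_ray[OF A \<kappa> \<theta>(1) _ c0(2) c])
  next
    case False
    \<comment> \<open>Replacing \<theta> by 1 - \<theta> conjugates the sum of the two ray parts, so
      the case above 1/2 follows from the case below it.\<close>
    then have "0 < 1 - \<theta>" "1 - \<theta> < 1 / 2" using \<theta> half by auto
    have th: "1 - (1 - \<theta>) = \<theta>" by simp
    from dominant_ray[OF A \<kappa> \<open>0 < 1 - \<theta>\<close> \<open>1 - \<theta> < 1 / 2\<close> c0(2) c, of 1, unfolded th]
    show ?thesis
    proof eventually_elim
      case (elim t)
      have "cnj (x + cnj y) = y + cnj x" for x y :: complex by simp
      then show ?case using elim by (metis complex_cnj_zero_iff)
    qed
  qed
  moreover have "\<forall>\<^sub>F t::real in at_right 0. t > 0" by (rule eventually_at_right_less)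
  ultimately show ?thesis
    using twisted_sum_eq_ray_parts[OF A \<kappa> c0(2) \<theta> zero_less_one order_refl]
  proof eventually_elim
    case (elim t)
    show ?case unfolding z_eq elim(3) using elim(1,2) by (simp only: divide_eq_0_iff of_real_eq_0_iff) simp
  qed
qed

section \<open>Asymptotics at the root z = -1\<close>

lemma Theta_eq: "Theta k t = pi powr (3 / 2) * sqrt (real k / 3) / sqrt t"
  unfolding Theta_def times_divide_eq_right[symmetric] real_sqrt_divide[symmetric]
  by (simp add: divide_divide_eq_left)

lemma Theta_squared:
  assumes "t > 0"
  shows "(Theta k t)\<^sup>2 = pi ^ 3 * real k / (3 * t)"
proof -
  have "(pi powr (3 / 2))\<^sup>2 = pi powr (real 3)" by (simp add: powr_power)
  also have "\<dots> = pi ^ 3" by (simp only: powr_realpow[OF pi_gt_zero])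
  finally show ?thesis using assms by (simp add: Theta_def power_mult_distrib)
qed

lemma Theta_pos: "k \<ge> 1 \<Longrightarrow> t > 0 \<Longrightarrow> Theta k t > 0"
  by (simp add: Theta_def)

text \<open>Identifies the Laplace parameter at frequency 1/2: the exponent 2 \<mu> is
  \<open>Theta k t\<close>, so the saddle contributes decay exp (- Theta) and rotation cis
  Theta.\<close>

lemma half_frequency:
  assumes "k \<ge> 1" "t > 0"
  shows "sqrt (real k * pi\<^sup>2 / 6 * pi * (1 / 2) / t) = Theta k t / 2"
proof (rule real_sqrt_unique)
  show "(Theta k t / 2)\<^sup>2 = real k * pi\<^sup>2 / 6 * pi * (1 / 2) / t"
    unfolding power_divide Theta_squared[OF assms(2)] by (simp add: power2_eq_square power3_eq_cube)
  show "0 \<le> Theta k t / 2" using Theta_pos[OF assms] by simp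
qed

text \<open>At \<theta> = 1/2 both rays have the same frequency, so the sum is twice the real part
  of one ray part. The rotation by Theta has no limit and is kept outside Z, which is the normalised
  and convergent factor.\<close>

lemma half_sum:
  assumes k: "k \<ge> 1" and A_def: "A = real k * pi\<^sup>2 / 6" and \<kappa>: "\<kappa> > 0" and G: "admissible A \<kappa> c G" and s: "0 < s" "s \<le> 1"
  shows "\<exists>Z. (Z \<longlongrightarrow> (1 + \<i>) * cis (- (pi * s)) * (c * complex_gauss)) (at_right 0) \<and>
     (\<forall>\<^sub>F t in at_right 0. (\<lambda>m. (- 1) ^ m * G (of_real (t * (real m + s)))) sums
        of_real (2 * Re (cis (Theta k t) * Z t) / (t * amplitude A \<kappa> (Theta k t / 2) * exp (Theta k t))))"
proof -
  have A: "A > 0" using k by (simp add: A_def)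
  define Z where "Z t = of_real (amplitude A \<kappa> (sqrt (A * pi * (1/2) / t))) * exp (2 * of_real (sqrt (A * pi * (1/2) / t)) * (1 - \<i>)) * ray_part A s G (1/2) t" for t
  have "(Z \<longlongrightarrow> (1 + \<i>) * cis (- (2 * pi * (1/2) * s)) * (c * complex_gauss)) (at_right 0)"
    unfolding Z_def by (rule ray_part_limit[OF A \<kappa> _ G]) simp
  then have Z: "(Z \<longlongrightarrow> (1 + \<i>) * cis (- (pi * s)) * (c * complex_gauss)) (at_right 0)" by simp
  have "\<forall>\<^sub>F t::real in at_right 0. t > 0" by (rule eventually_at_right_less)
  moreover have "\<forall>\<^sub>F t::real in at_right 0. t < A * pi * (1 / 2)"
    by (rule order_tendstoD(2)[OF tendsto_ident_at]) (use A in simp)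
  ultimately have "\<forall>\<^sub>F t in at_right 0. (\<lambda>m. (- 1) ^ m * G (of_real (t * (real m + s)))) sums
        of_real (2 * Re (cis (Theta k t) * Z t) / (t * amplitude A \<kappa> (Theta k t / 2) * exp (Theta k t)))"
  proof eventually_elim
    case (elim t)
    have th: "sqrt (A * pi * (1/2) / t) = Theta k t / 2" unfolding A_def by (rule half_frequency[OF k elim(1)])
    define am where "am = amplitude A \<kappa> (Theta k t / 2)"
    have am: "am > 0" using Theta_pos[OF k elim(1)] A by (simp add: am_def amplitude_def)
    define ra where "ra = ray_part A s G (1/2) t"
    have "Z t = of_real am * exp (2 * of_real (Theta k t / 2) * (1 - \<i>)) * ra"
      unfolding Z_def th am_def ra_def ..
    also have "exp (2 * of_real (Theta k t / 2) * (1 - \<i>)) = of_real (exp (Theta k t)) * cis (- Theta k t)"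
      unfolding exp_of_real[symmetric] cis_conv_exp exp_add[symmetric] by (simp add: algebra_simps)
    finally have "cis (Theta k t) * Z t = of_real (am * exp (Theta k t)) * ra * (cis (Theta k t) * cis (- Theta k t))" by simp
    also have "cis (Theta k t) * cis (- Theta k t) = 1" by (simp add: cis_mult)
    finally have "Re (cis (Theta k t) * Z t) = am * exp (Theta k t) * Re ra" by simp
    then have r: "2 * Re ra / t = 2 * Re (cis (Theta k t) * Z t) / (t * am * exp (Theta k t))"
      using am by simp
    have "(\<lambda>m. cis (2 * pi * (1/2)) ^ m * G (of_real (t * (real m + s)))) sums ((ra + cnj (ray_part A s G (1 - 1/2) t)) / of_real t)"
      unfolding ra_def by (rule admissible_sum[OF A \<kappa> G _ _ s]) (use elim in auto)
    moreover have "ra + cnj (ray_part A s G (1 - 1/2) t) = of_real (2 * Re ra)"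
      unfolding ra_def by (simp add: complex_eq_iff)
    ultimately have "(\<lambda>m. (- 1) ^ m * G (of_real (t * (real m + s)))) sums of_real (2 * Re ra / t)" by simp
    then show ?case unfolding r am_def .
  qed
  with Z show ?thesis by blast
qed

text \<open>The reciprocal, up to a constant, of the size of the sums at z = -1. The exponent of t
  adds 1 from the factor t, k/4 - 1/2 from the power k/2 - 1 of the saddle radius, and - 1/4 from
  sqrt \<mu>.\<close>

definition half_weight :: "nat \<Rightarrow> real \<Rightarrow> real" where
  "half_weight k t = t powr (real k / 4 + 1 / 4) * exp (Theta k t)"

lemma half_weight_pos: "t > 0 \<Longrightarrow> half_weight k t > 0"
  by (simp add: half_weight_def)

lemma amplitude_half_weight:
  assumes k: "k \<ge> 1" and A: "A > 0"
  shows "\<exists>K>0. \<forall>t>0. t * amplitude A (real k / 2) (Theta k t / 2) * exp (Theta k t) = K * half_weight k t"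
proof -
  define C where "C = pi powr (3 / 2) * sqrt (real k / 3)"
  have C: "C > 0" using k by (simp add: C_def)
  define K where "K = (A / C) powr (real k / 2 - 1) * sqrt (C / 2)"
  have "t * amplitude A (real k / 2) (Theta k t / 2) * exp (Theta k t) = K * half_weight k t" if t: "t > 0" for t
  proof -
    have th: "Theta k t = C / sqrt t" by (simp add: Theta_eq C_def)
    have s: "sqrt t = t powr (1 / 2)" using t by (simp add: powr_half_sqrt)
    have "A / (2 * (Theta k t / 2)) = (A / C) * t powr (1/2)" using C t by (simp add: th s)
    then have p1: "(A / (2 * (Theta k t / 2))) powr (real k / 2 - 1) = (A / C) powr (real k / 2 - 1) * t powr (1/2 * (real k / 2 - 1))"
      by (simp only: powr_mult powr_powr)
    have p2: "sqrt (Theta k t / 2) = sqrt (C / 2) * t powr (- (1/4))"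
    proof -
      have "sqrt (sqrt t) = t powr (1/4)" using t by (simp add: powr_half_sqrt[symmetric] powr_powr)
      then have "sqrt (C / 2) * t powr (- (1/4)) = sqrt (C / 2) / sqrt (sqrt t)" using t by (simp add: powr_minus_divide)
      also have "\<dots> = sqrt ((C / 2) / sqrt t)" by (simp only: real_sqrt_divide)
      also have "(C / 2) / sqrt t = Theta k t / 2" by (simp add: th)
      finally show ?thesis ..
    qed
    have "t powr 1 * (t powr (1/2 * (real k / 2 - 1)) * t powr (- (1/4))) = t powr (real k / 4 + 1 / 4)"
      unfolding powr_add[symmetric] by (rule arg_cong[where f="\<lambda>x. t powr x"]) (simp add: algebra_simps)
    then have "t * (t powr (1/2 * (real k / 2 - 1)) * t powr (- (1/4))) = t powr (real k / 4 + 1 / 4)" using t by simp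
    note tp = this
    have "t' * ((\<alpha> * x) * (\<beta> * y)) * e = \<alpha> * \<beta> * (t' * (x * y) * e)" for t' \<alpha> \<beta> x y e :: real
      by (simp only: mult_ac)
    then show ?thesis
      unfolding amplitude_def p1 p2 half_weight_def K_def tp[symmetric] by (simp only:)
  qed
  moreover have "K > 0" using A C by (simp add: K_def)
  ultimately show ?thesis by blast
qed

text \<open>One constant B serves all shifts s and the derivative, so it will cancel in quotients.
  The phase comes from pi/4 - k pi/8 + pi/8 = - \<open>phase_shift k\<close>. The derivative
  inherits the extra factor A (1 - \<i>) / 2 of its admissible constant, which rotates its phase by
  - pi/4 against the sum itself.\<close>

lemma half_asymptotics_complex:
  assumes k: "k \<ge> 1"
  shows "\<exists>B>0. (\<forall>s. 0 < s \<and> s \<le> 1 \<longrightarrow> (\<exists>X. (X \<longlongrightarrow> of_real B * cis (- phase_shift k - pi * s)) (at_right 0) \<and>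
        (\<forall>\<^sub>F t in at_right 0. twisted_sum k (- 1) s (of_real t) = of_real (Re (cis (Theta k t) * X t) / half_weight k t)))) \<and>
     (\<exists>Y. (Y \<longlongrightarrow> - (of_real (B / 2) * cis (- phase_shift k) * (1 - \<i>))) (at_right 0) \<and>
        (\<forall>\<^sub>F t in at_right 0. twisted_sum' k (- 1) 1 (of_real t) = of_real (Theta k t * Re (cis (Theta k t) * Y t) / (half_weight k t * t))))"
proof -
  define A where "A = real k * pi\<^sup>2 / 6"
  have A: "A > 0" using k by (simp add: A_def)
  have \<kappa>: "real k / 2 > 0" "real k / 2 + 1 > 0" using k by auto
  obtain c0 where c0: "c0 > 0" and G: "admissible A (real k / 2) (of_real c0 * cis (- (real k * pi / 8))) (summand k)"
    and G': "admissible A (real k / 2 + 1) (of_real c0 * cis (- (real k * pi / 8)) * (of_real A * (1 - \<i>) / 2)) (\<lambda>x. x * summand' k x)"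
    using admissible_summand[OF k A_def] by blast
  obtain \<gamma> where \<gamma>: "\<gamma> > 0" "complex_gauss = of_real \<gamma> * cis (pi / 8)" using complex_gauss_polar by blast
  obtain K where K: "K > 0" "\<And>t. t > 0 \<Longrightarrow> t * amplitude A (real k / 2) (Theta k t / 2) * exp (Theta k t) = K * half_weight k t"
    using amplitude_half_weight[OF k A] by blast
  define B where "B = 2 * (sqrt 2 * c0 * \<gamma>) / K"
  have B: "B > 0" using c0 \<gamma>(1) K(1) by (simp add: B_def)
  have i1: "1 + \<i> = of_real (sqrt 2) * cis (pi / 4)" by (simp add: complex_eq_iff cos_45 sin_45)
  have const: "of_real (2 / K) * ((1 + \<i>) * cis (- (pi * s)) * ((of_real c0 * cis (- (real k * pi / 8))) * complex_gauss)) = of_real B * cis (- phase_shift k - pi * s)" for s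
  proof -
    have "of_real (2 / K) * ((1 + \<i>) * cis (- (pi * s)) * ((of_real c0 * cis (- (real k * pi / 8))) * complex_gauss)) =
      of_real B * (cis (pi / 4) * cis (- (pi * s)) * cis (- (real k * pi / 8)) * cis (pi / 8))"
      unfolding i1 \<gamma>(2) B_def by simp
    also have "cis (pi / 4) * cis (- (pi * s)) * cis (- (real k * pi / 8)) * cis (pi / 8) = cis (- phase_shift k - pi * s)"
      unfolding cis_mult by (rule arg_cong[where f=cis]) (simp add: phase_shift_def field_simps)
    finally show ?thesis .
  qed
  have pos: "\<forall>\<^sub>F t::real in at_right 0. t > 0" by (rule eventually_at_right_less)
  have part1: "\<exists>X. (X \<longlongrightarrow> of_real B * cis (- phase_shift k - pi * s)) (at_right 0) \<and>
        (\<forall>\<^sub>F t in at_right 0. twisted_sum k (- 1) s (of_real t) = of_real (Re (cis (Theta k t) * X t) / half_weight k t))"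
    if s: "0 < s" "s \<le> 1" for s
  proof -
    obtain Z where Z: "(Z \<longlongrightarrow> (1 + \<i>) * cis (- (pi * s)) * ((of_real c0 * cis (- (real k * pi / 8))) * complex_gauss)) (at_right 0)"
      and ev: "\<forall>\<^sub>F t in at_right 0. (\<lambda>m. (- 1) ^ m * summand k (of_real (t * (real m + s)))) sums
        of_real (2 * Re (cis (Theta k t) * Z t) / (t * amplitude A (real k / 2) (Theta k t / 2) * exp (Theta k t)))"
      using half_sum[OF k A_def \<kappa>(1) G s] by blast
    have "((\<lambda>t. of_real (2 / K) * Z t) \<longlongrightarrow> of_real B * cis (- phase_shift k - pi * s)) (at_right 0)"
      unfolding const[symmetric] by (intro tendsto_mult_left Z)
    moreover have "\<forall>\<^sub>F t in at_right 0. twisted_sum k (- 1) s (of_real t) = of_real (Re (cis (Theta k t) * (of_real (2 / K) * Z t)) / half_weight k t)"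
      using ev pos
    proof eventually_elim
      case (elim t)
      have "twisted_sum k (- 1) s (of_real t) = of_real (2 * Re (cis (Theta k t) * Z t) / (K * half_weight k t))"
        using elim(1) unfolding twisted_sum_def K(2)[OF elim(2)] by (simp add: sums_iff mult.commute)
      moreover have "cis (Theta k t) * (of_real (2 / K) * Z t) = of_real (2 / K) * (cis (Theta k t) * Z t)" by (simp only: mult_ac)
      then have "Re (cis (Theta k t) * (of_real (2 / K) * Z t)) = 2 / K * Re (cis (Theta k t) * Z t)"
        by (simp only: Re_complex_of_real times_complex.sel Im_complex_of_real)
      ultimately show ?case by simp
    qed
    ultimately show ?thesis by blast
  qed
  have part2: "\<exists>Y. (Y \<longlongrightarrow> - (of_real (B / 2) * cis (- phase_shift k) * (1 - \<i>))) (at_right 0) \<and>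
        (\<forall>\<^sub>F t in at_right 0. twisted_sum' k (- 1) 1 (of_real t) = of_real (Theta k t * Re (cis (Theta k t) * Y t) / (half_weight k t * t)))"
  proof -
    obtain Z where Z: "(Z \<longlongrightarrow> (1 + \<i>) * cis (- (pi * 1)) * ((of_real c0 * cis (- (real k * pi / 8)) * (of_real A * (1 - \<i>) / 2)) * complex_gauss)) (at_right 0)"
      and ev: "\<forall>\<^sub>F t in at_right 0. (\<lambda>m. (- 1) ^ m * (of_real (t * (real m + 1)) * summand' k (of_real (t * (real m + 1))))) sums
        of_real (2 * Re (cis (Theta k t) * Z t) / (t * amplitude A (real k / 2 + 1) (Theta k t / 2) * exp (Theta k t)))"
      using half_sum[OF k A_def \<kappa>(2) G', of 1] by auto
    define Y where "Y t = of_real (2 / (A * K)) * Z t" for t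
    have "of_real (2 / (A * K)) * ((1 + \<i>) * cis (- (pi * 1)) * ((of_real c0 * cis (- (real k * pi / 8)) * (of_real A * (1 - \<i>) / 2)) * complex_gauss))
      = (of_real (2 / K) * ((1 + \<i>) * cis (- (pi * 1)) * ((of_real c0 * cis (- (real k * pi / 8))) * complex_gauss))) * ((1 - \<i>) / 2)"
      using A by simp
    also have "\<dots> = of_real B * cis (- phase_shift k - pi * 1) * ((1 - \<i>) / 2)" unfolding const ..
    also have "cis (- phase_shift k - pi * 1) = - cis (- phase_shift k)" by (simp add: complex_eq_iff)
    also have "of_real B * (- cis (- phase_shift k)) * ((1 - \<i>) / 2) = - (of_real (B / 2) * cis (- phase_shift k) * (1 - \<i>))" by simp
    finally have lim: "of_real (2 / (A * K)) * ((1 + \<i>) * cis (- (pi * 1)) * ((of_real c0 * cis (- (real k * pi / 8)) * (of_real A * (1 - \<i>) / 2)) * complex_gauss)) = - (of_real (B / 2) * cis (- phase_shift k) * (1 - \<i>))" .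
    have "(Y \<longlongrightarrow> - (of_real (B / 2) * cis (- phase_shift k) * (1 - \<i>))) (at_right 0)"
      unfolding Y_def lim[symmetric] by (intro tendsto_mult_left Z)
    moreover have "\<forall>\<^sub>F t in at_right 0. twisted_sum' k (- 1) 1 (of_real t) = of_real (Theta k t * Re (cis (Theta k t) * Y t) / (half_weight k t * t))"
      using ev pos
    proof eventually_elim
      case (elim t)
      have th: "Theta k t > 0" by (rule Theta_pos[OF k elim(2)])
      have wp: "half_weight k t > 0" by (rule half_weight_pos[OF elim(2)])
      \<comment> \<open>Raising the exponent \<kappa> by one multiplies the normalisation by the
        saddle radius A / Theta. This is the source of the relative growth Theta / t of the
        derivative.\<close>
      have am: "amplitude A (real k / 2 + 1) (Theta k t / 2) = amplitude A (real k / 2) (Theta k t / 2) * (A / Theta k t)"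
      proof -
        have "(A / Theta k t) powr (real k / 2) = (A / Theta k t) powr (real k / 2 - 1 + 1)" by simp
        also have "\<dots> = (A / Theta k t) powr (real k / 2 - 1) * (A / Theta k t)" unfolding powr_add using A th by simp
        finally show ?thesis unfolding amplitude_def by simp
      qed
      have w: "t * amplitude A (real k / 2 + 1) (Theta k t / 2) * exp (Theta k t) = K * half_weight k t * (A / Theta k t)"
        unfolding am K(2)[OF elim(2), symmetric] by simp
      have "(\<lambda>m. of_real t * ((- 1) ^ m * (of_real (real m + 1) * summand' k (of_real (real m + 1) * of_real t)))) sums (of_real t * twisted_sum' k (- 1) 1 (of_real t))"
        by (intro sums_mult twisted_sum_aux(2)) (use elim(2) in auto)
      then have "(\<lambda>m. (- 1) ^ m * (of_real (t * (real m + 1)) * summand' k (of_real (t * (real m + 1))))) sums (of_real t * twisted_sum' k (- 1) 1 (of_real t))"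
        by (simp add: mult_ac)
      with elim(1) have e: "of_real t * twisted_sum' k (- 1) 1 (of_real t) = of_real (2 * Re (cis (Theta k t) * Z t) / (K * half_weight k t * (A / Theta k t)))"
        unfolding w using sums_unique2 by blast
      have "cis (Theta k t) * Y t = of_real (2 / (A * K)) * (cis (Theta k t) * Z t)" unfolding Y_def by (simp only: mult_ac)
      then have "Re (cis (Theta k t) * Y t) = 2 / (A * K) * Re (cis (Theta k t) * Z t)"
        by (simp only: Re_complex_of_real times_complex.sel Im_complex_of_real)
      then have r: "Theta k t * Re (cis (Theta k t) * Y t) / (half_weight k t * t) = 2 * Re (cis (Theta k t) * Z t) / (K * half_weight k t * (A / Theta k t)) / t"
        by (simp only:) (simp add: mult_ac)
      have "twisted_sum' k (- 1) 1 (of_real t) = of_real t * twisted_sum' k (- 1) 1 (of_real t) / of_real t" using elim(2) by simp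
      also have "\<dots> = of_real (2 * Re (cis (Theta k t) * Z t) / (K * half_weight k t * (A / Theta k t)) / t)"
        unfolding e by simp
      finally show ?case unfolding r .
    qed
    ultimately show ?thesis by blast
  qed
  show ?thesis
  proof (rule exI[of _ B], rule conjI[OF B], rule conjI[OF _ part2], rule allI, rule impI)
    fix s :: real assume "0 < s \<and> s \<le> 1"
    then show "\<exists>X. (X \<longlongrightarrow> of_real B * cis (- phase_shift k - pi * s)) (at_right 0) \<and>
        (\<forall>\<^sub>F t in at_right 0. twisted_sum k (- 1) s (of_real t) = of_real (Re (cis (Theta k t) * X t) / half_weight k t))"
      by (elim conjE) (rule part1)
  qed
qed

text \<open>The rotating factor has no limit, so only the difference of real parts can converge;
  modulus 1 passes the error of X through unchanged.\<close>

lemma cis_perturbation: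
  fixes X :: "real \<Rightarrow> complex"
  assumes "(X \<longlongrightarrow> L) F"
  shows "((\<lambda>t. Re (cis (\<tau> t) * X t) - Re (cis (\<tau> t) * L)) \<longlongrightarrow> 0) F"
proof (rule Lim_null_comparison)
  show "((\<lambda>t. norm (X t - L)) \<longlongrightarrow> 0) F"
    using tendsto_norm_zero[OF LIM_zero[OF assms]] .
  show "\<forall>\<^sub>F t in F. norm (Re (cis (\<tau> t) * X t) - Re (cis (\<tau> t) * L)) \<le> norm (X t - L)"
  proof (intro always_eventually allI)
    fix t
    have e: "Re (cis (\<tau> t) * X t) - Re (cis (\<tau> t) * L) = Re (cis (\<tau> t) * (X t - L))"
      unfolding right_diff_distrib by (rule minus_complex.sel(1)[symmetric])
    show "norm (Re (cis (\<tau> t) * X t) - Re (cis (\<tau> t) * L)) \<le> norm (X t - L)"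
      unfolding e real_norm_def using abs_Re_le_cmod[of "cis (\<tau> t) * (X t - L)"]
      unfolding norm_mult norm_cis mult_1_left .
  qed
qed

text \<open>The real form of the complex statement. The shift s = 1 turns the cosine into its
  negative, and multiplying cis \<psi> by 1 - \<i> gives the real part cos \<psi> + sin \<psi>. All
  errors are o(1) after multiplication by the weight.\<close>

lemma half_asymptotics:
  assumes k: "k \<ge> 1"
  shows "\<exists>B>0. \<exists>f f'.
     (\<forall>\<^sub>F t in at_right 0. twisted_sum k (- 1) 1 (of_real t) = of_real (f t)) \<and>
     (\<forall>\<^sub>F t in at_right 0. twisted_sum' k (- 1) 1 (of_real t) = of_real (f' t)) \<and>
     ((\<lambda>t. half_weight k t * f t + B * cos (Theta k t - phase_shift k)) \<longlongrightarrow> 0) (at_right 0) \<and>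
     ((\<lambda>t. half_weight k t * t * f' t / Theta k t + B / 2 * (cos (Theta k t - phase_shift k) + sin (Theta k t - phase_shift k))) \<longlongrightarrow> 0) (at_right 0) \<and>
     (\<forall>s. 0 < s \<and> s \<le> 1 \<longrightarrow> (\<exists>n. (\<forall>\<^sub>F t in at_right 0. twisted_sum k (- 1) s (of_real t) = of_real (n t)) \<and>
        ((\<lambda>t. half_weight k t * n t - B * cos (Theta k t - phase_shift k - pi * s)) \<longlongrightarrow> 0) (at_right 0)))"
proof -
  note ex = half_asymptotics_complex[OF k]
  define B where "B = (SOME B. B > 0 \<and> (\<forall>s. 0 < s \<and> s \<le> 1 \<longrightarrow> (\<exists>X. (X \<longlongrightarrow> of_real B * cis (- phase_shift k - pi * s)) (at_right 0) \<and>
        (\<forall>\<^sub>F t in at_right 0. twisted_sum k (- 1) s (of_real t) = of_real (Re (cis (Theta k t) * X t) / half_weight k t)))) \<and>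
     (\<exists>Y. (Y \<longlongrightarrow> - (of_real (B / 2) * cis (- phase_shift k) * (1 - \<i>))) (at_right 0) \<and>
        (\<forall>\<^sub>F t in at_right 0. twisted_sum' k (- 1) 1 (of_real t) = of_real (Theta k t * Re (cis (Theta k t) * Y t) / (half_weight k t * t)))))"
  note bb = someI_ex[OF ex, folded B_def]
  note B = conjunct1[OF bb]
  note part1 = conjunct1[OF conjunct2[OF bb], rule_format, OF conjI]
  note part2 = conjunct2[OF conjunct2[OF bb]]
  have pos: "\<forall>\<^sub>F t::real in at_right 0. t > 0" by (rule eventually_at_right_less)
  have n: "\<exists>n. (\<forall>\<^sub>F t in at_right 0. twisted_sum k (- 1) s (of_real t) = of_real (n t)) \<and>
        ((\<lambda>t. half_weight k t * n t - B * cos (Theta k t - phase_shift k - pi * s)) \<longlongrightarrow> 0) (at_right 0)" if s: "0 < s" "s \<le> 1" for s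
  proof -
    obtain X where X: "(X \<longlongrightarrow> of_real B * cis (- phase_shift k - pi * s)) (at_right 0)"
      and ev: "\<forall>\<^sub>F t in at_right 0. twisted_sum k (- 1) s (of_real t) = of_real (Re (cis (Theta k t) * X t) / half_weight k t)"
      using part1[OF s] by blast
    have r: "Re (cis (Theta k t) * (of_real B * cis (- phase_shift k - pi * s))) = B * cos (Theta k t - phase_shift k - pi * s)" for t
    proof -
      have "cis (Theta k t) * (of_real B * cis (- phase_shift k - pi * s)) = of_real B * cis (Theta k t + (- phase_shift k - pi * s))"
        by (simp only: cis_mult[symmetric] mult_ac)
      also have "Theta k t + (- phase_shift k - pi * s) = Theta k t - phase_shift k - pi * s" by simp
      finally have e: "cis (Theta k t) * (of_real B * cis (- phase_shift k - pi * s)) = of_real B * cis (Theta k t - phase_shift k - pi * s)" .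
      show ?thesis unfolding e by simp
    qed
    have "\<forall>\<^sub>F t in at_right 0. Re (cis (Theta k t) * X t) - Re (cis (Theta k t) * (of_real B * cis (- phase_shift k - pi * s))) =
       half_weight k t * (Re (cis (Theta k t) * X t) / half_weight k t) - B * cos (Theta k t - phase_shift k - pi * s)"
      using pos
    proof eventually_elim
      case (elim t)
      then show ?case using half_weight_pos[OF elim, of k] unfolding r by simp
    qed
    from Lim_transform_eventually[OF cis_perturbation[OF X] this] ev show ?thesis by (intro exI conjI)
  qed
  obtain f where f: "\<forall>\<^sub>F t in at_right 0. twisted_sum k (- 1) 1 (of_real t) = of_real (f t)"
    and fl: "((\<lambda>t. half_weight k t * f t - B * cos (Theta k t - phase_shift k - pi * 1)) \<longlongrightarrow> 0) (at_right 0)"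
    using n[of 1] by auto
  have fl': "((\<lambda>t. half_weight k t * f t + B * cos (Theta k t - phase_shift k)) \<longlongrightarrow> 0) (at_right 0)"
    using fl by (simp add: cos_diff[of _ pi])
  obtain Y where Y: "(Y \<longlongrightarrow> - (of_real (B / 2) * cis (- phase_shift k) * (1 - \<i>))) (at_right 0)"
    and ev: "\<forall>\<^sub>F t in at_right 0. twisted_sum' k (- 1) 1 (of_real t) = of_real (Theta k t * Re (cis (Theta k t) * Y t) / (half_weight k t * t))"
    using part2 by blast
  have r: "Re (cis (Theta k t) * - (of_real (B / 2) * cis (- phase_shift k) * (1 - \<i>))) = - (B / 2 * (cos (Theta k t - phase_shift k) + sin (Theta k t - phase_shift k)))" for t
  proof -
    have "cis (Theta k t) * - (of_real (B / 2) * cis (- phase_shift k) * (1 - \<i>)) = - (of_real (B / 2) * (cis (Theta k t + - phase_shift k) * (1 - \<i>)))"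
      unfolding cis_mult[symmetric] by (simp add: mult_ac)
    also have "Theta k t + - phase_shift k = Theta k t - phase_shift k" by simp
    finally have e: "cis (Theta k t) * - (of_real (B / 2) * cis (- phase_shift k) * (1 - \<i>)) = - (of_real (B / 2) * (cis (Theta k t - phase_shift k) * (1 - \<i>)))" .
    show ?thesis unfolding e by (simp add: algebra_simps)
  qed
  have "\<forall>\<^sub>F t in at_right 0. Re (cis (Theta k t) * Y t) - Re (cis (Theta k t) * - (of_real (B / 2) * cis (- phase_shift k) * (1 - \<i>))) =
     half_weight k t * t * (Theta k t * Re (cis (Theta k t) * Y t) / (half_weight k t * t)) / Theta k t + B / 2 * (cos (Theta k t - phase_shift k) + sin (Theta k t - phase_shift k))"
    using pos
  proof eventually_elim
    case (elim t)
    then show ?case using half_weight_pos[OF elim, of k] Theta_pos[OF k elim] unfolding r by simp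
  qed
  note dl = Lim_transform_eventually[OF cis_perturbation[OF Y] this]
  have n': "\<forall>s. 0 < s \<and> s \<le> 1 \<longrightarrow> (\<exists>n. (\<forall>\<^sub>F t in at_right 0. twisted_sum k (- 1) s (of_real t) = of_real (n t)) \<and>
        ((\<lambda>t. half_weight k t * n t - B * cos (Theta k t - phase_shift k - pi * s)) \<longlongrightarrow> 0) (at_right 0))"
    by (rule allI, rule impI, elim conjE) (rule n)
  show ?thesis
    by (rule exI[of _ B], rule conjI[OF B], rule exI[of _ f],
        rule exI[of _ "\<lambda>t. Theta k t * Re (cis (Theta k t) * Y t) / (half_weight k t * t)"],
        rule conjI[OF f], rule conjI[OF ev], rule conjI[OF fl'], rule conjI[OF dl n'])
qed

section \<open>Poles and residues\<close>

lemma W_eq_twisted_sums: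
  assumes a: "a \<ge> 1" and q: "q \<noteq> 0"
  shows "W a d k q = 1 / of_nat d * (\<Sum>z | z ^ d = 1. twisted_sum k z (1 / real a) (- of_nat a * Ln q) / twisted_sum k z 1 (- of_nat a * Ln q))"
proof -
  have p: "q ^ n = exp (of_nat n * Ln q)" for n using q by (simp add: exp_of_nat_mult)
  have 1: "z ^ m * q ^ (a * m + 1) * Phi (q ^ (a * m + 1)) ^ k = z ^ m * summand k (of_real (real m + 1 / real a) * (- of_nat a * Ln q))" for z m
  proof -
    have "- (of_real (real m + 1 / real a) * (- of_nat a * Ln q)) = of_nat (a * m + 1) * Ln q"
      using a by (simp add: algebra_simps)
    then show ?thesis unfolding summand_def p by (simp only: mult.assoc)
  qed
  have 2: "z ^ m * q ^ (a * (m + 1)) * Phi (q ^ (a * (m + 1))) ^ k = z ^ m * summand k (of_real (real m + 1) * (- of_nat a * Ln q))" for z m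
  proof -
    have "- (of_real (real m + 1) * (- of_nat a * Ln q)) = of_nat (a * (m + 1)) * Ln q"
      by (simp add: algebra_simps)
    then show ?thesis unfolding summand_def p by (simp only: mult.assoc)
  qed
  show ?thesis unfolding W_def 1 2 twisted_sum_def ..
qed

lemma norm_root_of_unity: "z ^ d = 1 \<Longrightarrow> d \<ge> 1 \<Longrightarrow> norm (z::complex) = 1"
  by (metis norm_one norm_power norm_ge_zero power_eq_1_iff not_one_le_zero)

lemma finite_roots: "d \<ge> 1 \<Longrightarrow> finite {z::complex. z ^ d = 1}"
  by (rule finite_roots_unity)

lemma Ln_exp_real: "- of_nat a * Ln (of_real (exp (- t / real a))) = of_real t" if "a \<ge> 1"
  using that by (simp add: Ln_of_real)

lemma twisted_comp_deriv:
  assumes a: "a \<ge> 1" and z: "norm z = 1" and s: "s > 0" and q: "Re q > 0" "norm q < 1"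
  shows "((\<lambda>q. twisted_sum k z s (- of_nat a * Ln q)) has_field_derivative
     twisted_sum' k z s (- of_nat a * Ln q) * (- of_nat a / q)) (at q)"
proof -
  have q0: "q \<noteq> 0" "q \<notin> \<real>\<^sub>\<le>\<^sub>0" using q by (auto simp: complex_nonpos_Reals_iff)
  have "Re (- of_nat a * Ln q) > 0"
    using a q q0 by (simp add: Re_Ln mult_less_0_iff mult_neg_pos) 
  moreover have "((\<lambda>q. - of_nat a * Ln q) has_field_derivative (- of_nat a / q)) (at q)"
    using q0 by (auto intro!: derivative_eq_intros simp: field_simps)
  ultimately show ?thesis by (intro DERIV_chain2[OF twisted_sum_aux(3)[OF z s]])
qed

text \<open>With all other denominators nonzero, only the term of z = -1 can be singular at x. If
  its denominator is nonzero too, W is holomorphic nearby. If the denominator vanishes while its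
  derivative and the numerator do not, then W times (q - x) has a nonzero limit, which is the
  residue; the factor - a / x is the derivative of t = - a Ln q.\<close>

lemma W_pole_analysis:
  assumes a: "a \<ge> 1" and d: "d \<ge> 1" "even d" and t: "t > 0" and x_def: "x = exp (- t / real a)"
    and nz: "\<And>z. z ^ d = 1 \<Longrightarrow> z \<noteq> - 1 \<Longrightarrow> twisted_sum k z 1 (of_real t) \<noteq> 0"
  shows "twisted_sum k (- 1) 1 (of_real t) \<noteq> 0 \<Longrightarrow> \<not> is_pole (W a d k) (of_real x)"
    and "twisted_sum k (- 1) 1 (of_real t) = 0 \<Longrightarrow> twisted_sum k (- 1) (1 / real a) (of_real t) \<noteq> 0 \<Longrightarrow>
      twisted_sum' k (- 1) 1 (of_real t) \<noteq> 0 \<Longrightarrow>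
      is_pole (W a d k) (of_real x) \<and>
      residue (W a d k) (of_real x) = 1 / of_nat d * (twisted_sum k (- 1) (1 / real a) (of_real t) / (twisted_sum' k (- 1) 1 (of_real t) * (- of_nat a / of_real x)))"
proof -
  define p where "p = complex_of_real x"
  have x: "0 < x" "x < 1" using t a by (auto simp: x_def)
  have Lp: "- of_nat a * Ln p = of_real t" unfolding p_def x_def by (rule Ln_exp_real[OF a])
  \<comment> \<open>The half-disc avoids the branch cut of \<open>Ln\<close> and the point 0, and
    there \<open>- of_nat a * Ln q\<close> has positive real part.\<close>
  define U where "U = {q::complex. Re q > 0} \<inter> ball 0 1"
  have U: "open U" by (simp add: U_def open_halfspace_Re_gt open_Int)
  have pU: "p \<in> U" using x by (simp add: U_def p_def)
  define N D where "N z q = twisted_sum k z (1 / real a) (- of_nat a * Ln q)" and "D z q = twisted_sum k z 1 (- of_nat a * Ln q)" for z q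
  have roots: "norm z = 1" if "z \<in> {z. z ^ d = 1}" for z :: complex using that d(1) norm_root_of_unity by auto
  have m1: "- 1 \<in> {z::complex. z ^ d = 1}" using d(2) by simp
  have fin: "finite {z::complex. z ^ d = 1}" by (rule finite_roots[OF d(1)])
  have Nd: "(N z has_field_derivative twisted_sum' k z (1 / real a) (- of_nat a * Ln q) * (- of_nat a / q)) (at q)"
    and Dd: "(D z has_field_derivative twisted_sum' k z 1 (- of_nat a * Ln q) * (- of_nat a / q)) (at q)"
    if "q \<in> U" "norm z = 1" for z q
  proof -
    have q: "Re q > 0" "norm q < 1" and s: "1 / real a > 0" using that a by (auto simp: U_def)
    show "(N z has_field_derivative twisted_sum' k z (1 / real a) (- of_nat a * Ln q) * (- of_nat a / q)) (at q)"
      unfolding N_def[abs_def] by (rule twisted_comp_deriv[OF a that(2) s q])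
    show "(D z has_field_derivative twisted_sum' k z 1 (- of_nat a * Ln q) * (- of_nat a / q)) (at q)"
      unfolding D_def[abs_def] by (rule twisted_comp_deriv[OF a that(2) zero_less_one q])
  qed
  have hol: "N z holomorphic_on U" "D z holomorphic_on U" if "norm z = 1" for z
    unfolding holomorphic_on_def field_differentiable_def
    by (intro ballI exI, rule has_field_derivative_at_within[OF Nd[OF _ that]], assumption)
       (intro ballI exI, rule has_field_derivative_at_within[OF Dd[OF _ that]], assumption)
  have Wq: "W a d k q = 1 / of_nat d * (\<Sum>z | z ^ d = 1. N z q / D z q)" if "q \<in> U" for q
    unfolding N_def D_def using that by (intro W_eq_twisted_sums a) (auto simp: U_def)
  have holW: "W a d k holomorphic_on V" if V: "V \<subseteq> U" "\<And>q z. q \<in> V \<Longrightarrow> z ^ d = 1 \<Longrightarrow> D z q \<noteq> 0" for V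
  proof -
    have "(\<lambda>q. 1 / of_nat d * (\<Sum>z | z ^ d = 1. N z q / D z q)) holomorphic_on V"
    proof (intro holomorphic_intros)
      fix z assume z: "z \<in> {z::complex. z ^ d = 1}"
      show "N z holomorphic_on V" "D z holomorphic_on V"
        using holomorphic_on_subset[OF hol(1)[OF roots[OF z]] V(1)] holomorphic_on_subset[OF hol(2)[OF roots[OF z]] V(1)] by auto
    qed (use V(2) in auto)
    then show ?thesis by (rule holomorphic_transform) (use V(1) Wq in auto)
  qed
  have cont: "isCont (N z) p" "isCont (D z) p" if "norm z = 1" for z
    using DERIV_isCont[OF Nd[OF pU that]] DERIV_isCont[OF Dd[OF pU that]] by auto
  have Dp: "D z p = twisted_sum k z 1 (of_real t)" and Np: "N z p = twisted_sum k z (1 / real a) (of_real t)" for z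
    unfolding D_def N_def Lp by simp_all
  have evD: "\<forall>\<^sub>F q in at p. D z q \<noteq> 0" if "norm z = 1" "D z p \<noteq> 0" for z
    using tendsto_imp_eventually_ne[OF cont(2)[OF that(1), unfolded isCont_def] that(2)] .
  have evU: "\<forall>\<^sub>F q in at p. q \<in> U" using U pU by (rule eventually_at_in_open')
  have evO: "\<forall>\<^sub>F q in at p. \<forall>z\<in>{z. z ^ d = 1} - {- 1}. D z q \<noteq> 0"
    using fin roots nz by (intro eventually_ball_finite ballI evD) (auto simp: Dp)
  show "\<not> is_pole (W a d k) (of_real x)" if n1: "twisted_sum k (- 1) 1 (of_real t) \<noteq> 0"
  proof -
    have "\<forall>\<^sub>F q in at p. D (- 1) q \<noteq> 0" by (rule evD) (use n1 in \<open>simp_all add: Dp\<close>)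
    with evU evO have "\<forall>\<^sub>F q in at p. q \<in> U \<and> (\<forall>z\<in>{z. z ^ d = 1}. D z q \<noteq> 0)"
      by eventually_elim auto
    then obtain e where e: "e > 0" "\<And>q. q \<noteq> p \<Longrightarrow> dist q p < e \<Longrightarrow> q \<in> U \<and> (\<forall>z\<in>{z. z ^ d = 1}. D z q \<noteq> 0)"
      unfolding eventually_at by auto
    have e': "q \<in> U \<and> (\<forall>z\<in>{z. z ^ d = 1}. D z q \<noteq> 0)" if "q \<in> ball p e" for q
    proof (cases "q = p")
      case True
      then show ?thesis using pU nz n1 by (metis Dp mem_Collect_eq)
    next
      case False
      then show ?thesis using e(2)[of q] that by (simp add: dist_commute)
    qed
    have "W a d k holomorphic_on ball p e" by (rule holW) (use e' in auto)
    then show ?thesis unfolding p_def[symmetric]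
      by (intro not_is_pole_holomorphic[of "ball p e"]) (use e(1) in auto)
  qed
  assume z0: "twisted_sum k (- 1) 1 (of_real t) = 0" and n0: "twisted_sum k (- 1) (1 / real a) (of_real t) \<noteq> 0"
    and d0: "twisted_sum' k (- 1) 1 (of_real t) \<noteq> 0"
  define D' where "D' = twisted_sum' k (- 1) 1 (of_real t) * (- of_nat a / p)"
  have D'0: "D' \<noteq> 0" using d0 a x by (simp add: D'_def p_def)
  have "(D (- 1) has_field_derivative D') (at p)"
    unfolding D'_def using Dd[OF pU, of "- 1"] Lp by simp
  then have Dl: "((\<lambda>q. D (- 1) q / (q - p)) \<longlongrightarrow> D') (at p)"
    using z0 by (simp add: has_field_derivative_iff Dp)
  define rest where "rest q = (\<Sum>z \<in> {z. z ^ d = 1} - {- 1}. N z q / D z q)" for q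
  have rl: "(rest \<longlongrightarrow> rest p) (at p)"
    unfolding rest_def using cont roots nz by (intro tendsto_sum tendsto_divide) (auto simp: isCont_def Dp)
  have Nl: "(N (- 1) \<longlongrightarrow> N (- 1) p) (at p)" using cont(1)[of "- 1"] by (simp add: isCont_def)
  define c where "c = 1 / of_nat d * (N (- 1) p / D')"
  have "((\<lambda>q. 1 / of_nat d * (rest q * (q - p) + N (- 1) q / (D (- 1) q / (q - p)))) \<longlongrightarrow> 1 / of_nat d * (rest p * (p - p) + N (- 1) p / D')) (at p)"
    by (intro tendsto_intros rl Nl Dl D'0)
  then have lim0: "((\<lambda>q. 1 / of_nat d * (rest q * (q - p) + N (- 1) q / (D (- 1) q / (q - p)))) \<longlongrightarrow> c) (at p)"
    by (simp add: c_def)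
  have "\<forall>\<^sub>F q in at p. 1 / of_nat d * (rest q * (q - p) + N (- 1) q / (D (- 1) q / (q - p))) = W a d k q * (q - p)"
    using evU
  proof eventually_elim
    case (elim q)
    have "(\<Sum>z | z ^ d = 1. N z q / D z q) = N (- 1) q / D (- 1) q + rest q"
      unfolding rest_def by (rule sum.remove[OF fin m1])
    moreover have "l * (r * w + n / (\<Delta> / w)) = l * (n / \<Delta> + r) * w" for l r w n \<Delta> :: complex
      by (simp add: distrib_left distrib_right)
    ultimately show ?case unfolding Wq[OF elim] by (simp only:)
  qed
  from Lim_transform_eventually[OF lim0 this] have lim: "((\<lambda>q. W a d k q * (q - p)) \<longlongrightarrow> c) (at p)" .
  have c0: "c \<noteq> 0" using d(1) n0 D'0 by (simp add: c_def Np)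
  have "\<forall>\<^sub>F q in at p. D (- 1) q / (q - p) \<noteq> 0" by (rule tendsto_imp_eventually_ne[OF Dl D'0])
  with evU evO have "\<forall>\<^sub>F q in at p. q \<in> U \<and> (\<forall>z\<in>{z. z ^ d = 1}. D z q \<noteq> 0)"
    by eventually_elim auto
  then obtain e where e: "e > 0" "\<And>q. q \<noteq> p \<Longrightarrow> dist q p < e \<Longrightarrow> q \<in> U \<and> (\<forall>z\<in>{z. z ^ d = 1}. D z q \<noteq> 0)"
    unfolding eventually_at by auto
  have e': "q \<in> U \<and> (\<forall>z\<in>{z. z ^ d = 1}. D z q \<noteq> 0)" if "q \<in> ball p e - {p}" for q
    using e(2)[of q] that by (simp add: dist_commute)
  have "W a d k holomorphic_on ball p e - {p}"
    by (rule holW) (use e' in blast)+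
  then have res: "residue (W a d k) p = c"
    by (intro residue_simple'[OF open_ball _ _ lim]) (use e(1) in auto)
  have "filterlim (\<lambda>q. W a d k q * (q - p) / (q - p)) at_infinity (at p)"
  proof (rule filterlim_divide_at_infinity[OF lim _ c0])
    show "filterlim (\<lambda>q. q - p) (at 0) (at p)"
      by (auto simp: filterlim_at eventually_at_filter intro!: tendsto_eq_intros)
  qed
  then have "is_pole (\<lambda>q. W a d k q * (q - p) / (q - p)) p" by (simp add: is_pole_def)
  also have "?this \<longleftrightarrow> is_pole (W a d k) p"
    by (rule is_pole_cong) (auto simp: eventually_at_filter)
  finally show "is_pole (W a d k) (of_real x) \<and>
      residue (W a d k) (of_real x) = 1 / of_nat d * (twisted_sum k (- 1) (1 / real a) (of_real t) / (twisted_sum' k (- 1) 1 (of_real t) * (- of_nat a / of_real x)))"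
    using res unfolding p_def[symmetric] c_def D'_def Np by simp
qed

section \<open>Zeros of a perturbed cosine\<close>

lemma trig_shift:
  "sin (pi * (real j + 1 / 2) + \<delta>) = (- 1) ^ j * cos \<delta>" "cos (pi * (real j + 1 / 2) + \<delta>) = - ((- 1) ^ j * sin \<delta>)"
proof -
  have "pi * (real j + 1 / 2) + \<delta> = (pi / 2 + \<delta>) + real j * pi" by (simp add: algebra_simps)
  then show "sin (pi * (real j + 1 / 2) + \<delta>) = (- 1) ^ j * cos \<delta>" "cos (pi * (real j + 1 / 2) + \<delta>) = - ((- 1) ^ j * sin \<delta>)"
    by (simp_all add: sin_add cos_add)
qed

text \<open>Existence: at distance \<epsilon> on either side of the centre the main term has size B
  sin \<epsilon> and opposite signs, so it outweighs the error and the intermediate value theorem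
  applies. Uniqueness: within pi/4 of the centre the main term of h' is at least B/2 in modulus, so
  h' has no zero there and two zeros of h would contradict the mean value theorem.\<close>

lemma oscillating_zeros:
  fixes h h' :: "real \<Rightarrow> real"
  assumes B: "B > 0" and d: "\<forall>\<^sub>F u in at_top. (h has_real_derivative h' u) (at u)"
    and h: "((\<lambda>u. h u + B * cos (u - \<phi>)) \<longlongrightarrow> 0) at_top" and h': "((\<lambda>u. h' u - B * sin (u - \<phi>)) \<longlongrightarrow> 0) at_top"
  shows "\<And>\<epsilon>. 0 < \<epsilon> \<Longrightarrow> \<epsilon> \<le> pi / 4 \<Longrightarrow> \<forall>\<^sub>F j in sequentially. \<exists>u. \<bar>u - \<phi> - pi * (real j + 1 / 2)\<bar> < \<epsilon> \<and> h u = 0"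
    and "\<forall>\<^sub>F j in sequentially. \<exists>!u. \<bar>u - \<phi> - pi * (real j + 1 / 2)\<bar> < pi / 4 \<and> h u = 0"
proof -
  obtain U1 where U1: "\<And>u. u \<ge> U1 \<Longrightarrow> (h has_real_derivative h' u) (at u)"
    using d unfolding eventually_at_top_linorder by blast
  define c where "c j = \<phi> + pi * (real j + 1 / 2)" for j
  have large: "\<forall>\<^sub>F j in sequentially. c j - pi / 4 \<ge> U" for U
  proof -
    have "filterlim (\<lambda>j. c j - pi / 4) at_top sequentially" unfolding c_def by real_asymp
    then show ?thesis by (simp add: filterlim_at_top)
  qed
  have ex: "\<forall>\<^sub>F j in sequentially. \<exists>u. \<bar>u - c j\<bar> < \<epsilon> \<and> h u = 0" if \<epsilon>: "0 < \<epsilon>" "\<epsilon> \<le> pi / 4" for \<epsilon>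
  proof -
    have s: "sin \<epsilon> > 0" using \<epsilon> pi_gt_zero by (intro sin_gt_zero) linarith+
    have "\<forall>\<^sub>F u in at_top. \<bar>h u + B * cos (u - \<phi>)\<bar> < B * sin \<epsilon>"
      using tendstoD[OF h, of "B * sin \<epsilon>"] B s by (simp add: dist_real_def)
    then obtain U2 where U2: "\<And>u. u \<ge> U2 \<Longrightarrow> \<bar>h u + B * cos (u - \<phi>)\<bar> < B * sin \<epsilon>"
      unfolding eventually_at_top_linorder by blast
    show ?thesis using large[of "max U1 U2"]
    proof eventually_elim
      case (elim j)
      define g where "g \<delta> = (- 1) ^ j * h (c j + \<delta>)" for \<delta>
      have big: "c j + \<delta> \<ge> U1" "c j + \<delta> \<ge> U2" if "\<bar>\<delta>\<bar> \<le> \<epsilon>" for \<delta> using that elim \<epsilon> by auto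
      have key: "\<bar>g \<delta> - B * sin \<delta>\<bar> < B * sin \<epsilon>" if "\<bar>\<delta>\<bar> \<le> \<epsilon>" for \<delta>
      proof -
        have "c j + \<delta> - \<phi> = pi * (real j + 1 / 2) + \<delta>" by (simp add: c_def)
        then have "cos (c j + \<delta> - \<phi>) = - ((- 1) ^ j * sin \<delta>)" by (simp only: trig_shift)
        then have "g \<delta> - B * sin \<delta> = (- 1) ^ j * (h (c j + \<delta>) + B * cos (c j + \<delta> - \<phi>))"
          by (simp add: g_def algebra_simps)
        then have "\<bar>g \<delta> - B * sin \<delta>\<bar> = \<bar>h (c j + \<delta>) + B * cos (c j + \<delta> - \<phi>)\<bar>" by (simp add: abs_mult)
        then show ?thesis using U2[OF big(2)[OF that]] by simp
      qed
      have g1: "g \<epsilon> > 0" using key[of \<epsilon>] \<epsilon> by (simp add: abs_less_iff)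
      have g2: "g (- \<epsilon>) < 0" using key[of "- \<epsilon>"] \<epsilon> by (simp add: abs_less_iff)
      have "continuous_on {- \<epsilon>..\<epsilon>} g"
      proof (intro continuous_at_imp_continuous_on ballI)
        fix \<delta> assume "\<delta> \<in> {- \<epsilon>..\<epsilon>}"
        then have "isCont h (c j + \<delta>)" using DERIV_isCont[OF U1[OF big(1)]] by auto
        then show "isCont g \<delta>" unfolding g_def by (intro continuous_intros isCont_o2[of _ "\<lambda>\<delta>. c j + \<delta>" h]) auto
      qed
      then obtain \<delta> where \<delta>: "- \<epsilon> \<le> \<delta>" "\<delta> \<le> \<epsilon>" "g \<delta> = 0"
        using IVT'[of g "- \<epsilon>" 0 \<epsilon>] g1 g2 \<epsilon> by auto
      have "\<delta> \<noteq> \<epsilon>" "\<delta> \<noteq> - \<epsilon>" using g1 g2 \<delta>(3) by auto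
      then show ?case using \<delta> by (intro exI[of _ "c j + \<delta>"]) (auto simp: g_def)
    qed
  qed
  then show "\<forall>\<^sub>F j in sequentially. \<exists>u. \<bar>u - \<phi> - pi * (real j + 1 / 2)\<bar> < \<epsilon> \<and> h u = 0" if "0 < \<epsilon>" "\<epsilon> \<le> pi / 4" for \<epsilon>
    using that by (simp add: c_def diff_diff_eq)
  have "\<forall>\<^sub>F u in at_top. \<bar>h' u - B * sin (u - \<phi>)\<bar> < B / 2"
    using tendstoD[OF h', of "B / 2"] B by (simp add: dist_real_def)
  then obtain U3 where U3: "\<And>u. u \<ge> U3 \<Longrightarrow> \<bar>h' u - B * sin (u - \<phi>)\<bar> < B / 2"
    unfolding eventually_at_top_linorder by blast
  have nz: "h' u \<noteq> 0" if u: "\<bar>u - c j\<bar> < pi / 4" and j: "c j - pi / 4 \<ge> max U1 U3" for u j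
  proof
    assume "h' u = 0"
    have "u \<ge> U3" using u j by linarith
    from U3[OF this] have 1: "\<bar>B * sin (u - \<phi>)\<bar> < B / 2" using \<open>h' u = 0\<close> by simp
    have "u - \<phi> = pi * (real j + 1 / 2) + (u - c j)" by (simp add: c_def)
    then have "sin (u - \<phi>) = (- 1) ^ j * cos (u - c j)" by (simp only: trig_shift)
    then have "\<bar>B * sin (u - \<phi>)\<bar> = B * \<bar>cos (u - c j)\<bar>" using B by (simp add: abs_mult)
    then have 2: "\<bar>cos (u - c j)\<bar> < 1 / 2" using 1 B by simp
    \<comment> \<open>The window has half-width pi/4, but the weaker comparison with pi/3 gives
      exactly the 1/2 that matches the error bound B/2.\<close>
    have "cos (pi / 3) \<le> cos \<bar>u - c j\<bar>" using u pi_gt_zero by (intro cos_monotone_0_pi_le) linarith+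
    then have "1 / 2 \<le> cos (u - c j)" by (simp add: cos_60)
    with 2 show False by linarith
  qed
  have exq: "\<forall>\<^sub>F j in sequentially. \<exists>u. \<bar>u - c j\<bar> < pi / 4 \<and> h u = 0"
    by (rule ex) simp_all
  show "\<forall>\<^sub>F j in sequentially. \<exists>!u. \<bar>u - \<phi> - pi * (real j + 1 / 2)\<bar> < pi / 4 \<and> h u = 0"
    using exq large[of "max U1 U3"]
  proof eventually_elim
    case (elim j)
    have uniq: False if "u < v" "\<bar>u - c j\<bar> < pi / 4" "h u = 0" "\<bar>v - c j\<bar> < pi / 4" "h v = 0" for u v
    proof -
      have "\<exists>z>u. z < v \<and> h v - h u = (v - u) * h' z"
        by (rule MVT2[OF that(1)], rule U1) (use that elim(2) in linarith)
      then obtain z where z: "u < z" "z < v" "h v - h u = (v - u) * h' z" by blast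
      have z3: "h' z = 0" using z(3) that by simp
      have "\<bar>z - c j\<bar> < pi / 4" using z(1,2) that(2,4) by linarith
      from nz[OF this elim(2)] z3 show False by simp
    qed
    from elim(1) obtain u where u: "\<bar>u - c j\<bar> < pi / 4" "h u = 0" by blast
    have "\<exists>!u. \<bar>u - c j\<bar> < pi / 4 \<and> h u = 0"
    proof (rule ex1I[of _ u])
      fix v assume "\<bar>v - c j\<bar> < pi / 4 \<and> h v = 0"
      then show "v = u" using uniq[of u v] uniq[of v u] u by (cases u v rule: linorder_cases) auto
    qed (use u in auto)
    then show ?case by (simp add: c_def diff_diff_eq)
  qed
qed

section \<open>Zeros in the phase windows\<close>

lemma real_part_derivative:
  assumes "(F has_field_derivative F') (at (complex_of_real t))"
  shows "((\<lambda>t. Re (F (of_real t))) has_real_derivative Re F') (at t)"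
  using bounded_linear.has_vector_derivative[OF bounded_linear_Re has_vector_derivative_real_field[OF assms, of UNIV]]
  by (simp add: has_real_derivative_iff_has_vector_derivative)

definition inverse_phase :: "nat \<Rightarrow> real \<Rightarrow> real" where
  "inverse_phase k u = pi ^ 3 * real k / (3 * u\<^sup>2)"

lemma inverse_phase_pos: "k \<ge> 1 \<Longrightarrow> u > 0 \<Longrightarrow> inverse_phase k u > 0"
  by (simp add: inverse_phase_def)

lemma Theta_inverse_phase:
  assumes "k \<ge> 1" "u > 0"
  shows "Theta k (inverse_phase k u) = u"
proof -
  have "(Theta k (inverse_phase k u))\<^sup>2 = u\<^sup>2"
    unfolding Theta_squared[OF inverse_phase_pos[OF assms]] using assms by (simp add: inverse_phase_def)
  then show ?thesis using Theta_pos[OF assms(1) inverse_phase_pos[OF assms]] assms(2) by (simp add: power2_eq_iff_nonneg)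
qed

lemma inverse_phase_Theta:
  assumes "k \<ge> 1" "t > 0"
  shows "inverse_phase k (Theta k t) = t"
  unfolding inverse_phase_def Theta_squared[OF assms(2)] using assms by simp

lemma inverse_phase_at_right:
  assumes "k \<ge> 1"
  shows "filterlim (inverse_phase k) (at_right 0) at_top"
proof -
  have "real k > 0" using assms by simp
  then show ?thesis unfolding inverse_phase_def by real_asymp
qed

text \<open>The phase u = Theta is taken as the variable, and h is the weighted sum. Its derivative
  combines - B cos from differentiating exp u with B (cos + sin) from the derivative of the sum; the
  cosines cancel and B sin remains, as the oscillation lemma demands.\<close>

lemma window_zeros:
  assumes k: "k \<ge> 1"
  shows "\<And>\<epsilon>. 0 < \<epsilon> \<Longrightarrow> \<epsilon> \<le> pi / 4 \<Longrightarrow> \<forall>\<^sub>F j in sequentially. \<exists>t>0. \<bar>Theta k t - phase_shift k - pi * (real j + 1 / 2)\<bar> < \<epsilon> \<and> twisted_sum k (- 1) 1 (of_real t) = 0"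
    and "\<forall>\<^sub>F j in sequentially. \<exists>!t. t > 0 \<and> \<bar>Theta k t - phase_shift k - pi * (real j + 1 / 2)\<bar> < pi / 4 \<and> twisted_sum k (- 1) 1 (of_real t) = 0"
proof -
  define F F' where "F t = Re (twisted_sum k (- 1) 1 (of_real t))" and "F' t = Re (twisted_sum' k (- 1) 1 (of_real t))" for t :: real
  define \<phi> where "\<phi> = phase_shift k"
  obtain B f f' where B: "B > 0"
    and f: "\<forall>\<^sub>F t in at_right 0. twisted_sum k (- 1) 1 (of_real t) = of_real (f t)"
    and f': "\<forall>\<^sub>F t in at_right 0. twisted_sum' k (- 1) 1 (of_real t) = of_real (f' t)"
    and fl0: "((\<lambda>t. half_weight k t * f t + B * cos (Theta k t - phase_shift k)) \<longlongrightarrow> 0) (at_right 0)"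
    and fl0': "((\<lambda>t. half_weight k t * t * f' t / Theta k t + B / 2 * (cos (Theta k t - phase_shift k) + sin (Theta k t - phase_shift k))) \<longlongrightarrow> 0) (at_right 0)"
    using half_asymptotics[OF k] by (elim exE conjE) (rule that)
  note fl = fl0[folded \<phi>_def] and fl' = fl0'[folded \<phi>_def]
  define \<tau> where "\<tau> = inverse_phase k"
  note tr = inverse_phase_at_right[OF k, folded \<tau>_def]
  have up: "\<forall>\<^sub>F u::real in at_top. u > 0" by (rule eventually_gt_at_top)
  define p where "p = real k / 4 + 1 / 4"
  \<comment> \<open>The first term of h' differentiates exp u, the second the power of \<tau>, the
    third the sum itself; the last two use that \<tau> has derivative - 2 \<tau> / u.\<close>
  define h h' where "h u = half_weight k (\<tau> u) * F (\<tau> u)"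
    and "h' u = h u - 2 * p / u * h u - 2 * (half_weight k (\<tau> u) * \<tau> u * F' (\<tau> u) / u)" for u
  have hw: "half_weight k (\<tau> u) = \<tau> u powr p * exp u" if "u > 0" for u
    unfolding half_weight_def p_def \<tau>_def Theta_inverse_phase[OF k that] ..
  have d\<tau>: "(\<tau> has_real_derivative (- 2 * \<tau> u / u)) (at u)" if "u > 0" for u
    unfolding \<tau>_def inverse_phase_def[abs_def] using that
    by (auto intro!: derivative_eq_intros simp: power2_eq_square divide_simps)
  have dh: "(h has_real_derivative h' u) (at u)" if u: "u > 0" for u
  proof -
    have t: "\<tau> u > 0" using inverse_phase_pos[OF k u] by (simp add: \<tau>_def)
    have "(twisted_sum k (- 1) 1 has_field_derivative twisted_sum' k (- 1) 1 (of_real (\<tau> u))) (at (of_real (\<tau> u)))"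
      by (rule twisted_sum_aux(3)) (use t in auto)
    from real_part_derivative[OF this] have "(F has_real_derivative F' (\<tau> u)) (at (\<tau> u))"
      unfolding F_def F'_def .
    from DERIV_chain2[OF this d\<tau>[OF u]] have dF: "((\<lambda>u. F (\<tau> u)) has_real_derivative F' (\<tau> u) * (- 2 * \<tau> u / u)) (at u)" .
    have dw: "((\<lambda>u. \<tau> u powr p * exp u) has_real_derivative \<tau> u powr p * exp u * (1 - 2 * p / u)) (at u)"
    proof -
      have "((\<lambda>u. \<tau> u powr p) has_real_derivative (p * \<tau> u powr (p - 1) * (- 2 * \<tau> u / u))) (at u)"
        using DERIV_fun_powr[OF d\<tau>[OF u] t, of p] by simp
      then have "((\<lambda>u. \<tau> u powr p * exp u) has_real_derivative (p * \<tau> u powr (p - 1) * (- 2 * \<tau> u / u)) * exp u + exp u * \<tau> u powr p) (at u)"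
        by (intro DERIV_mult DERIV_exp)
      moreover have "\<tau> u powr (p - 1) = \<tau> u powr p / \<tau> u" using t by (simp add: powr_diff)
      ultimately show ?thesis using t by (simp add: algebra_simps)
    qed
    have "((\<lambda>u. \<tau> u powr p * exp u * F (\<tau> u)) has_real_derivative \<tau> u powr p * exp u * (1 - 2 * p / u) * F (\<tau> u) + F' (\<tau> u) * (- 2 * \<tau> u / u) * (\<tau> u powr p * exp u)) (at u)"
      by (rule DERIV_mult[OF dw dF])
    then have "((\<lambda>u. \<tau> u powr p * exp u * F (\<tau> u)) has_real_derivative h' u) (at u)"
      by (rule back_subst[where P="\<lambda>x. (_ has_real_derivative x) _"]) (simp add: h'_def h_def hw[OF u] algebra_simps)
    then show ?thesis
      by (rule has_field_derivative_transform_within_open[OF _ open_greaterThan[of 0]]) (use u in \<open>auto simp: h_def hw\<close>)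
  qed
  have evF: "\<forall>\<^sub>F u in at_top. twisted_sum k (- 1) 1 (of_real (\<tau> u)) = of_real (F (\<tau> u)) \<and> F (\<tau> u) = f (\<tau> u) \<and> F' (\<tau> u) = f' (\<tau> u)"
    using eventually_compose_filterlim[OF f tr] eventually_compose_filterlim[OF f' tr]
    by eventually_elim (simp add: F_def F'_def)
  have h_lim: "((\<lambda>u. h u + B * cos (u - \<phi>)) \<longlongrightarrow> 0) at_top"
    using filterlim_compose[OF fl tr]
  proof (rule Lim_transform_eventually)
    show "\<forall>\<^sub>F u in at_top. half_weight k (\<tau> u) * f (\<tau> u) + B * cos (Theta k (\<tau> u) - \<phi>) = h u + B * cos (u - \<phi>)"
      using evF up by eventually_elim (simp add: h_def \<tau>_def Theta_inverse_phase[OF k])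
  qed
  have e_lim: "((\<lambda>u. half_weight k (\<tau> u) * \<tau> u * F' (\<tau> u) / u + B / 2 * (cos (u - \<phi>) + sin (u - \<phi>))) \<longlongrightarrow> 0) at_top"
    using filterlim_compose[OF fl' tr]
  proof (rule Lim_transform_eventually)
    show "\<forall>\<^sub>F u in at_top. half_weight k (\<tau> u) * \<tau> u * f' (\<tau> u) / Theta k (\<tau> u) + B / 2 * (cos (Theta k (\<tau> u) - \<phi>) + sin (Theta k (\<tau> u) - \<phi>)) =
       half_weight k (\<tau> u) * \<tau> u * F' (\<tau> u) / u + B / 2 * (cos (u - \<phi>) + sin (u - \<phi>))"
      using evF up by eventually_elim (simp add: \<tau>_def Theta_inverse_phase[OF k])
  qed
  have small: "((\<lambda>u. 2 * p / u * h u) \<longlongrightarrow> 0) at_top"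
  proof -
    have pu: "((\<lambda>u. 2 * p / u) \<longlongrightarrow> 0) at_top" by real_asymp
    have c: "((\<lambda>u. 2 * p / u * (B * cos (u - \<phi>))) \<longlongrightarrow> 0) at_top"
    proof (rule Lim_null_comparison)
      show "((\<lambda>u. \<bar>2 * p / u\<bar> * B) \<longlongrightarrow> 0) at_top" using tendsto_mult_left_zero[OF tendsto_rabs_zero[OF pu]] .
      show "\<forall>\<^sub>F u in at_top. norm (2 * p / u * (B * cos (u - \<phi>))) \<le> \<bar>2 * p / u\<bar> * B"
      proof (intro always_eventually allI)
        fix u
        have "\<bar>2 * p / u\<bar> * (B * \<bar>cos (u - \<phi>)\<bar>) \<le> \<bar>2 * p / u\<bar> * (B * 1)" using B by (intro mult_left_mono) auto
        then show "norm (2 * p / u * (B * cos (u - \<phi>))) \<le> \<bar>2 * p / u\<bar> * B" using B by (simp add: abs_mult)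
      qed
    qed
    from tendsto_diff[OF tendsto_mult_zero[OF pu h_lim] c] show ?thesis by (simp add: algebra_simps)
  qed
  have h'_lim: "((\<lambda>u. h' u - B * sin (u - \<phi>)) \<longlongrightarrow> 0) at_top"
    using tendsto_diff[OF tendsto_diff[OF h_lim small] tendsto_mult_right_zero[OF e_lim, of 2]]
    by (simp add: h'_def algebra_simps)
  have ev_d: "\<forall>\<^sub>F u in at_top. (h has_real_derivative h' u) (at u)"
    using up by eventually_elim (rule dh)
  note oz = oscillating_zeros[OF B ev_d h_lim h'_lim]
  have evZ: "\<forall>\<^sub>F u in at_top. u > 0 \<and> (h u = 0 \<longleftrightarrow> twisted_sum k (- 1) 1 (of_real (\<tau> u)) = 0)"
    using evF up
  proof eventually_elim
    case (elim u)
    have "half_weight k (\<tau> u) > 0" using inverse_phase_pos[OF k elim(2)] by (intro half_weight_pos) (simp add: \<tau>_def)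
    then show ?case using elim by (simp add: h_def)
  qed
  then obtain U where U: "\<And>u. u \<ge> U \<Longrightarrow> u > 0 \<and> (h u = 0 \<longleftrightarrow> twisted_sum k (- 1) 1 (of_real (\<tau> u)) = 0)"
    unfolding eventually_at_top_linorder by blast
  have large: "\<forall>\<^sub>F j in sequentially. \<phi> + pi * (real j + 1 / 2) - pi / 4 \<ge> U"
  proof -
    have "filterlim (\<lambda>j. \<phi> + pi * (real j + 1 / 2) - pi / 4) at_top sequentially" by real_asymp
    then show ?thesis by (simp add: filterlim_at_top)
  qed
  show "\<forall>\<^sub>F j in sequentially. \<exists>t>0. \<bar>Theta k t - phase_shift k - pi * (real j + 1 / 2)\<bar> < \<epsilon> \<and> twisted_sum k (- 1) 1 (of_real t) = 0"
    if \<epsilon>: "0 < \<epsilon>" "\<epsilon> \<le> pi / 4" for \<epsilon>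
    using oz(1)[OF \<epsilon>] large
  proof eventually_elim
    case (elim j)
    then obtain u where u: "\<bar>u - \<phi> - pi * (real j + 1 / 2)\<bar> < \<epsilon>" "h u = 0" by blast
    then have "u \<ge> U" using elim(2) \<epsilon> by linarith
    then show ?case using U[of u] u inverse_phase_pos[OF k, of u] Theta_inverse_phase[OF k, of u]
      by (intro exI[of _ "\<tau> u"]) (auto simp: \<tau>_def \<phi>_def)
  qed
  show "\<forall>\<^sub>F j in sequentially. \<exists>!t. t > 0 \<and> \<bar>Theta k t - phase_shift k - pi * (real j + 1 / 2)\<bar> < pi / 4 \<and> twisted_sum k (- 1) 1 (of_real t) = 0"
    using oz(2) large
  proof eventually_elim
    case (elim j)
    from elim(1) obtain u where u: "\<bar>u - \<phi> - pi * (real j + 1 / 2)\<bar> < pi / 4" "h u = 0"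
      and uniq: "\<And>v. \<bar>v - \<phi> - pi * (real j + 1 / 2)\<bar> < pi / 4 \<Longrightarrow> h v = 0 \<Longrightarrow> v = u" by (elim ex1E) blast
    have uU: "u \<ge> U" using u elim(2) by linarith
    show ?case
    proof (rule ex1I[of _ "\<tau> u"])
      show "\<tau> u > 0 \<and> \<bar>Theta k (\<tau> u) - phase_shift k - pi * (real j + 1 / 2)\<bar> < pi / 4 \<and> twisted_sum k (- 1) 1 (of_real (\<tau> u)) = 0"
        using U[OF uU] u inverse_phase_pos[OF k, of u] Theta_inverse_phase[OF k, of u] by (auto simp: \<tau>_def \<phi>_def)
    next
      fix t assume t: "t > 0 \<and> \<bar>Theta k t - phase_shift k - pi * (real j + 1 / 2)\<bar> < pi / 4 \<and> twisted_sum k (- 1) 1 (of_real t) = 0"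
      have tt: "\<tau> (Theta k t) = t" using inverse_phase_Theta[OF k] t by (simp add: \<tau>_def)
      have "Theta k t \<ge> U"
        using t[THEN conjunct2, THEN conjunct1] elim(2) unfolding \<phi>_def by linarith
      from U[OF this] have "h (Theta k t) = 0" using t by (simp add: tt)
      then have "Theta k t = u" using t by (intro uniq) (auto simp: \<phi>_def)
      then show "t = \<tau> u" using tt by simp
    qed
  qed
qed

section \<open>Late poles\<close>

text \<open>The zeros of the denominator at z = -1 depend on k alone; a and d enter only through q =
  exp (- t / a) and the residues. Where no unique zero exists the value is unspecified, and all
  statements about it are eventual in j.\<close>

definition late_time :: "nat \<Rightarrow> nat \<Rightarrow> real" where
  "late_time k j = (THE t. t > 0 \<and> \<bar>Theta k t - phase_shift k - pi * (real j + 1 / 2)\<bar> < pi / 4 \<and> twisted_sum k (- 1) 1 (of_real t) = 0)"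

lemma late_time:
  assumes k: "k \<ge> 1"
  shows "\<forall>\<^sub>F j in sequentially. late_time k j > 0 \<and> \<bar>Theta k (late_time k j) - phase_shift k - pi * (real j + 1 / 2)\<bar> < pi / 4 \<and>
       twisted_sum k (- 1) 1 (of_real (late_time k j)) = 0 \<and>
       (\<forall>t. t > 0 \<and> \<bar>Theta k t - phase_shift k - pi * (real j + 1 / 2)\<bar> < pi / 4 \<and> twisted_sum k (- 1) 1 (of_real t) = 0 \<longrightarrow> t = late_time k j)"
  using window_zeros(2)[OF k]
proof eventually_elim
  case (elim j)
  have T: "late_time k j > 0 \<and> \<bar>Theta k (late_time k j) - phase_shift k - pi * (real j + 1 / 2)\<bar> < pi / 4 \<and> twisted_sum k (- 1) 1 (of_real (late_time k j)) = 0"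
    unfolding late_time_def by (rule theI'[OF elim])
  have eq: "t = late_time k j" if "t > 0 \<and> \<bar>Theta k t - phase_shift k - pi * (real j + 1 / 2)\<bar> < pi / 4 \<and> twisted_sum k (- 1) 1 (of_real t) = 0" for t
    unfolding late_time_def by (rule the1_equality[OF elim that, symmetric])
  show ?case
  proof (intro conjI allI impI)
    show "late_time k j > 0" by (rule T[THEN conjunct1])
    show "\<bar>Theta k (late_time k j) - phase_shift k - pi * (real j + 1 / 2)\<bar> < pi / 4" by (rule T[THEN conjunct2, THEN conjunct1])
    show "twisted_sum k (- 1) 1 (of_real (late_time k j)) = 0" by (rule T[THEN conjunct2, THEN conjunct2])
  qed (rule eq)
qed

lemma late_time_pos:
  assumes "k \<ge> 1"
  shows "\<forall>\<^sub>F j in sequentially. late_time k j > 0"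
  using late_time[OF assms] by eventually_elim (rule conjunct1)

text \<open>Every narrower window also contains a zero for large j, and uniqueness in the window of
  half-width pi/4 forces it to be the same zero.\<close>

lemma late_time_phase:
  assumes k: "k \<ge> 1"
  shows "(\<lambda>j. Theta k (late_time k j) - phase_shift k - pi * (real j + 1 / 2)) \<longlonglongrightarrow> 0"
proof (rule tendstoI)
  fix \<epsilon> :: real assume \<epsilon>: "\<epsilon> > 0"
  define \<epsilon>' where "\<epsilon>' = min \<epsilon> (pi / 4)"
  have \<epsilon>': "0 < \<epsilon>'" "\<epsilon>' \<le> pi / 4" "\<epsilon>' \<le> \<epsilon>" using \<epsilon> by (auto simp: \<epsilon>'_def)
  show "\<forall>\<^sub>F j in sequentially. dist (Theta k (late_time k j) - phase_shift k - pi * (real j + 1 / 2)) 0 < \<epsilon>"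
    using window_zeros(1)[OF k \<epsilon>'(1,2)] late_time[OF k]
  proof eventually_elim
    case (elim j)
    from elim(1) obtain t where t: "t > 0" "\<bar>Theta k t - phase_shift k - pi * (real j + 1 / 2)\<bar> < \<epsilon>'" "twisted_sum k (- 1) 1 (of_real t) = 0"
      by blast
    then have "\<bar>Theta k t - phase_shift k - pi * (real j + 1 / 2)\<bar> < pi / 4" using \<epsilon>' by linarith
    then have "t = late_time k j" using elim(2) t by blast
    then show ?case using t(2) \<epsilon>'(3) by (simp add: dist_real_def)
  qed
qed

lemma late_time_limits:
  assumes k: "k \<ge> 1"
  defines "u \<equiv> \<lambda>j. Theta k (late_time k j)"
  shows "filterlim u at_top sequentially" "(\<lambda>j. u j / real j) \<longlonglongrightarrow> pi" "(\<lambda>j. u (Suc j) - u j) \<longlonglongrightarrow> pi"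
    "(\<lambda>j. u (Suc j) / real j) \<longlonglongrightarrow> pi"
    "\<forall>\<^sub>F j in sequentially. late_time k j = inverse_phase k (u j)" "filterlim (late_time k) (at_right 0) sequentially"
proof -
  define e where "e j = u j - phase_shift k - pi * (real j + 1 / 2)" for j
  have e: "e \<longlonglongrightarrow> 0" unfolding e_def[abs_def] u_def by (rule late_time_phase[OF k])
  have u_eq: "u j = e j + (phase_shift k + pi * (real j + 1 / 2))" for j by (simp add: e_def)
  have "filterlim (\<lambda>j. phase_shift k + pi * (real j + 1 / 2)) at_top sequentially" by real_asymp
  then show inf: "filterlim u at_top sequentially"
    unfolding u_eq[abs_def] by (rule filterlim_tendsto_add_at_top[OF e])
  have rj: "filterlim real at_top sequentially" by (rule filterlim_real_sequentially)
  have ej: "(\<lambda>j. e j / real j) \<longlonglongrightarrow> 0" by (rule real_tendsto_divide_at_top[OF e rj])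
  have "(\<lambda>j. (phase_shift k + pi * (real j + 1 / 2)) / real j) \<longlonglongrightarrow> pi" by real_asymp
  from tendsto_add[OF ej this] show "(\<lambda>j. u j / real j) \<longlonglongrightarrow> pi" by (simp add: u_eq add_divide_distrib)
  have e': "(\<lambda>j. e (Suc j)) \<longlonglongrightarrow> 0" using e by (rule LIMSEQ_Suc)
  have "u (Suc j) - u j = e (Suc j) - e j + pi" for j by (simp add: u_eq algebra_simps)
  then show d: "(\<lambda>j. u (Suc j) - u j) \<longlonglongrightarrow> pi"
    using tendsto_add[OF tendsto_diff[OF e' e] tendsto_const[of pi]] by simp
  have "(\<lambda>j. e (Suc j) / real j) \<longlonglongrightarrow> 0" by (rule real_tendsto_divide_at_top[OF e' rj])
  moreover have "(\<lambda>j. (phase_shift k + pi * (real (Suc j) + 1 / 2)) / real j) \<longlonglongrightarrow> pi" by real_asymp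
  ultimately have "(\<lambda>j. e (Suc j) / real j + (phase_shift k + pi * (real (Suc j) + 1 / 2)) / real j) \<longlonglongrightarrow> 0 + pi" by (rule tendsto_add)
  then show "(\<lambda>j. u (Suc j) / real j) \<longlonglongrightarrow> pi" unfolding u_eq add_divide_distrib by simp
  show eq: "\<forall>\<^sub>F j in sequentially. late_time k j = inverse_phase k (u j)"
    using late_time_pos[OF k] by eventually_elim (simp add: u_def inverse_phase_Theta[OF k])
  show "filterlim (late_time k) (at_right 0) sequentially"
    by (rule filterlim_cong[OF refl refl eq, THEN iffD2, OF filterlim_compose[OF inverse_phase_at_right[OF k] inf]])
qed

text \<open>At a late zero the phase is pi (j + 1/2) + o(1). Times (-1)^j and the weight, the
  numerator tends to B sin (pi s); the normalised derivative tends to - B/2. The sign, the weight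
  and B cancel in the quotient.\<close>

lemma late_time_amplitudes:
  assumes k: "k \<ge> 1" and s: "0 < s" "s \<le> 1"
  shows "\<exists>n f'. (\<forall>\<^sub>F j in sequentially. twisted_sum k (- 1) s (of_real (late_time k j)) = of_real (n (late_time k j))) \<and>
    (\<forall>\<^sub>F j in sequentially. twisted_sum' k (- 1) 1 (of_real (late_time k j)) = of_real (f' (late_time k j))) \<and>
    (\<forall>\<^sub>F j in sequentially. f' (late_time k j) \<noteq> 0) \<and>
    (\<lambda>j. n (late_time k j) * Theta k (late_time k j) / (late_time k j * f' (late_time k j))) \<longlonglongrightarrow> - 2 * sin (pi * s)"
proof -
  obtain B f f' where B: "B > 0"
    and f': "\<forall>\<^sub>F t in at_right 0. twisted_sum' k (- 1) 1 (of_real t) = of_real (f' t)"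
    and fl': "((\<lambda>t. half_weight k t * t * f' t / Theta k t + B / 2 * (cos (Theta k t - phase_shift k) + sin (Theta k t - phase_shift k))) \<longlongrightarrow> 0) (at_right 0)"
    and ns: "\<forall>s. 0 < s \<and> s \<le> 1 \<longrightarrow> (\<exists>n. (\<forall>\<^sub>F t in at_right 0. twisted_sum k (- 1) s (of_real t) = of_real (n t)) \<and>
        ((\<lambda>t. half_weight k t * n t - B * cos (Theta k t - phase_shift k - pi * s)) \<longlongrightarrow> 0) (at_right 0))"
    using half_asymptotics[OF k] by (elim exE conjE) (rule that)
  have "\<exists>n. (\<forall>\<^sub>F t in at_right 0. twisted_sum k (- 1) s (of_real t) = of_real (n t)) \<and>
        ((\<lambda>t. half_weight k t * n t - B * cos (Theta k t - phase_shift k - pi * s)) \<longlongrightarrow> 0) (at_right 0)"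
    by (rule ns[rule_format]) (use s in simp)
  then obtain n where n: "\<forall>\<^sub>F t in at_right 0. twisted_sum k (- 1) s (of_real t) = of_real (n t)"
    and nl: "((\<lambda>t. half_weight k t * n t - B * cos (Theta k t - phase_shift k - pi * s)) \<longlongrightarrow> 0) (at_right 0)"
    by (elim exE conjE) (rule that)
  define T where "T = late_time k"
  define e where "e j = Theta k (T j) - phase_shift k - pi * (real j + 1 / 2)" for j
  have e: "e \<longlonglongrightarrow> 0" unfolding e_def[abs_def] T_def by (rule late_time_phase[OF k])
  note T0 = late_time_limits(6)[OF k, folded T_def]
  have Tpos: "\<forall>\<^sub>F j in sequentially. T j > 0" unfolding T_def by (rule late_time_pos[OF k])
  have c1: "cos (Theta k (T j) - phase_shift k - pi * s) = - ((- 1) ^ j * sin (e j - pi * s))" for j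
  proof -
    have "Theta k (T j) - phase_shift k - pi * s = pi * (real j + 1 / 2) + (e j - pi * s)" by (simp add: e_def)
    then show ?thesis by (simp only: trig_shift)
  qed
  have c2: "cos (Theta k (T j) - phase_shift k) + sin (Theta k (T j) - phase_shift k) = (- 1) ^ j * (cos (e j) - sin (e j))" for j
  proof -
    have "Theta k (T j) - phase_shift k = pi * (real j + 1 / 2) + e j" by (simp add: e_def)
    then show ?thesis by (simp only: trig_shift) (simp add: algebra_simps)
  qed
  have sq: "(- 1) ^ j * ((- 1) ^ j * x) = x" for j and x :: real
    unfolding mult.assoc[symmetric] power_mult_distrib[symmetric] by simp
  have sign0: "(\<lambda>j. (- 1) ^ j * g j) \<longlonglongrightarrow> 0" if "g \<longlonglongrightarrow> 0" for g :: "nat \<Rightarrow> real"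
    using that by (intro tendsto_rabs_zero_cancel[of "\<lambda>j. (- 1) ^ j * g j"]) (simp add: abs_mult tendsto_rabs_zero)
  have N: "(\<lambda>j. (- 1) ^ j * (half_weight k (T j) * n (T j))) \<longlonglongrightarrow> B * sin (pi * s)"
  proof -
    have "(\<lambda>j. (- 1) ^ j * (half_weight k (T j) * n (T j) - B * cos (Theta k (T j) - phase_shift k - pi * s)) + - (B * sin (e j - pi * s))) \<longlonglongrightarrow> 0 + - (B * sin (0 - pi * s))"
      by (intro tendsto_add sign0 filterlim_compose[OF nl T0] tendsto_intros e)
    moreover have "(- 1) ^ j * (half_weight k (T j) * n (T j) - B * cos (Theta k (T j) - phase_shift k - pi * s)) + - (B * sin (e j - pi * s)) = (- 1) ^ j * (half_weight k (T j) * n (T j))" for j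
      unfolding c1 using sq[of j "B * sin (e j - pi * s)"] by (simp add: algebra_simps)
    ultimately show ?thesis by simp
  qed
  have D: "(\<lambda>j. (- 1) ^ j * (half_weight k (T j) * T j * f' (T j) / Theta k (T j))) \<longlonglongrightarrow> - (B / 2)"
  proof -
    have "(\<lambda>j. (- 1) ^ j * (half_weight k (T j) * T j * f' (T j) / Theta k (T j) + B / 2 * (cos (Theta k (T j) - phase_shift k) + sin (Theta k (T j) - phase_shift k))) - B / 2 * (cos (e j) - sin (e j))) \<longlonglongrightarrow> 0 - B / 2 * (cos 0 - sin 0)"
      by (intro tendsto_diff sign0 filterlim_compose[OF fl' T0] tendsto_intros e)
    moreover have "(- 1) ^ j * (half_weight k (T j) * T j * f' (T j) / Theta k (T j) + B / 2 * (cos (Theta k (T j) - phase_shift k) + sin (Theta k (T j) - phase_shift k))) - B / 2 * (cos (e j) - sin (e j)) = (- 1) ^ j * (half_weight k (T j) * T j * f' (T j) / Theta k (T j))" for j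
      unfolding c2 using sq[of j "B / 2 * (cos (e j) - sin (e j))"] by (simp add: distrib_left mult.left_commute)
    ultimately show ?thesis by simp
  qed
  have "- (B / 2) \<noteq> 0" using B by simp
  from tendsto_imp_eventually_ne[OF D this] have f'0: "\<forall>\<^sub>F j in sequentially. f' (T j) \<noteq> 0"
    by eventually_elim auto
  have L: "(\<lambda>j. ((- 1) ^ j * (half_weight k (T j) * n (T j))) / ((- 1) ^ j * (half_weight k (T j) * T j * f' (T j) / Theta k (T j)))) \<longlonglongrightarrow> B * sin (pi * s) / - (B / 2)"
    by (intro tendsto_divide N D) fact
  have "(\<lambda>j. n (T j) * Theta k (T j) / (T j * f' (T j))) \<longlonglongrightarrow> - 2 * sin (pi * s)"
  proof -
    have "B * sin (pi * s) / - (B / 2) = - 2 * sin (pi * s)" using B by (simp add: field_simps)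
    moreover have "\<forall>\<^sub>F j in sequentially. ((- 1) ^ j * (half_weight k (T j) * n (T j))) / ((- 1) ^ j * (half_weight k (T j) * T j * f' (T j) / Theta k (T j))) = n (T j) * Theta k (T j) / (T j * f' (T j))"
      using Tpos
    proof eventually_elim
      case (elim j)
      show ?case using half_weight_pos[OF elim, of k] by simp
    qed
    ultimately show ?thesis using Lim_transform_eventually[OF L] by simp
  qed
  then show ?thesis
    using eventually_compose_filterlim[OF n T0] eventually_compose_filterlim[OF f' T0] f'0
    unfolding T_def by (intro exI[of _ n] exI[of _ f'] conjI)
qed

text \<open>Far windows involve only small t, where every other denominator is nonzero, so poles in
  the window correspond to zeros at z = -1. The residue is - x n / (d a f'). With n Theta / (t f')
  tending to - 2 sin (pi / a), t = pi^3 k / (3 Theta^2) and Theta ~ pi j, it behaves like 2 k sin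
  (pi / a) / (3 a d j^3).\<close>

lemma late_pole_eq:
  assumes a: "a \<ge> 2" and k: "k \<ge> 1" and d: "d \<ge> 1" "even d"
  shows "\<forall>\<^sub>F j in sequentially. late_index a d k j \<and> late_pole a d k j = exp (- late_time k j / real a)"
    and "\<exists>R. (\<forall>\<^sub>F j in sequentially. residue (W a d k) (of_real (late_pole a d k j)) = of_real (R j)) \<and>
          (\<lambda>j. R j * real j ^ 3) \<longlonglongrightarrow> 2 * real k * sin (pi / real a) / (3 * real a * real d)"
proof -
  define T where "T = late_time k"
  define x where "x j = exp (- T j / real a)" for j
  have a1: "a \<ge> 1" and ra: "0 < 1 / real a" "1 / real a \<le> 1" using a by auto
  obtain n f' where n: "\<forall>\<^sub>F j in sequentially. twisted_sum k (- 1) (1 / real a) (of_real (T j)) = of_real (n (T j))"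
    and f': "\<forall>\<^sub>F j in sequentially. twisted_sum' k (- 1) 1 (of_real (T j)) = of_real (f' (T j))"
    and f'0: "\<forall>\<^sub>F j in sequentially. f' (T j) \<noteq> 0"
    and L: "(\<lambda>j. n (T j) * Theta k (T j) / (T j * f' (T j))) \<longlonglongrightarrow> - 2 * sin (pi * (1 / real a))"
    using late_time_amplitudes[OF k ra, folded T_def] by (elim exE conjE) (rule that)
  have sin_pos: "sin (pi * (1 / real a)) > 0"
    using a by (intro sin_gt_zero) (auto simp: divide_less_eq)
  then have "- 2 * sin (pi * (1 / real a)) \<noteq> 0" by simp
  from tendsto_imp_eventually_ne[OF L this] have n0: "\<forall>\<^sub>F j in sequentially. n (T j) \<noteq> 0"
    by eventually_elim auto
  note lt = late_time[OF k, folded T_def]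
  have "\<forall>\<^sub>F t in at_right 0. \<forall>z\<in>{z. z ^ d = 1} - {- 1}. twisted_sum k z 1 (of_real t) \<noteq> 0"
    using finite_roots[OF d(1)] norm_root_of_unity[OF _ d(1)]
    by (intro eventually_ball_finite ballI twisted_sum_nonzero[OF k]) auto
  then obtain b where b: "b > 0" "\<And>t. 0 < t \<Longrightarrow> t < b \<Longrightarrow> \<forall>z\<in>{z. z ^ d = 1} - {- 1}. twisted_sum k z 1 (of_real t) \<noteq> 0"
    unfolding eventually_at_right_field by auto
  have large: "\<forall>\<^sub>F j in sequentially. phase_shift k + pi * (real j + 1 / 2) - pi / 4 \<ge> max 0 (Theta k b)"
  proof -
    have "filterlim (\<lambda>j. phase_shift k + pi * (real j + 1 / 2) - pi / 4) at_top sequentially" by real_asymp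
    then show ?thesis unfolding filterlim_at_top by (rule spec)
  qed
  have main: "\<forall>\<^sub>F j in sequentially. pole_in_window a d k j = (\<lambda>y. y = x j) \<and>
      residue (W a d k) (of_real (x j)) = of_real (- (x j * n (T j)) / (real d * real a * f' (T j)))"
    using n f' f'0 n0 lt large
  proof eventually_elim
    case (elim j)
    \<comment> \<open>Theta decreases in t, so a window above Theta b admits only t < b.\<close>
    have tsmall: "t < b" if "t > 0" "\<bar>Theta k t - phase_shift k - pi * (real j + 1 / 2)\<bar> < pi / 4" for t
    proof (rule ccontr)
      assume "\<not> t < b"
      then have "Theta k t \<le> Theta k b" using b(1) that(1) unfolding Theta_def
        by (intro mult_left_mono real_sqrt_le_mono divide_left_mono) auto
      then show False using that(2) elim(6) by linarith
    qed
    have nz: "twisted_sum k z 1 (of_real t) \<noteq> 0"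
      if "t > 0" "\<bar>Theta k t - phase_shift k - pi * (real j + 1 / 2)\<bar> < pi / 4" "z ^ d = 1" "z \<noteq> - 1" for t z
      using b(2)[OF that(1) tsmall[OF that(1,2)]] that(3,4) by blast
    have Tj: "T j > 0" "\<bar>Theta k (T j) - phase_shift k - pi * (real j + 1 / 2)\<bar> < pi / 4" "twisted_sum k (- 1) 1 (of_real (T j)) = 0"
      using elim(5) by blast+
    have n_ne: "twisted_sum k (- 1) (1 / real a) (of_real (T j)) \<noteq> 0" unfolding elim(1) using elim(4) by simp
    have f_ne: "twisted_sum' k (- 1) 1 (of_real (T j)) \<noteq> 0" unfolding elim(2) using elim(3) by simp
    note wp = W_pole_analysis(2)[OF a1 d Tj(1) x_def nz[OF Tj(1,2)] Tj(3) n_ne f_ne]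
    have "pole_in_window a d k j y \<longleftrightarrow> y = x j" for y
    proof
      assume "pole_in_window a d k j y"
      then obtain t where t: "t > 0" "y = exp (- t / real a)" "\<bar>Theta k t - phase_shift k - pi * (real j + 1 / 2)\<bar> < pi / 4"
        and pole: "is_pole (W a d k) (of_real y)"
        unfolding pole_in_window_def by blast
      have "twisted_sum k (- 1) 1 (of_real t) = 0"
        using W_pole_analysis(1)[OF a1 d t(1,2) nz[OF t(1,3)]] pole by blast
      then have "t = T j" using elim(5) t by blast
      then show "y = x j" using t(2) by (simp add: x_def)
    next
      assume "y = x j"
      then show "pole_in_window a d k j y" unfolding pole_in_window_def
        using wp Tj by (auto simp: x_def)
    qed
    moreover have "residue (W a d k) (of_real (x j)) = of_real (- (x j * n (T j)) / (real d * real a * f' (T j)))"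
      using wp unfolding elim(1,2) by (simp add: mult_ac)
    ultimately show ?case by (simp add: fun_eq_iff)
  qed
  then show *: "\<forall>\<^sub>F j in sequentially. late_index a d k j \<and> late_pole a d k j = exp (- late_time k j / real a)"
    by eventually_elim (simp add: late_index_def late_pole_def x_def T_def)
  define u where "u j = Theta k (T j)" for j
  note ul = late_time_limits[OF k, folded T_def, folded u_def]
  have x1: "x \<longlonglongrightarrow> 1"
  proof -
    have "T \<longlonglongrightarrow> 0" using ul(6) by (simp add: filterlim_at)
    then have "(\<lambda>j. exp (- T j / real a)) \<longlonglongrightarrow> exp (- 0 / real a)" using a by (intro tendsto_intros) auto
    then show ?thesis by (simp add: x_def[abs_def])
  qed
  define R where "R j = - (x j * n (T j)) / (real d * real a * f' (T j))" for j
  have "(\<lambda>j. - (1 / (real d * real a)) * x j * (n (T j) * u j / (T j * f' (T j))) * (pi ^ 3 * real k / 3 * inverse ((u j / real j) ^ 3))) \<longlonglongrightarrow>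
     - (1 / (real d * real a)) * 1 * (- 2 * sin (pi * (1 / real a))) * (pi ^ 3 * real k / 3 * inverse (pi ^ 3))"
    by (intro tendsto_mult tendsto_const x1 L[folded u_def] tendsto_inverse tendsto_power ul(2)) simp
  moreover have "- (1 / (real d * real a)) * 1 * (- 2 * sin (pi * (1 / real a))) * (pi ^ 3 * real k / 3 * inverse (pi ^ 3)) = 2 * real k * sin (pi / real a) / (3 * real a * real d)"
    using a d by (simp add: divide_simps)
  ultimately have lim: "(\<lambda>j. - (1 / (real d * real a)) * x j * (n (T j) * u j / (T j * f' (T j))) * (pi ^ 3 * real k / 3 * inverse ((u j / real j) ^ 3))) \<longlonglongrightarrow>
      2 * real k * sin (pi / real a) / (3 * real a * real d)"
    by (simp only:)
  have ev: "\<forall>\<^sub>F j in sequentially. - (1 / (real d * real a)) * x j * (n (T j) * u j / (T j * f' (T j))) * (pi ^ 3 * real k / 3 * inverse ((u j / real j) ^ 3)) = R j * real j ^ 3"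
    using ul(5) late_time_pos[OF k, folded T_def] f'0
  proof eventually_elim
    case (elim j)
    have uj: "u j > 0" using Theta_pos[OF k] elim(2) by (simp add: u_def)
    have T_eq: "T j = pi ^ 3 * real k / (3 * (u j)\<^sup>2)" using elim(1) by (simp add: inverse_phase_def)
    have C: "pi ^ 3 * real k / 3 = T j * (u j)\<^sup>2" unfolding T_eq using uj by simp
    have Tj: "T j > 0" by (rule elim(2))
    have aux: "m * v / (r * f) * (r * v\<^sup>2 * inverse ((v / y) ^ 3)) = m / f * y ^ 3" if "v > 0" "r > 0" "f \<noteq> 0" for m v r f y :: real
      using that by (simp add: power_divide power2_eq_square power3_eq_cube)
    from aux[OF uj Tj elim(3), of "n (T j)" "real j"]
    have "- (1 / (real d * real a)) * x j * (n (T j) * u j / (T j * f' (T j)) * (T j * (u j)\<^sup>2 * inverse ((u j / real j) ^ 3))) = - (1 / (real d * real a)) * x j * (n (T j) / f' (T j) * real j ^ 3)"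
      by (rule arg_cong)
    moreover have "- (1 / (real d * real a)) * x j * (n (T j) / f' (T j) * real j ^ 3) = R j * real j ^ 3"
      by (simp add: R_def mult_ac)
    ultimately show ?case unfolding C by (simp only: mult.assoc)
  qed
  have "(\<lambda>j. R j * real j ^ 3) \<longlonglongrightarrow> 2 * real k * sin (pi / real a) / (3 * real a * real d)"
    by (rule Lim_transform_eventually[OF lim ev])
  moreover have "\<forall>\<^sub>F j in sequentially. residue (W a d k) (of_real (late_pole a d k j)) = of_real (R j)"
    using main * by eventually_elim (simp add: R_def x_def T_def)
  ultimately show "\<exists>R. (\<forall>\<^sub>F j in sequentially. residue (W a d k) (of_real (late_pole a d k j)) = of_real (R j)) \<and>
          (\<lambda>j. R j * real j ^ 3) \<longlonglongrightarrow> 2 * real k * sin (pi / real a) / (3 * real a * real d)" by blast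
qed

text \<open>Leading-order asymptotics of the times would not determine a difference; the o(1)
  precision of the phase does. With T = C / u^2 the difference is C (u' - u) (u' + u) / (u^2 u'^2),
  where u' is the next phase, u' - u tends to pi and both are ~ pi j. Passing to exp (- T / a)
  changes nothing to leading order, as the poles tend to 1.\<close>

lemma late_pole_gap:
  assumes a: "a \<ge> 2" and k: "k \<ge> 1" and d: "d \<ge> 1" "even d"
  shows "(\<lambda>j. (late_pole a d k (j + 1) - late_pole a d k j) * real j ^ 3) \<longlonglongrightarrow> 2 * pi * real k / (3 * real a)"
proof -
  define T where "T = late_time k"
  define x where "x j = exp (- T j / real a)" for j
  define u where "u j = Theta k (T j)" for j
  note ul = late_time_limits[OF k, folded T_def, folded u_def]
  have x1: "x \<longlonglongrightarrow> 1"
  proof -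
    have "T \<longlonglongrightarrow> 0" using ul(6) by (simp add: filterlim_at)
    then have "(\<lambda>j. exp (- T j / real a)) \<longlonglongrightarrow> exp (- 0 / real a)" using a by (intro tendsto_intros) auto
    then show ?thesis by (simp add: x_def[abs_def])
  qed
  define \<Delta> where "\<Delta> j = (T j - T (Suc j)) / real a" for j
  define C where "C = pi ^ 3 * real k / 3"
  have lim0: "(\<lambda>j. C / real a * (u (Suc j) - u j) * (u (Suc j) / real j + u j / real j) * inverse ((u j / real j)\<^sup>2 * (u (Suc j) / real j)\<^sup>2)) \<longlonglongrightarrow>
     C / real a * pi * (pi + pi) * inverse (pi\<^sup>2 * pi\<^sup>2)"
    by (intro tendsto_mult tendsto_const tendsto_add tendsto_inverse tendsto_power ul(2,3,4)) simp
  have eqD: "\<forall>\<^sub>F j in sequentially. C / real a * (u (Suc j) - u j) * (u (Suc j) / real j + u j / real j) * inverse ((u j / real j)\<^sup>2 * (u (Suc j) / real j)\<^sup>2) = \<Delta> j * real j ^ 3"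
    using ul(5) eventually_sequentially_Suc[THEN iffD2, OF ul(5)]
      filterlim_at_top_dense[THEN iffD1, OF ul(1), rule_format, of 0]
      eventually_sequentially_Suc[THEN iffD2, OF filterlim_at_top_dense[THEN iffD1, OF ul(1), rule_format, of 0]] eventually_gt_at_top[of 0]
  proof eventually_elim
    case (elim j)
    have T1: "T j = C / (u j)\<^sup>2" "T (Suc j) = C / (u (Suc j))\<^sup>2" using elim(1,2) by (simp_all add: inverse_phase_def C_def)
    have "(v - w) * (v / y + w / y) * inverse ((w / y)\<^sup>2 * (v / y)\<^sup>2) = (1 / w\<^sup>2 - 1 / v\<^sup>2) * y ^ 3" if "v > 0" "w > 0" "y > 0" for v w y :: real
    proof -
      define b c where "b = w / y" and "c = v / y"
      have bc: "w = b * y" "v = c * y" and pos: "b > 0" "c > 0" using that by (simp_all add: b_def c_def)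
      have "(c - b) * (c + b) * inverse (b\<^sup>2 * c\<^sup>2) = 1 / b\<^sup>2 - 1 / c\<^sup>2"
        using pos by (simp add: divide_simps) (simp add: algebra_simps power2_eq_square)
      then have "y * ((c - b) * (c + b) * inverse (b\<^sup>2 * c\<^sup>2)) = y * (1 / b\<^sup>2 - 1 / c\<^sup>2)" by (rule arg_cong)
      moreover have "v - w = y * (c - b)" unfolding bc by (simp add: algebra_simps)
      moreover have "(1 / w\<^sup>2 - 1 / v\<^sup>2) * y ^ 3 = y * (1 / b\<^sup>2 - 1 / c\<^sup>2)"
        unfolding bc power_mult_distrib left_diff_distrib right_diff_distrib using that by (simp add: power2_eq_square power3_eq_cube)
      ultimately show ?thesis unfolding b_def[symmetric] c_def[symmetric] by (simp only: mult.assoc)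
    qed
    from this[OF elim(4,3), of "real j"] elim(5)
    have "(u (Suc j) - u j) * (u (Suc j) / real j + u j / real j) * inverse ((u j / real j)\<^sup>2 * (u (Suc j) / real j)\<^sup>2) = (1 / (u j)\<^sup>2 - 1 / (u (Suc j))\<^sup>2) * real j ^ 3" by simp
    then have "C / real a * ((u (Suc j) - u j) * (u (Suc j) / real j + u j / real j) * inverse ((u j / real j)\<^sup>2 * (u (Suc j) / real j)\<^sup>2)) = C / real a * ((1 / (u j)\<^sup>2 - 1 / (u (Suc j))\<^sup>2) * real j ^ 3)" by (rule arg_cong)
    moreover have "C / real a * ((1 / (u j)\<^sup>2 - 1 / (u (Suc j))\<^sup>2) * real j ^ 3) = \<Delta> j * real j ^ 3"
      unfolding \<Delta>_def T1 by (simp add: diff_divide_distrib left_diff_distrib right_diff_distrib mult.commute[of "real a"])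
    ultimately show ?case by (simp only: mult.assoc)
  qed
  have D: "(\<lambda>j. \<Delta> j * real j ^ 3) \<longlonglongrightarrow> 2 * pi * real k / (3 * real a)"
  proof -
    have "C / real a * pi * (pi + pi) * inverse (pi\<^sup>2 * pi\<^sup>2) = 2 * pi * real k / (3 * real a)"
      unfolding C_def by (simp add: field_simps power2_eq_square power3_eq_cube)
    then show ?thesis using Lim_transform_eventually[OF lim0 eqD] by simp
  qed
  have L0: "2 * pi * real k / (3 * real a) > 0" using a k by simp
  have \<Delta>0: "filterlim \<Delta> (at 0) sequentially"
  proof -
    have "T \<longlonglongrightarrow> 0" using ul(6) by (simp add: filterlim_at)
    then have "(\<lambda>j. (T j - T (Suc j)) / real a) \<longlonglongrightarrow> (0 - 0) / real a" using a by (intro tendsto_intros LIMSEQ_Suc) auto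
    then have "\<Delta> \<longlonglongrightarrow> 0" by (simp add: \<Delta>_def[abs_def])
    moreover have "\<forall>\<^sub>F j in sequentially. \<Delta> j \<noteq> 0"
      using order_tendstoD(1)[OF D L0] by eventually_elim auto
    ultimately show ?thesis by (simp add: filterlim_at)
  qed
  have "((\<lambda>y::real. (exp y - 1) / y) \<longlongrightarrow> 1) (at 0)"
    using DERIV_exp[of "0::real"] by (simp add: has_field_derivative_iff)
  from filterlim_compose[OF this \<Delta>0] have E: "(\<lambda>j. (exp (\<Delta> j) - 1) / \<Delta> j) \<longlonglongrightarrow> 1" .
  have "(\<lambda>j. x j * ((exp (\<Delta> j) - 1) / \<Delta> j) * (\<Delta> j * real j ^ 3)) \<longlonglongrightarrow> 1 * 1 * (2 * pi * real k / (3 * real a))"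
    by (intro tendsto_mult x1 E D)
  then have G: "(\<lambda>j. x j * ((exp (\<Delta> j) - 1) / \<Delta> j) * (\<Delta> j * real j ^ 3)) \<longlonglongrightarrow> 2 * pi * real k / (3 * real a)" by simp
  note lp = late_pole_eq(1)[OF a k d, folded T_def]
  show ?thesis
  proof (rule Lim_transform_eventually[OF G])
    show "\<forall>\<^sub>F j in sequentially. x j * ((exp (\<Delta> j) - 1) / \<Delta> j) * (\<Delta> j * real j ^ 3) = (late_pole a d k (j + 1) - late_pole a d k j) * real j ^ 3"
      using lp eventually_sequentially_Suc[THEN iffD2, OF lp] \<Delta>0[unfolded filterlim_at, THEN conjunct1]
    proof eventually_elim
      case (elim j)
      have "x j * exp (\<Delta> j) = x (Suc j)" unfolding x_def \<Delta>_def exp_add[symmetric] using a by (simp add: field_simps)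
      then have "x (Suc j) - x j = x j * (exp (\<Delta> j) - 1)" by (simp add: right_diff_distrib)
      moreover have "late_pole a d k (j + 1) = x (Suc j)" "late_pole a d k j = x j" using elim by (simp_all add: x_def)
      ultimately show ?case using elim(3) by simp
    qed
  qed
qed

text \<open>Monotonicity of Theta turns both conditions on the pole into conditions on its phase.
  The windows have spacing pi, so the count is U / pi + O(1), using only that each pole lies in its
  window. Finally 1 / sqrt (- ln (1 - \<epsilon>)) differs from \<epsilon>^(-1/2) by o(1).\<close>

lemma late_pole_count:
  assumes a: "a \<ge> 2" and k: "k \<ge> 1" and d: "d \<ge> 1" "even d" and q0: "0 < q0" "q0 < 1"
  shows "(\<lambda>\<epsilon>. real (card {j. late_index a d k j \<and> q0 \<le> late_pole a d k j \<and> late_pole a d k j \<le> 1 - \<epsilon>})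
                  - sqrt (pi * real k / (3 * real a)) * \<epsilon> powr (- 1 / 2))
            \<in> O[at_right 0](\<lambda>_. 1)"
proof -
  define \<phi> where "\<phi> = phase_shift k"
  define S where "S \<epsilon> = {j. late_index a d k j \<and> q0 \<le> late_pole a d k j \<and> late_pole a d k j \<le> 1 - \<epsilon>}" for \<epsilon>
  define U where "U \<epsilon> = Theta k (- real a * ln (1 - \<epsilon>))" for \<epsilon>
  define U0 where "U0 = Theta k (- real a * ln q0)"
  have ap: "real a > 0" using a by simp
  have Theta_le: "Theta k t \<le> Theta k t' \<longleftrightarrow> t' \<le> t" if "t > 0" "t' > 0" for t t'
  proof -
    have kp: "real k > 0" using k by simp
    have "Theta k t \<le> Theta k t' \<longleftrightarrow> real k / (3 * t) \<le> real k / (3 * t')"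
      unfolding Theta_def mult_le_cancel_left real_sqrt_le_iff by simp
    also have "\<dots> \<longleftrightarrow> t' \<le> t"
    proof
      assume le: "real k / (3 * t) \<le> real k / (3 * t')"
      show "t' \<le> t"
      proof (rule ccontr)
        assume "\<not> t' \<le> t"
        then have "real k / (3 * t') < real k / (3 * t)" using that kp by (intro divide_strict_left_mono) auto
        with le show False by linarith
      qed
    next
      assume "t' \<le> t"
      then show "real k / (3 * t) \<le> real k / (3 * t')" using that kp by (intro divide_left_mono) auto
    qed
    finally show ?thesis .
  qed
  have late: "\<exists>t>0. late_pole a d k j = exp (- t / real a) \<and> \<bar>Theta k t - \<phi> - pi * (real j + 1 / 2)\<bar> < pi / 4" if "late_index a d k j" for j
  proof -
    have "pole_in_window a d k j (late_pole a d k j)"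
      unfolding late_pole_def by (rule theI'[OF that[unfolded late_index_def]])
    then show ?thesis unfolding pole_in_window_def \<phi>_def by blast
  qed
  have cmp1: "exp (- t / real a) \<le> 1 - \<epsilon> \<longleftrightarrow> Theta k t \<le> U \<epsilon>" if "t > 0" "0 < \<epsilon>" "\<epsilon> < 1" for t \<epsilon>
  proof -
    have "exp (- t / real a) \<le> 1 - \<epsilon> \<longleftrightarrow> - t / real a \<le> ln (1 - \<epsilon>)"
      using that exp_le_cancel_iff[of "- t / real a" "ln (1 - \<epsilon>)"] by simp
    also have "\<dots> \<longleftrightarrow> - real a * ln (1 - \<epsilon>) \<le> t"
      unfolding pos_divide_le_eq[OF ap]
      using minus_le_iff[of t "ln (1 - \<epsilon>) * real a"] by (simp only: mult_minus_left mult.commute)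
    also have "\<dots> \<longleftrightarrow> Theta k t \<le> U \<epsilon>"
      unfolding U_def using that a by (intro Theta_le[symmetric]) (auto simp: mult_pos_neg)
    finally show ?thesis .
  qed
  have cmp2: "q0 \<le> exp (- t / real a) \<longleftrightarrow> U0 \<le> Theta k t" if "t > 0" for t
  proof -
    have "q0 \<le> exp (- t / real a) \<longleftrightarrow> ln q0 \<le> - t / real a"
      using q0 exp_le_cancel_iff[of "ln q0" "- t / real a"] by simp
    also have "\<dots> \<longleftrightarrow> t \<le> - real a * ln q0"
      unfolding pos_le_divide_eq[OF ap]
      using le_minus_iff[of "ln q0 * real a" t] by (simp only: minus_mult_left[symmetric] mult.commute[of "ln q0"])
    also have "\<dots> \<longleftrightarrow> U0 \<le> Theta k t"
      unfolding U0_def using that a q0 by (intro Theta_le[symmetric]) (auto simp: mult_pos_neg)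
    finally show ?thesis .
  qed
  obtain J1 where J1: "\<And>j. j \<ge> J1 \<Longrightarrow> late_index a d k j"
    using late_pole_eq(1)[OF a k d] unfolding eventually_sequentially by blast
  \<comment> \<open>From J on every index is late and its whole window lies above \<open>U0\<close>,
    so the lower cutoff \<open>q0\<close> is automatic. The finitely many smaller indices go into
    the error.\<close>
  define J where "J = max J1 (nat \<lceil>(U0 - \<phi>) / pi\<rceil> + 1)"
  have bound: "\<bar>real (card (S \<epsilon>)) - U \<epsilon> / pi\<bar> \<le> \<bar>\<phi>\<bar> / pi + 5 + real J" if \<epsilon>: "0 < \<epsilon>" "\<epsilon> < 1" for \<epsilon>
  proof -
    define y where "y = (U \<epsilon> - \<phi>) / pi"
    have Upos: "U \<epsilon> > 0" unfolding U_def using \<epsilon> a by (intro Theta_pos[OF k]) (auto simp: mult_pos_neg)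
    have yU: "\<bar>y - U \<epsilon> / pi\<bar> = \<bar>\<phi>\<bar> / pi" by (simp add: y_def diff_divide_distrib abs_divide)
    have ypi: "pi * y = U \<epsilon> - \<phi>" by (simp add: y_def)
    \<comment> \<open>The window allows membership only for j < y - 1/4 and, for j \<ge> J,
      guarantees it for j \<le> y - 3/4. Rounding outwards to y + 1 and y - 1 costs only a
      constant.\<close>
    have sub1: "S \<epsilon> \<subseteq> {..<nat \<lceil>y + 1\<rceil>}"
    proof
      fix j assume j: "j \<in> S \<epsilon>"
      then obtain t where t: "t > 0" "late_pole a d k j = exp (- t / real a)" "\<bar>Theta k t - \<phi> - pi * (real j + 1 / 2)\<bar> < pi / 4"
        using late unfolding S_def by blast
      have "Theta k t \<le> U \<epsilon>" using j t cmp1[OF t(1) \<epsilon>] by (simp add: S_def)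
      then have "pi * (real j + 1 / 2) < pi * y + pi / 4" using t(3) ypi by linarith
      then have "pi * (real j + 1 / 2) < pi * (y + 1 / 4)" by (simp add: distrib_left)
      then have "real j + 1 / 2 < y + 1 / 4" unfolding mult_less_cancel_left_pos[OF pi_gt_zero] .
      then have "real j < y + 1" by simp
      then show "j \<in> {..<nat \<lceil>y + 1\<rceil>}" by (simp add: less_ceiling_iff zless_nat_conj) linarith
    qed
    have sub2: "{J..<nat \<lfloor>y - 1\<rfloor>} \<subseteq> S \<epsilon>"
    proof
      fix j assume j: "j \<in> {J..<nat \<lfloor>y - 1\<rfloor>}"
      then have li: "late_index a d k j" using J1 by (simp add: J_def)
      obtain t where t: "t > 0" "late_pole a d k j = exp (- t / real a)" "\<bar>Theta k t - \<phi> - pi * (real j + 1 / 2)\<bar> < pi / 4"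
        using late[OF li] by blast
      have "real j \<le> y - 1" using j by (simp add: zless_nat_conj) linarith
      then have "pi * (real j + 1 / 2 + 1 / 4) \<le> pi * y" by (intro mult_left_mono) auto
      then have "pi * (real j + 1 / 2) + pi / 4 \<le> pi * y" by (simp only: distrib_left[of pi _ "1 / 4"] times_divide_eq_right mult_1_right)
      then have "Theta k t \<le> U \<epsilon>" using t(3) ypi by linarith
      then have 1: "late_pole a d k j \<le> 1 - \<epsilon>" using cmp1[OF t(1) \<epsilon>] t(2) by simp
      have "(U0 - \<phi>) / pi \<le> real j" using j unfolding J_def by (simp add: J_def) linarith
      then have "U0 - \<phi> \<le> pi * real j" by (simp add: divide_le_eq mult.commute)
      moreover have "pi * real j + pi / 4 = pi * (real j + 1 / 2) - pi / 4" by (simp add: distrib_left)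
      moreover have "pi / 4 \<ge> 0" by simp
      ultimately have "U0 \<le> Theta k t" using t(3) by linarith
      then have 2: "q0 \<le> late_pole a d k j" using cmp2[OF t(1)] t(2) by simp
      show "j \<in> S \<epsilon>" using li 1 2 by (simp add: S_def)
    qed
    have fin: "finite (S \<epsilon>)" using finite_subset[OF sub1] by simp
    have "card (S \<epsilon>) \<le> nat \<lceil>y + 1\<rceil>" using card_mono[OF _ sub1] by simp
    then have up: "real (card (S \<epsilon>)) \<le> max 0 (y + 2)" by linarith
    have "nat \<lfloor>y - 1\<rfloor> - J \<le> card (S \<epsilon>)" using card_mono[OF fin sub2] by simp
    then have low: "y - 2 - real J \<le> real (card (S \<epsilon>))" by linarith
    have "U \<epsilon> / pi \<ge> 0" using Upos by simp
    then show ?thesis using up low yU by linarith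
  qed
  define K where "K = sqrt (pi * real k / (3 * real a))"
  have U_eq: "U \<epsilon> / pi = K / sqrt (- ln (1 - \<epsilon>))" if "0 < \<epsilon>" "\<epsilon> < 1" for \<epsilon>
  proof -
    define L where "L = - ln (1 - \<epsilon>)"
    have L: "L > 0" using that by (simp add: L_def)
    have "(U \<epsilon> / pi)\<^sup>2 = (K / sqrt L)\<^sup>2"
    proof -
      have "- real a * ln (1 - \<epsilon>) = real a * L" by (simp add: L_def)
      then have "(U \<epsilon>)\<^sup>2 = pi ^ 3 * real k / (3 * (real a * L))"
        unfolding U_def using Theta_squared[of "real a * L" k] L a by simp
      then have "(U \<epsilon> / pi)\<^sup>2 = pi * real k / (3 * (real a * L))"
        by (simp add: power_divide power2_eq_square power3_eq_cube)
      also have "\<dots> = (K / sqrt L)\<^sup>2" using L by (simp add: K_def power_divide)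
      finally show ?thesis .
    qed
    moreover have "U \<epsilon> > 0" unfolding U_def using that a by (intro Theta_pos[OF k]) (auto simp: mult_pos_neg)
    then have "U \<epsilon> / pi \<ge> 0" by simp
    moreover have "K / sqrt L \<ge> 0" using L by (simp add: K_def)
    ultimately show ?thesis unfolding L_def by (simp add: power2_eq_iff_nonneg)
  qed
  have "((\<lambda>\<epsilon>::real. 1 / sqrt (- ln (1 - \<epsilon>)) - \<epsilon> powr (- 1 / 2)) \<longlongrightarrow> 0) (at_right 0)" by real_asymp
  from tendstoD[OF this zero_less_one]
  have "\<forall>\<^sub>F \<epsilon>::real in at_right 0. \<bar>1 / sqrt (- ln (1 - \<epsilon>)) - \<epsilon> powr (- 1 / 2)\<bar> < 1"
    unfolding dist_real_def diff_0_right .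
  moreover have "\<forall>\<^sub>F \<epsilon>::real in at_right 0. 0 < \<epsilon> \<and> \<epsilon> < 1" by (rule eventually_at_right_real[of 0 1, simplified])
  ultimately have ev: "\<forall>\<^sub>F \<epsilon> in at_right 0. norm (real (card (S \<epsilon>)) - K * \<epsilon> powr (- 1 / 2)) \<le> (\<bar>\<phi>\<bar> / pi + 5 + real J + K) * norm (1::real)"
  proof eventually_elim
    case (elim \<epsilon>)
    have K0: "K \<ge> 0" by (simp add: K_def)
    have "\<bar>K * (1 / sqrt (- ln (1 - \<epsilon>)) - \<epsilon> powr (- 1 / 2))\<bar> \<le> K * 1"
      unfolding abs_mult using elim K0 by (intro mult_mono) auto
    moreover have "K * (1 / sqrt (- ln (1 - \<epsilon>)) - \<epsilon> powr (- 1 / 2)) = U \<epsilon> / pi - K * \<epsilon> powr (- 1 / 2)"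
      using U_eq[of \<epsilon>] elim by (simp add: right_diff_distrib)
    ultimately have "\<bar>U \<epsilon> / pi - K * \<epsilon> powr (- 1 / 2)\<bar> \<le> K" by (simp only: mult_1_right)
    moreover note bound[OF elim(2)[THEN conjunct1] elim(2)[THEN conjunct2]]
    ultimately show ?case unfolding real_norm_def abs_one mult_1_right by linarith
  qed
  show ?thesis using bigoI[OF ev] unfolding S_def K_def .
qed

theorem corollary4p9:
  fixes a d k :: nat
  assumes "a \<ge> 2" and "k \<ge> 1" and "d \<ge> 2" and "even d"
  shows "((\<lambda>j. late_pole a d k (j + 1) - late_pole a d k j)
            \<sim>[at_top] (\<lambda>j. 2 * pi * real k / (3 * real a * real j ^ 3))) \<and>
         ((\<lambda>j. residue (W a d k) (complex_of_real (late_pole a d k j)) /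
               complex_of_real (late_pole a d k (j + 1) - late_pole a d k j))
            \<longlonglongrightarrow> complex_of_real (sin (pi / real a) / (pi * real d))) \<and>
         (\<forall>\<^sub>F q0 in at_left (1::real).
            (\<lambda>\<epsilon>. real (card {j. late_index a d k j \<and>
                      q0 \<le> late_pole a d k j \<and> late_pole a d k j \<le> 1 - \<epsilon>})
                  - sqrt (pi * real k / (3 * real a)) * \<epsilon> powr (- 1 / 2))
            \<in> O[at_right 0](\<lambda>_. 1))"
proof (intro conjI)
  have d1: "d \<ge> 1" using assms(3) by simp
  define g where "g j = late_pole a d k (j + 1) - late_pole a d k j" for j
  define L where "L = 2 * pi * real k / (3 * real a)"
  have L: "L > 0" using assms by (simp add: L_def)
  have gap: "(\<lambda>j. g j * real j ^ 3) \<longlonglongrightarrow> L"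
    unfolding g_def L_def by (rule late_pole_gap[OF assms(1,2) d1 assms(4)])
  have jpos: "\<forall>\<^sub>F j::nat in sequentially. j > 0" by (rule eventually_gt_at_top)
  show "(\<lambda>j. late_pole a d k (j + 1) - late_pole a d k j) \<sim>[at_top] (\<lambda>j. 2 * pi * real k / (3 * real a * real j ^ 3))"
  proof (rule asymp_equivI')
    have "(\<lambda>j. g j * real j ^ 3 / L) \<longlonglongrightarrow> L / L" using gap L by (intro tendsto_divide tendsto_const) auto
    then have "(\<lambda>j. g j * real j ^ 3 / L) \<longlonglongrightarrow> 1" using L by simp
    then show "(\<lambda>j. (late_pole a d k (j + 1) - late_pole a d k j) / (2 * pi * real k / (3 * real a * real j ^ 3))) \<longlonglongrightarrow> 1"
      by (rule Lim_transform_eventually) (use jpos in \<open>eventually_elim, simp add: g_def L_def field_simps\<close>)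
  qed
  obtain R where R: "\<forall>\<^sub>F j in sequentially. residue (W a d k) (of_real (late_pole a d k j)) = of_real (R j)"
    and RL: "(\<lambda>j. R j * real j ^ 3) \<longlonglongrightarrow> 2 * real k * sin (pi / real a) / (3 * real a * real d)"
    using late_pole_eq(2)[OF assms(1,2) d1 assms(4)] by (elim exE conjE) (rule that)
  \<comment> \<open>Residue and gap are both of order j^(-3) with nonzero gap constant, so the
    scaled limits can be divided.\<close>
  have "(\<lambda>j. (R j * real j ^ 3) / (g j * real j ^ 3)) \<longlonglongrightarrow> 2 * real k * sin (pi / real a) / (3 * real a * real d) / L"
    using L by (intro tendsto_divide RL gap) simp
  moreover have "2 * real k * sin (pi / real a) / (3 * real a * real d) / L = sin (pi / real a) / (pi * real d)"
    using assms by (simp add: L_def field_simps)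
  ultimately have "(\<lambda>j. complex_of_real ((R j * real j ^ 3) / (g j * real j ^ 3))) \<longlonglongrightarrow> of_real (sin (pi / real a) / (pi * real d))"
    by (intro tendsto_of_real) simp
  then show "(\<lambda>j. residue (W a d k) (complex_of_real (late_pole a d k j)) /
               complex_of_real (late_pole a d k (j + 1) - late_pole a d k j))
            \<longlonglongrightarrow> complex_of_real (sin (pi / real a) / (pi * real d))"
    by (rule Lim_transform_eventually) (use R jpos in \<open>eventually_elim, simp add: g_def\<close>)
  \<comment> \<open>The count estimate holds for every fixed q0 strictly between 0 and 1, hence for
    all q0 sufficiently close to 1 from the left.\<close>
  have "\<forall>\<^sub>F q0 in at_left (1::real). 0 < q0 \<and> q0 < 1"
    using eventually_at_left_real[of 0 "1::real"] by simp
  then show "\<forall>\<^sub>F q0 in at_left (1::real).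
            (\<lambda>\<epsilon>. real (card {j. late_index a d k j \<and>
                      q0 \<le> late_pole a d k j \<and> late_pole a d k j \<le> 1 - \<epsilon>})
                  - sqrt (pi * real k / (3 * real a)) * \<epsilon> powr (- 1 / 2))
            \<in> O[at_right 0](\<lambda>_. 1)"
    by eventually_elim (rule late_pole_count[OF assms(1,2) d1 assms(4)]; simp)
qed

end
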